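(* Let $n\ge 1$ be an integer. (Sufficiency) Let $1\le q<4$ and set $M_q=\lfloor\frac{2n}{4-q}\rfloor+1$. There is a constant $C$ depending only on $n$ and $q$ such that for every function $m\in L^q(\mathbb R^{2n})\cap\mathcal C^{M_q}(\mathbb R^{2n})$ satisfying $$\|\partial^\alpha m\|_{L^\infty}\le C_0<\infty\quad\text{for all multiindices }\alpha\text{ with }|\alpha|\le M_q,$$ the bilinear operator $T_m$ with multiplier $m$ satisfies $$\|T_m\|_{L^2\times L^2\to L^1}\le C\,C_0^{1-\frac q4}\,\|m\|_{L^q}^{\frac q4}.$$ (Converse) There is a function $m\in\bigcap_{q>4}L^q(\mathbb R^{2n})\cap\mathcal L^\infty(\mathbb R^{2n})$ such that the associated operator $T_m$ does not map $L^2(\mathbb R^n)\times L^2(\mathbb R^n)$ to $L^1(\mathbb R^n)$, i.e. $T_m$ is not bounded from $L^2\times L^2$ to $L^1$.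
   Context: The Fourier transform is $\widehat f(\xi)=\int_{\mathbb R^n} f(x)e^{-2\pi i x\cdot\xi}\,dx$. For a bounded function $m$ on $\mathbb R^{2n}$, the bilinear multiplier operator $T_m$ is defined on pairs of Schwartz functions $f,g$ on $\mathbb R^n$ by $$T_m(f,g)(x)=\int_{\mathbb R^n}\int_{\mathbb R^n} m(\xi,\eta)\widehat f(\xi)\widehat g(\eta)e^{2\pi i x\cdot(\xi+\eta)}\,d\xi\,d\eta .$$ $\|T_m\|_{L^2\times L^2\to L^1}$ denotes its norm from $L^2(\mathbb R^n)\times L^2(\mathbb R^n)$ to $L^1(\mathbb R^n)$, i.e. the smallest $A\in[0,\infty]$ with $\|T_m(f,g)\|_{L^1}\le A\|f\|_{L^2}\|g\|_{L^2}$ for all Schwartz $f,g$. $\lfloor b\rfloor$ denotes the integer part of $b$. $\mathcal C^M(\mathbb R^{2n})$ is the class of functions on $\mathbb R^{2n}$ whose partial derivatives of order up to and including $M$ are continuous. Finally, $$\mathcal L^\infty(\mathbb R^{2n})=\{m:\mathbb R^{2n}\to\mathbb C:\ \partial^\alpha m\text{ exists and }\|\partial^\alpha m\|_{L^\infty}<\infty\text{ for all multiindices }\alpha\}.$$ *)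

theory Defs
  imports "HOL-Analysis.Analysis" "HOL-Probability.Essential_Supremum"
begin

section \<open>Partial derivatives\<close>

definition partial_deriv ::
  "'a::euclidean_space \<Rightarrow> ('a \<Rightarrow> complex) \<Rightarrow> 'a \<Rightarrow> complex" where
  "partial_deriv b f x = vector_derivative (\<lambda>t. f (x + t *\<^sub>R b)) (at 0)"

text \<open>A multi-index of order \<open>k\<close> is represented by a list of \<open>k\<close> basis vectors, which also
  records the order in which the derivatives are taken (the last one first). For functions of
  class \<open>C\<^sup>k\<close> this order is immaterial.\<close>

definition multi_index :: "'a::euclidean_space list \<Rightarrow> bool" where
  "multi_index \<alpha> \<longleftrightarrow> set \<alpha> \<subseteq> Basis"

definition iter_partial ::
  "'a::euclidean_space list \<Rightarrow> ('a \<Rightarrow> complex) \<Rightarrow> 'a \<Rightarrow> complex" where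
  "iter_partial \<alpha> f = foldr partial_deriv \<alpha> f"

text \<open>Since \<^const>\<open>vector_derivative\<close> is total, existence of the iterated partial
  derivative at every point is a separate condition.\<close>

fun has_iter_partial :: "'a::euclidean_space list \<Rightarrow> ('a \<Rightarrow> complex) \<Rightarrow> bool" where
  "has_iter_partial [] f \<longleftrightarrow> True"
| "has_iter_partial (b # \<alpha>) f \<longleftrightarrow> has_iter_partial \<alpha> f \<and>
     (\<forall>x. (\<lambda>t::real. iter_partial \<alpha> f (x + t *\<^sub>R b)) differentiable (at 0))"

definition C_class :: "nat \<Rightarrow> ('a::euclidean_space \<Rightarrow> complex) \<Rightarrow> bool" where
  "C_class M f \<longleftrightarrow> (\<forall>\<alpha>. multi_index \<alpha> \<and> length \<alpha> \<le> M \<longrightarrow>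
     has_iter_partial \<alpha> f \<and> continuous_on UNIV (iter_partial \<alpha> f))"

definition schwartz :: "('a::euclidean_space \<Rightarrow> complex) \<Rightarrow> bool" where
  "schwartz f \<longleftrightarrow> (\<forall>M. C_class M f) \<and>
     (\<forall>\<alpha> N. multi_index \<alpha> \<longrightarrow>
        bounded (range (\<lambda>x. norm x ^ N *\<^sub>R iter_partial \<alpha> f x)))"

section \<open>Lebesgue spaces\<close>

definition in_Lp :: "real \<Rightarrow> ('a::euclidean_space \<Rightarrow> complex) \<Rightarrow> bool" where
  "in_Lp p f \<longleftrightarrow> f \<in> borel_measurable lborel \<and> integrable lborel (\<lambda>x. norm (f x) powr p)"

text \<open>The value is the \<open>L\<^sup>p\<close> norm only for functions satisfying \<open>in_Lp p\<close>.\<close>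

definition Lp_norm :: "real \<Rightarrow> ('a::euclidean_space \<Rightarrow> complex) \<Rightarrow> real" where
  "Lp_norm p f = (LINT x|lborel. norm (f x) powr p) powr (1 / p)"

text \<open>The \<open>L\<^sup>1\<close> and \<open>L\<^sup>\<infinity>\<close> norms are also needed with the value \<open>\<infinity>\<close>.\<close>

definition L1_norm :: "('a::euclidean_space \<Rightarrow> complex) \<Rightarrow> ennreal" where
  "L1_norm f = (\<integral>\<^sup>+ x. ennreal (norm (f x)) \<partial>lborel)"

definition Linf_norm :: "('a::euclidean_space \<Rightarrow> complex) \<Rightarrow> ennreal" where
  "Linf_norm f = esssup lborel (\<lambda>x. ennreal (norm (f x)))"

definition Linf_class :: "('a::euclidean_space \<Rightarrow> complex) \<Rightarrow> bool" where
  "Linf_class f \<longleftrightarrow> (\<forall>\<alpha>. multi_index \<alpha> \<longrightarrow>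
     has_iter_partial \<alpha> f \<and> Linf_norm (iter_partial \<alpha> f) < \<infinity>)"

section \<open>Bilinear multipliers\<close>

definition fourier :: "('a::euclidean_space \<Rightarrow> complex) \<Rightarrow> 'a \<Rightarrow> complex" where
  "fourier f \<xi> = (LINT x|lborel. f x * exp (- 2 * of_real pi * \<i> * of_real (x \<bullet> \<xi>)))"

definition bilinear_mult ::
  "('a::euclidean_space \<times> 'a \<Rightarrow> complex) \<Rightarrow> ('a \<Rightarrow> complex) \<Rightarrow> ('a \<Rightarrow> complex) \<Rightarrow> 'a \<Rightarrow> complex" where
  "bilinear_mult m f g x =
     (LINT \<xi>|lborel. LINT \<eta>|lborel.
        m (\<xi>, \<eta>) * fourier f \<xi> * fourier g \<eta> *
        exp (2 * of_real pi * \<i> * of_real (x \<bullet> (\<xi> + \<eta>))))"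

text \<open>The norm from \<open>L\<^sup>2 \<times> L\<^sup>2\<close> to \<open>L\<^sup>1\<close>, with value \<open>\<infinity>\<close> for unbounded operators. The
  infimum is attained, because \<open>L\<^sup>2\<close> norms of Schwartz functions are finite.\<close>

definition mult_norm :: "('a::euclidean_space \<times> 'a \<Rightarrow> complex) \<Rightarrow> ennreal" where
  "mult_norm m = Inf {A. \<forall>f g. schwartz f \<and> schwartz g \<longrightarrow>
     L1_norm (bilinear_mult m f g) \<le> A * ennreal (Lp_norm 2 f) * ennreal (Lp_norm 2 g)}"

end

theory Submission
  imports Defs "HOL-Probability.Probability"
begin

text \<open>
  For the sufficiency, let \<open>A\<^sub>l\<close> be convolution with the normalised indicator of a product of two balls
  of radius \<open>\<beta> ^ l\<close>, and put \<open>a\<^sub>0 = m\<close>, \<open>a\<^sub>l\<^sub>+\<^sub>1 = a\<^sub>l - A\<^sub>l a\<^sub>l\<close>, so that \<open>m\<close> is the sum of the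
  functions \<open>A\<^sub>l a\<^sub>l\<close>. Every factor \<open>1 - A\<^sub>l\<close> turns one bounded derivative of \<open>m\<close> into a factor
  \<open>\<beta> ^ l\<close>, hence \<open>a\<^sub>l = O(C\<^sub>0 2 ^ l \<beta> ^ (M l))\<close>, while the \<open>L\<^sup>q\<close> norms grow at most
  geometrically with a ratio independent of \<open>\<beta>\<close>. The multiplier \<open>A\<^sub>l a\<^sub>l\<close> is a superposition of
  tensor products; a splitting of \<open>a\<^sub>l\<close>, the Cauchy-Schwarz inequality and the \<open>L\<^sup>2\<close> bound for the
  Fourier transform estimate its norm by
  \<open>\<beta> ^ (- n l / 2) \<parallel>a\<^sub>l\<parallel>\<^sub>\<infinity> ^ (1 - q / 4) \<parallel>a\<^sub>l\<parallel>\<^sub>q ^ (q / 4)\<close>. For small \<open>\<beta>\<close> these bounds are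
  summable exactly because \<open>M > 2 n / (4 - q)\<close>.

  For the converse, the chirp \<open>m\<^sub>N(\<xi>, \<eta>) = exp (\<pi> i \<bar>\<xi> + \<eta>\<bar>\<^sup>2 / N - \<pi> (\<bar>\<xi>\<bar>\<^sup>2 + \<bar>\<eta>\<bar>\<^sup>2) / N\<^sup>2)\<close> has
  derivatives bounded uniformly in \<open>N\<close>, and its norm is at least \<open>c N ^ (n / 2)\<close>, as one sees by testing with
  Gaussians whose Fourier transform is \<open>exp (- \<pi> \<bar>\<xi>\<bar>\<^sup>2 / N\<^sup>2)\<close>. With \<open>N\<^sub>k = 2 ^ 2 ^ k\<close> the series of
  \<open>2 ^ k N\<^sub>k ^ (- n / 2) m\<^sub>N\<close>, \<open>N = N\<^sub>k\<close>, converges in all required norms, and on the \<open>k\<close>-th test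
  Gaussian every term but the \<open>k\<close>-th is harmless.
\<close>

section \<open>Gaussians\<close>

text \<open>The exponent 4 enters both halves by a count of powers. At the scale r =
  \<open>\<beta> ^ l\<close> the ball kernel has height of order r ^ (- n), and the tensor estimate
  costs the square root of that. The gain is the power 1 - q / 4 of a sup bound of order r ^ M, up
  to factors free of \<beta>. So the scales sum when M * (1 - q / 4) > n / 2. In the converse the
  chirp has L^q norm of order N ^ (2 n / q), which at q = 4 equals the lower bound N ^ (n / 2) for
  its operator norm. Hence weights of order N ^ (- n / 2) keep the operator norms from decaying, yet
  give decay in L^q for every q > 4.

  One average with a positive kernel approximates only to low order, however smooth the multiplier
  is. Iterating the residual over decreasing scales collects one order per factor, so positive
  product kernels suffice and each average stays an exact superposition of tensor products. The
  losses per step are constants that do not see the kernel, so \<beta> can be fixed after them. In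
  the converse, squaring from one scale to the next makes any two scales so far apart that a test
  Gaussian does not resonate with a foreign chirp.\<close>

lemma measurable_cis [measurable]: "cis \<in> borel_measurable borel"
  by (intro borel_measurable_continuous_onI continuous_intros)

lemma measurable_cnj [measurable]: "cnj \<in> borel_measurable borel"
  by (intro borel_measurable_continuous_onI continuous_intros)

lemma nn_integral_lborel_shift:
  fixes c :: "'a::euclidean_space"
  assumes [measurable]: "f \<in> borel_measurable borel"
  shows "(\<integral>\<^sup>+x. f (c + x) \<partial>lborel) = (\<integral>\<^sup>+x. f x \<partial>lborel)"
  by (subst (2) lborel_distr_plus[of c, symmetric]) (simp add: nn_integral_distr)

lemma integral_lborel_shift:
  fixes c :: "'a::euclidean_space" and f :: "'a \<Rightarrow> 'b::{banach, second_countable_topology}"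
  assumes [measurable]: "f \<in> borel_measurable borel"
  shows "(LINT x|lborel. f (c + x)) = (LINT x|lborel. f x)"
  by (subst (2) lborel_distr_plus[of c, symmetric]) (simp add: integral_distr)

lemma integrable_lborel_shift:
  fixes c :: "'a::euclidean_space" and f :: "'a \<Rightarrow> 'b::{banach, second_countable_topology}"
  assumes [measurable]: "f \<in> borel_measurable borel"
  shows "integrable lborel (\<lambda>x. f (c + x)) \<longleftrightarrow> integrable lborel f"
  by (subst (2) lborel_distr_plus[of c, symmetric]) (simp add: integrable_distr_eq)

lemma
  fixes f :: "'a::euclidean_space \<Rightarrow> real \<Rightarrow> 'b::{real_normed_field, banach, second_countable_topology}"
  assumes f: "\<And>b. b \<in> Basis \<Longrightarrow> integrable lborel (f b)"
  shows integrable_lborel_prod: "integrable lborel (\<lambda>x. \<Prod>b\<in>Basis. f b (x \<bullet> b))" (is ?I)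
    and integral_lborel_prod:
      "(LINT x|lborel. (\<Prod>b\<in>Basis. f b (x \<bullet> b))) = (\<Prod>b\<in>Basis. (LINT t|lborel. f b t))" (is ?E)
proof -
  interpret product_sigma_finite "\<lambda>_::'a. lborel :: real measure" ..
  have [measurable]: "f b \<in> borel_measurable borel" if "b \<in> Basis" for b
    using borel_measurable_integrable[OF f[OF that]] by simp
  let ?T = "\<lambda>g. \<Sum>b\<in>Basis. g b *\<^sub>R b :: 'a"
  have [measurable]: "?T \<in> (\<Pi>\<^sub>M b\<in>Basis. lborel) \<rightarrow>\<^sub>M borel"
    by measurable
  have [simp]: "(\<Sum>b\<in>Basis. g b *\<^sub>R b) \<bullet> c = g c" if "c \<in> Basis" for c :: 'a and g
    using that by (rule inner_sum_left_Basis)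
  have prd: "(\<Prod>b\<in>Basis. f b ((\<Sum>c\<in>Basis. g c *\<^sub>R c) \<bullet> b)) = (\<Prod>b\<in>Basis. f b (g b))" for g
    by (intro prod.cong) auto
  have m: "(\<lambda>x. \<Prod>b\<in>Basis. f b (x \<bullet> b)) \<in> borel_measurable borel"
    by measurable
  show ?I
    by (subst lborel_eq, subst integrable_distr_eq)
       (use m f in \<open>auto simp: prd intro!: product_integrable_prod\<close>)
  show ?E
    by (subst lborel_eq, subst integral_distr)
       (use m f in \<open>auto simp: prd intro!: product_integral_prod\<close>)
qed

text \<open>The substitution \<open>x = c * t\<close> with \<open>c = sqrt (2 * pi * \<rho>)\<close>
  turns the Gaussian into the standard normal density, so the integral is its characteristic
  function \<open>exp (- s^2 / 2)\<close> at \<open>s = 2 * pi * y / c\<close>. This takes the place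
  of a contour shift.\<close>

lemma
  fixes \<rho> y :: real
  assumes "\<rho> > 0"
  shows integrable_gaussian_real: "integrable lborel (\<lambda>t. exp (- pi * \<rho> * t\<^sup>2))" (is ?I)
    and integral_gaussian_cis_real:
      "(LINT t|lborel. complex_of_real (exp (- pi * \<rho> * t\<^sup>2)) * cis (2 * pi * (t * y))) =
         complex_of_real (exp (- pi * y\<^sup>2 / \<rho>) / sqrt \<rho>)" (is ?E)
proof -
  define c where "c = sqrt (2 * pi * \<rho>)"
  have c: "c > 0" "c\<^sup>2 = 2 * pi * \<rho>"
    using assms by (auto simp: c_def)
  have 1: "std_normal_density (0 + c * t) = exp (- pi * \<rho> * t\<^sup>2) / sqrt (2 * pi)" for t
    using c by (simp add: std_normal_density_def power_mult_distrib)
  have "integrable lborel (\<lambda>t. std_normal_density (0 + c * t))"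
    by (intro lborel_integrable_real_affine) (use c in auto)
  then have "integrable lborel (\<lambda>t. sqrt (2 * pi) * (exp (- pi * \<rho> * t\<^sup>2) / sqrt (2 * pi)))"
    unfolding 1 by (rule integrable_mult_right)
  then show ?I by simp
  define s where "s = 2 * pi * y / c"
  have "complex_of_real (exp (- (s^2) / 2)) = char std_normal_distribution s"
    by (simp add: char_std_normal_distribution)
  also have "\<dots> = (LINT x|lborel. std_normal_density x *\<^sub>R iexp (s * x))"
    unfolding char_def by (subst integral_density) auto
  also have "\<dots> = \<bar>c\<bar> *\<^sub>R (LINT t|lborel. std_normal_density (0 + c * t) *\<^sub>R iexp (s * (0 + c * t)))"
    by (rule lborel_integral_real_affine) (use c in auto)
  also have "(\<lambda>t. std_normal_density (0 + c * t) *\<^sub>R iexp (s * (0 + c * t))) =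
      (\<lambda>t. (1 / sqrt (2 * pi)) *\<^sub>R (complex_of_real (exp (- pi * \<rho> * t\<^sup>2)) * cis (2 * pi * (t * y))))"
  proof
    fix t
    have "s * (0 + c * t) = 2 * pi * (t * y)"
      using c by (simp add: s_def field_simps)
    then show "std_normal_density (0 + c * t) *\<^sub>R iexp (s * (0 + c * t)) =
      (1 / sqrt (2 * pi)) *\<^sub>R (complex_of_real (exp (- pi * \<rho> * t\<^sup>2)) * cis (2 * pi * (t * y)))"
      unfolding 1 by (simp only: cis_conv_exp scaleR_conv_of_real) (simp add: field_simps)
  qed
  finally have "complex_of_real (exp (- (s^2) / 2)) = (c / sqrt (2 * pi)) *\<^sub>R
      (LINT t|lborel. complex_of_real (exp (- pi * \<rho> * t\<^sup>2)) * cis (2 * pi * (t * y)))"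
    using c by simp
  moreover have "c / sqrt (2 * pi) = sqrt \<rho>"
    by (simp add: c_def real_sqrt_mult)
  moreover have "- (s^2) / 2 = - pi * y\<^sup>2 / \<rho>"
    using c assms by (simp add: s_def power_divide power_mult_distrib field_simps power2_eq_square)
  ultimately have "complex_of_real (exp (- pi * y\<^sup>2 / \<rho>)) = sqrt \<rho> *\<^sub>R
      (LINT t|lborel. complex_of_real (exp (- pi * \<rho> * t\<^sup>2)) * cis (2 * pi * (t * y)))" (is "_ = _ *\<^sub>R ?J")
    by (simp only:)
  then have "(1 / sqrt \<rho>) *\<^sub>R complex_of_real (exp (- pi * y\<^sup>2 / \<rho>)) = ?J"
    using assms by simp
  then show ?E
    by (simp add: scaleR_conv_of_real)
qed

lemma cis_sum: "finite A \<Longrightarrow> cis (\<Sum>a\<in>A. f a) = (\<Prod>a\<in>A. cis (f a))"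
  by (induction A rule: finite_induct) (auto simp: cis_mult[symmetric])

lemma
  fixes y :: "'a::euclidean_space"
  assumes "\<rho> > 0"
  shows integrable_gaussian: "integrable lborel (\<lambda>x::'a. exp (- pi * \<rho> * (norm x)\<^sup>2))" (is ?I)
    and integral_gaussian_cis:
      "(LINT x|lborel. complex_of_real (exp (- pi * \<rho> * (norm x)\<^sup>2)) * cis (2 * pi * (x \<bullet> y))) =
         complex_of_real (exp (- pi * (norm y)\<^sup>2 / \<rho>) * \<rho> powr (- real DIM('a) / 2))" (is ?E)
proof -
  have nrm: "(norm x)\<^sup>2 = (\<Sum>b\<in>Basis. (x \<bullet> b)\<^sup>2)" for x :: 'a
    unfolding power2_norm_eq_inner by (subst euclidean_inner) (simp add: power2_eq_square)
  have ex: "exp (c * (norm x)\<^sup>2) = (\<Prod>b\<in>Basis. exp (c * (x \<bullet> b)\<^sup>2))" for x :: 'a and c :: real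
    by (simp add: nrm exp_sum sum_distrib_left)
  show ?I
    unfolding ex using integrable_lborel_prod[of "\<lambda>_ t. exp (- pi * \<rho> * t\<^sup>2)"]
      integrable_gaussian_real[OF assms] by auto
  have int: "integrable lborel (\<lambda>t. complex_of_real (exp (- pi * \<rho> * t\<^sup>2)) * cis (2 * pi * (t * (y \<bullet> b))))" for b
    by (rule Bochner_Integration.integrable_bound[OF integrable_gaussian_real[OF assms]])
       (auto simp: norm_mult)
  have "(\<lambda>x. complex_of_real (exp (- pi * \<rho> * (norm x)\<^sup>2)) * cis (2 * pi * (x \<bullet> y))) =
    (\<lambda>x. \<Prod>b\<in>Basis. complex_of_real (exp (- pi * \<rho> * (x \<bullet> b)\<^sup>2)) * cis (2 * pi * ((x \<bullet> b) * (y \<bullet> b))))"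
    unfolding ex by (subst euclidean_inner) (simp add: prod.distrib cis_sum sum_distrib_left)
  then have "(LINT x|lborel. complex_of_real (exp (- pi * \<rho> * (norm x)\<^sup>2)) * cis (2 * pi * (x \<bullet> y))) =
     (\<Prod>b\<in>Basis. (LINT t|lborel. complex_of_real (exp (- pi * \<rho> * t\<^sup>2)) * cis (2 * pi * (t * (y \<bullet> b)))))"
    using integral_lborel_prod[of "\<lambda>b t. complex_of_real (exp (- pi * \<rho> * t\<^sup>2)) * cis (2 * pi * (t * (y \<bullet> b)))"] int
    by simp
  also have "\<dots> = (\<Prod>b\<in>Basis. complex_of_real (exp (- pi * (y \<bullet> b)\<^sup>2 / \<rho>) / sqrt \<rho>))"
    by (subst integral_gaussian_cis_real[OF assms]) simp
  also have "\<dots> = complex_of_real (\<Prod>b\<in>Basis. exp ((- pi / \<rho>) * (y \<bullet> b)\<^sup>2) * (1 / sqrt \<rho>))"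
    by (simp add: field_simps)
  also have "(\<Prod>b\<in>Basis. exp ((- pi / \<rho>) * (y \<bullet> b)\<^sup>2) * (1 / sqrt \<rho>)) =
      exp ((- pi / \<rho>) * (norm y)\<^sup>2) * (1 / sqrt \<rho>) ^ DIM('a)"
    unfolding ex by (simp only: prod.distrib prod_constant)
  also have "(1 / sqrt \<rho>) ^ DIM('a) = \<rho> powr (- real DIM('a) / 2)"
  proof -
    have "1 / sqrt \<rho> = \<rho> powr (- (1 / 2))"
      using assms by (simp only: powr_minus_divide) (simp add: powr_half_sqrt)
    then have "(1 / sqrt \<rho>) ^ DIM('a) = \<rho> powr (real DIM('a) * - (1 / 2))"
      using assms by (simp only: powr_power)
    then show ?thesis
      by simp
  qed
  finally show ?E
    by simp
qed

lemma integral_gaussian: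
  assumes "\<rho> > 0"
  shows "(LINT x|lborel. exp (- pi * \<rho> * (norm (x::'a::euclidean_space))\<^sup>2)) = \<rho> powr (- real DIM('a) / 2)"
proof -
  have "complex_of_real (LINT x|lborel. exp (- pi * \<rho> * (norm (x::'a))\<^sup>2)) =
      (LINT x|lborel. complex_of_real (exp (- pi * \<rho> * (norm x)\<^sup>2)) * cis (2 * pi * (x \<bullet> (0::'a))))"
    by simp
  also have "\<dots> = complex_of_real (\<rho> powr (- real DIM('a) / 2))"
    by (subst integral_gaussian_cis[OF assms]) simp
  finally show ?thesis
    using of_real_eq_iff by blast
qed

lemma nn_integral_gaussian:
  assumes "\<rho> > 0"
  shows "(\<integral>\<^sup>+x. ennreal (exp (- pi * \<rho> * (norm (x::'a::euclidean_space))\<^sup>2)) \<partial>lborel) =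
     ennreal (\<rho> powr (- real DIM('a) / 2))"
  by (simp only: nn_integral_eq_integral[OF integrable_gaussian[OF assms] always_eventually] exp_ge_zero
      integral_gaussian[OF assms] simp_thms)

section \<open>Plancherel inequality\<close>

text \<open>The Gaussian weight makes all integrals absolutely convergent. Integrating over
  \<open>x\<close> first turns the left side into a quadratic form in \<open>h\<close> whose kernel
  \<gamma>, the Fourier transform of the weight, has total mass 1. The inequality
  \<open>2 * a * b \<le> a^2 + b^2\<close> then bounds the form, as in Schur's test. The sign
  \<sigma> covers the transform and its inverse alike.\<close>

lemma plancherel_gaussian_le:
  fixes h :: "'a::euclidean_space \<Rightarrow> complex"
  assumes h: "integrable lborel h" and "\<rho> > 0" and \<sigma>: "\<bar>\<sigma>\<bar> = 1"
  shows "(\<integral>\<^sup>+x. ennreal (exp (- pi * \<rho> * (norm x)\<^sup>2) *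
      (cmod (LINT y|lborel. h y * cis (2 * pi * \<sigma> * (x \<bullet> y))))\<^sup>2) \<partial>lborel)
    \<le> (\<integral>\<^sup>+x. ennreal ((cmod (h x))\<^sup>2) \<partial>lborel)"
proof -
  note [measurable] = borel_measurable_integrable[OF h, simplified]
  define H where "H x = (LINT y|lborel. h y * cis (2 * pi * \<sigma> * (x \<bullet> y)))" for x
  define E where "E x = exp (- pi * \<rho> * (norm x)\<^sup>2)" for x :: 'a
  define \<gamma> where "\<gamma> w = exp (- pi * (norm w)\<^sup>2 / \<rho>) * \<rho> powr (- real DIM('a) / 2)" for w :: 'a
  have [measurable]: "E \<in> borel_measurable borel" "\<gamma> \<in> borel_measurable borel"
    unfolding E_def \<gamma>_def by measurable
  have Epos: "E x > 0" "\<gamma> x > 0" for x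
    using \<open>\<rho> > 0\<close> by (auto simp: E_def \<gamma>_def)
  have Eint: "integrable lborel E"
    unfolding E_def by (rule integrable_gaussian) fact
  have [measurable]: "H \<in> borel_measurable borel"
    unfolding H_def by measurable
  define \<Phi> where "\<Phi> x p = complex_of_real (E x) * (h (fst p) * cnj (h (snd p)) *
      cis (2 * pi * \<sigma> * (x \<bullet> (fst p - snd p))))" for x :: 'a and p :: "'a \<times> 'a"
  have "case_prod \<Phi> \<in> borel_measurable (borel \<Otimes>\<^sub>M (borel \<Otimes>\<^sub>M borel))"
    unfolding \<Phi>_def by measurable
  then have [measurable]: "case_prod \<Phi> \<in> borel_measurable (borel \<Otimes>\<^sub>M borel)"
    by (simp only: borel_prod)
  have hh: "integrable (lborel \<Otimes>\<^sub>M lborel) (\<lambda>p. h (fst p) * cnj (h (snd p)))"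
    by (rule lborel_pair.Fubini_integrable) (use h in \<open>auto simp: norm_mult\<close>)
  have hint: "integrable lborel (\<lambda>y. h y * cis (2 * pi * \<sigma> * (x \<bullet> y)))" for x
    by (rule Bochner_Integration.integrable_bound[OF h]) (auto simp: norm_mult)
  have hint2: "integrable lborel (\<lambda>y. cnj (h y) * cnj (cis (2 * pi * \<sigma> * (x \<bullet> y))))" for x
    by (rule Bochner_Integration.integrable_bound[OF h]) (auto simp: norm_mult)
  have cis_diff: "cis (2 * pi * \<sigma> * (x \<bullet> (y - z))) =
      cis (2 * pi * \<sigma> * (x \<bullet> y)) * cnj (cis (2 * pi * \<sigma> * (x \<bullet> z)))" for x y z :: 'a
    by (simp add: cis_cnj cis_mult inner_diff_right algebra_simps)
  have HH: "H x * cnj (H x) = (LINT p|lborel. h (fst p) * cnj (h (snd p)) *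
      cis (2 * pi * \<sigma> * (x \<bullet> (fst p - snd p))))" for x
  proof -
    have "(LINT p|lborel. h (fst p) * cnj (h (snd p)) * cis (2 * pi * \<sigma> * (x \<bullet> (fst p - snd p))))
      = (LINT p|(lborel \<Otimes>\<^sub>M lborel). (h (fst p) * cis (2 * pi * \<sigma> * (x \<bullet> fst p))) *
          cnj (h (snd p) * cis (2 * pi * \<sigma> * (x \<bullet> snd p))))"
      unfolding cis_diff by (simp add: lborel_prod mult_ac)
    also have "\<dots> = (LINT y|lborel. LINT z|lborel. (h y * cis (2 * pi * \<sigma> * (x \<bullet> y))) *
          cnj (h z * cis (2 * pi * \<sigma> * (x \<bullet> z))))"
      by (subst lborel_pair.integral_fst'[symmetric])
         (use hint2 in \<open>auto intro!: lborel_pair.Fubini_integrable simp: norm_mult h integrable_norm\<close>)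
    also have "\<dots> = H x * cnj (H x)"
    proof -
      have "(LINT z|lborel. cnj (h z) * cnj (cis (2 * pi * \<sigma> * (x \<bullet> z)))) = cnj (H x)"
        unfolding H_def complex_cnj_mult[symmetric] by (rule Bochner_Integration.integral_cnj)
      then show ?thesis
        by (simp add: H_def)
    qed
    finally show ?thesis ..
  qed
  have \<Phi>_int: "integrable (lborel \<Otimes>\<^sub>M lborel) (case_prod \<Phi>)"
  proof (rule lborel_pair.Fubini_integrable)
    show "integrable lborel (\<lambda>x. LINT p|lborel. norm (case_prod \<Phi> (x, p)))"
      using Eint Epos by (simp add: \<Phi>_def norm_mult abs_of_pos)
    show "AE x in lborel. integrable lborel (\<lambda>p. case_prod \<Phi> (x, p))"
    proof (intro always_eventually allI)
      fix x
      have "integrable (lborel \<Otimes>\<^sub>M lborel) (\<lambda>p. case_prod \<Phi> (x, p))"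
        by (rule Bochner_Integration.integrable_bound[OF integrable_mult_right[OF hh, of "complex_of_real (E x)"]])
           (auto simp: \<Phi>_def norm_mult)
      then show "integrable lborel (\<lambda>p. case_prod \<Phi> (x, p))"
        by (simp only: lborel_prod)
    qed
  qed auto
  have inner: "(LINT x|lborel. \<Phi> x p) = h (fst p) * cnj (h (snd p)) * \<gamma> (fst p - snd p)" for p
  proof -
    have "(LINT x|lborel. \<Phi> x p) = (LINT x|lborel. (h (fst p) * cnj (h (snd p))) *
       (complex_of_real (exp (- pi * \<rho> * (norm x)\<^sup>2)) * cis (2 * pi * (x \<bullet> (\<sigma> *\<^sub>R (fst p - snd p))))))"
      by (simp add: \<Phi>_def E_def mult_ac)
    also have "\<dots> = (h (fst p) * cnj (h (snd p))) * (complex_of_real (exp (- pi * (norm (\<sigma> *\<^sub>R (fst p - snd p)))\<^sup>2 / \<rho>) * \<rho> powr (- real DIM('a) / 2)))"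
      by (subst integral_mult_right_zero, subst integral_gaussian_cis) (use \<open>\<rho> > 0\<close> in auto)
    finally show ?thesis
      using \<sigma> by (simp add: \<gamma>_def)
  qed
  have "(\<integral>\<^sup>+x. ennreal (E x * (cmod (H x))\<^sup>2) \<partial>lborel) = ennreal (LINT x|lborel. E x * (cmod (H x))\<^sup>2)"
  proof (rule nn_integral_eq_integral)
    have "integrable lborel (\<lambda>x. LINT p|lborel. \<Phi> x p)"
      using lborel_pair.integrable_fst[OF \<Phi>_int] by simp
    then have "integrable lborel (\<lambda>x. norm (LINT p|lborel. \<Phi> x p))"
      by (rule integrable_norm)
    then show "integrable lborel (\<lambda>x. E x * (cmod (H x))\<^sup>2)"
      using Epos by (simp add: \<Phi>_def HH[symmetric] norm_mult power2_eq_square abs_of_pos)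
    show "AE x in lborel. 0 \<le> E x * (cmod (H x))\<^sup>2"
      using Epos by (intro always_eventually allI mult_nonneg_nonneg) (auto intro: less_imp_le)
  qed
  also have "(LINT x|lborel. E x * (cmod (H x))\<^sup>2) = norm (complex_of_real (LINT x|lborel. E x * (cmod (H x))\<^sup>2))"
    using Epos by (subst norm_of_real)
      (auto intro!: abs_of_nonneg[symmetric] Bochner_Integration.integral_nonneg mult_nonneg_nonneg intro: less_imp_le)
  also have "complex_of_real (LINT x|lborel. E x * (cmod (H x))\<^sup>2) = (LINT x|lborel. LINT p|lborel. \<Phi> x p)"
    unfolding integral_complex_of_real[symmetric]
    by (simp add: \<Phi>_def HH[symmetric] complex_norm_square[symmetric] del: complex_mult_cnj)
  also have "\<dots> = (LINT p|lborel. LINT x|lborel. \<Phi> x p)"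
    by (rule lborel_pair.Fubini_integral[OF \<Phi>_int, symmetric])
  also have "ennreal (norm \<dots>) \<le> (\<integral>\<^sup>+p. norm (LINT x|lborel. \<Phi> x p) \<partial>lborel)"
  proof (rule integral_norm_bound_ennreal)
    show "integrable lborel (\<lambda>p. LINT x|lborel. \<Phi> x p)"
      using lborel_pair.integrable_snd[OF \<Phi>_int] by simp
  qed
  also have "\<dots> = (\<integral>\<^sup>+p. ennreal (cmod (h (fst p)) * cmod (h (snd p)) * \<gamma> (fst p - snd p)) \<partial>(lborel \<Otimes>\<^sub>M lborel))"
    using Epos by (simp add: inner norm_mult lborel_prod abs_of_pos)
  also have "\<dots> \<le> (\<integral>\<^sup>+p. ennreal (1/2 * ((cmod (h (fst p)))\<^sup>2 * \<gamma> (fst p - snd p))) +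
      ennreal (1/2 * ((cmod (h (snd p)))\<^sup>2 * \<gamma> (fst p - snd p))) \<partial>(lborel \<Otimes>\<^sub>M lborel))"
  proof (rule nn_integral_mono)
    fix p
    have "2 * (cmod (h (fst p)) * cmod (h (snd p))) \<le> (cmod (h (fst p)))\<^sup>2 + (cmod (h (snd p)))\<^sup>2"
      using sum_squares_bound[of "cmod (h (fst p))" "cmod (h (snd p))"] by simp
    from mult_right_mono[OF this less_imp_le[OF Epos(2)[of "fst p - snd p"]]]
    show "ennreal (cmod (h (fst p)) * cmod (h (snd p)) * \<gamma> (fst p - snd p)) \<le>
      ennreal (1/2 * ((cmod (h (fst p)))\<^sup>2 * \<gamma> (fst p - snd p))) +
      ennreal (1/2 * ((cmod (h (snd p)))\<^sup>2 * \<gamma> (fst p - snd p)))"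
      using Epos(2)[of "fst p - snd p"]
      by (subst ennreal_plus[symmetric]) (auto intro!: ennreal_leI simp: algebra_simps simp del: ennreal_plus)
  qed
  also have "\<dots> = (\<integral>\<^sup>+p. ennreal (1/2 * ((cmod (h (fst p)))\<^sup>2 * \<gamma> (fst p - snd p))) \<partial>(lborel \<Otimes>\<^sub>M lborel)) +
      (\<integral>\<^sup>+p. ennreal (1/2 * ((cmod (h (snd p)))\<^sup>2 * \<gamma> (fst p - snd p))) \<partial>(lborel \<Otimes>\<^sub>M lborel))"
    by (rule nn_integral_add) auto
  also have "(\<integral>\<^sup>+p. ennreal (1/2 * ((cmod (h (fst p)))\<^sup>2 * \<gamma> (fst p - snd p))) \<partial>(lborel \<Otimes>\<^sub>M lborel)) =
      (\<integral>\<^sup>+y. \<integral>\<^sup>+z. ennreal (1/2 * ((cmod (h y))\<^sup>2 * \<gamma> (y - z))) \<partial>lborel \<partial>lborel)"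
    by (subst lborel.nn_integral_fst[symmetric]) auto
  also have "(\<integral>\<^sup>+p. ennreal (1/2 * ((cmod (h (snd p)))\<^sup>2 * \<gamma> (fst p - snd p))) \<partial>(lborel \<Otimes>\<^sub>M lborel)) =
      (\<integral>\<^sup>+z. \<integral>\<^sup>+y. ennreal (1/2 * ((cmod (h z))\<^sup>2 * \<gamma> (z - y))) \<partial>lborel \<partial>lborel)"
    by (subst lborel_pair.nn_integral_snd[symmetric]) (auto simp: \<gamma>_def norm_minus_commute)
  also have "(\<integral>\<^sup>+z. \<integral>\<^sup>+y. ennreal (1/2 * ((cmod (h z))\<^sup>2 * \<gamma> (z - y))) \<partial>lborel \<partial>lborel) =
      (\<integral>\<^sup>+z. ennreal (1/2 * (cmod (h z))\<^sup>2) \<partial>lborel)"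
  proof (rule nn_integral_cong)
    fix z
    have "(\<integral>\<^sup>+y. ennreal (1/2 * ((cmod (h z))\<^sup>2 * \<gamma> (z - y))) \<partial>lborel) =
       (\<integral>\<^sup>+y. ennreal (1/2 * (cmod (h z))\<^sup>2) * ennreal (\<gamma> (- z + y)) \<partial>lborel)"
      using Epos(2)
      by (intro nn_integral_cong) (simp add: ennreal_mult'[symmetric] less_imp_le \<gamma>_def norm_minus_commute mult_ac)
    also have "\<dots> = ennreal (1/2 * (cmod (h z))\<^sup>2) * (\<integral>\<^sup>+y. ennreal (\<gamma> (- z + y)) \<partial>lborel)"
      by (rule nn_integral_cmult) auto
    also have "(\<integral>\<^sup>+y. ennreal (\<gamma> (- z + y)) \<partial>lborel) = (\<integral>\<^sup>+y. ennreal (\<gamma> y) \<partial>lborel)"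
      by (rule nn_integral_lborel_shift) auto
    also have "\<dots> = (\<integral>\<^sup>+y. ennreal (\<rho> powr (- real DIM('a) / 2)) * ennreal (exp (- pi * (1/\<rho>) * (norm (y::'a))\<^sup>2)) \<partial>lborel)"
      using \<open>\<rho> > 0\<close>
      by (intro nn_integral_cong) (simp add: \<gamma>_def ennreal_mult'[symmetric] mult_ac)
    also have "\<dots> = ennreal (\<rho> powr (- real DIM('a) / 2)) * ennreal ((1/\<rho>) powr (- real DIM('a) / 2))"
      by (subst nn_integral_cmult, measurable, subst nn_integral_gaussian) (use \<open>\<rho> > 0\<close> in auto)
    also have "\<dots> = 1"
      using \<open>\<rho> > 0\<close> by (simp add: ennreal_mult'[symmetric] powr_mult[symmetric])
    finally show "(\<integral>\<^sup>+y. ennreal (1/2 * ((cmod (h z))\<^sup>2 * \<gamma> (z - y))) \<partial>lborel) = ennreal (1/2 * (cmod (h z))\<^sup>2)"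
      by simp
  qed
  also have "(\<integral>\<^sup>+z. ennreal (1/2 * (cmod (h z))\<^sup>2) \<partial>lborel) + (\<integral>\<^sup>+z. ennreal (1/2 * (cmod (h z))\<^sup>2) \<partial>lborel) =
      (\<integral>\<^sup>+z. ennreal (1/2 * (cmod (h z))\<^sup>2) + ennreal (1/2 * (cmod (h z))\<^sup>2) \<partial>lborel)"
    by (rule nn_integral_add[symmetric]) auto
  also have "\<dots> = (\<integral>\<^sup>+z. ennreal ((cmod (h z))\<^sup>2) \<partial>lborel)"
    by (intro nn_integral_cong) (simp flip: ennreal_plus)
  finally show ?thesis
    by (simp add: E_def H_def)
qed

text \<open>The weights with parameter \<open>1 / Suc k\<close> tend to 1 and each obeys the same
  bound, so Fatou's lemma passes it to the limit. The argument covers an infinite right side as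
  well.\<close>

lemma plancherel_le:
  fixes h :: "'a::euclidean_space \<Rightarrow> complex"
  assumes h: "integrable lborel h" and \<sigma>: "\<bar>\<sigma>\<bar> = 1"
  shows "(\<integral>\<^sup>+x. ennreal ((cmod (LINT y|lborel. h y * cis (2 * pi * \<sigma> * (x \<bullet> y))))\<^sup>2) \<partial>lborel)
    \<le> (\<integral>\<^sup>+x. ennreal ((cmod (h x))\<^sup>2) \<partial>lborel)"
proof -
  note [measurable] = borel_measurable_integrable[OF h, simplified]
  define H where "H x = (LINT y|lborel. h y * cis (2 * pi * \<sigma> * (x \<bullet> y)))" for x
  have [measurable]: "H \<in> borel_measurable borel"
    unfolding H_def by measurable
  define u where "u k x = ennreal (exp (- pi * (1 / real (Suc k)) * (norm x)\<^sup>2) * (cmod (H x))\<^sup>2)" for k x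
  have [measurable]: "u k \<in> borel_measurable lborel" for k
    unfolding u_def by measurable
  have "(\<lambda>k. u k x) \<longlonglongrightarrow> ennreal ((cmod (H x))\<^sup>2)" for x
  proof -
    have "(\<lambda>k. exp (- pi * (1 / real (Suc k)) * (norm x)\<^sup>2) * (cmod (H x))\<^sup>2) \<longlonglongrightarrow>
        exp (- pi * 0 * (norm x)\<^sup>2) * (cmod (H x))\<^sup>2"
      using lim_inverse_n' [THEN LIMSEQ_Suc]
      by (intro tendsto_intros) (auto simp: inverse_eq_divide)
    then show ?thesis
      unfolding u_def by (intro tendsto_ennrealI) simp
  qed
  then have "(\<integral>\<^sup>+x. ennreal ((cmod (H x))\<^sup>2) \<partial>lborel) = (\<integral>\<^sup>+x. liminf (\<lambda>k. u k x) \<partial>lborel)"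
    by (intro nn_integral_cong lim_imp_Liminf[symmetric]) auto
  also have "\<dots> \<le> liminf (\<lambda>k. \<integral>\<^sup>+x. u k x \<partial>lborel)"
    by (rule nn_integral_liminf) auto
  also have "\<dots> \<le> liminf (\<lambda>k::nat. \<integral>\<^sup>+x. ennreal ((cmod (h x))\<^sup>2) \<partial>lborel)"
    unfolding u_def H_def
    by (intro Liminf_mono always_eventually allI plancherel_gaussian_le[OF h _ \<sigma>]) simp
  also have "\<dots> = (\<integral>\<^sup>+x. ennreal ((cmod (h x))\<^sup>2) \<partial>lborel)"
    by (simp add: Liminf_const)
  finally show ?thesis
    by (simp add: H_def)
qed

section \<open>Iterated partial derivatives\<close>

text \<open>\<open>has_iter_partial\<close> speaks of the derivative at \<open>t = 0\<close> only,
  but at every base point. Moving the base point to \<open>x + s *\<^sub>R b\<close> yields the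
  derivative along the whole line.\<close>

lemma has_vector_derivative_partial:
  assumes "has_iter_partial (b # \<alpha>) f"
  shows "((\<lambda>t. iter_partial \<alpha> f (x + t *\<^sub>R b)) has_vector_derivative
    iter_partial (b # \<alpha>) f (x + s *\<^sub>R b)) (at s)"
proof -
  have "(\<lambda>t. iter_partial \<alpha> f ((x + s *\<^sub>R b) + t *\<^sub>R b)) differentiable (at 0)"
    using assms by simp
  then have "((\<lambda>t. iter_partial \<alpha> f ((x + s *\<^sub>R b) + t *\<^sub>R b)) has_vector_derivative
      iter_partial (b # \<alpha>) f (x + s *\<^sub>R b)) (at 0)"
    by (simp add: vector_derivative_works[symmetric] iter_partial_def partial_deriv_def)
  then have "((\<lambda>t. iter_partial \<alpha> f ((x + s *\<^sub>R b) + t *\<^sub>R b)) \<circ> (\<lambda>t. t - s) has_vector_derivative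
      1 *\<^sub>R iter_partial (b # \<alpha>) f (x + s *\<^sub>R b)) (at s)"
    by (intro vector_diff_chain_at) (auto intro!: derivative_eq_intros)
  then show ?thesis
    by (simp add: o_def algebra_simps)
qed

lemma norm_diff_le_of_vector_derivative:
  fixes \<phi> :: "real \<Rightarrow> 'b::real_normed_vector"
  assumes "\<And>s. s \<in> closed_segment 0 t \<Longrightarrow> (\<phi> has_vector_derivative \<phi>' s) (at s)"
    and "\<And>s. s \<in> closed_segment 0 t \<Longrightarrow> norm (\<phi>' s) \<le> B"
  shows "norm (\<phi> t - \<phi> 0) \<le> B * \<bar>t\<bar>"
proof -
  have "norm (\<phi> t - \<phi> 0) \<le> B * norm (t - 0)"
  proof (rule differentiable_bound[where S="closed_segment 0 t" and f'="\<lambda>s h. h *\<^sub>R \<phi>' s"])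
    show "(\<phi> has_derivative (\<lambda>h. h *\<^sub>R \<phi>' s)) (at s within closed_segment 0 t)"
      if "s \<in> closed_segment 0 t" for s
      using assms(1)[OF that] by (auto simp: has_vector_derivative_def intro: has_derivative_at_withinI)
    show "onorm (\<lambda>h. h *\<^sub>R \<phi>' s) \<le> B" if "s \<in> closed_segment 0 t" for s
      using assms(2)[OF that] by (simp add: onorm_scaleR_left onorm_id)
  qed auto
  then show ?thesis by simp
qed

lemma norm_diff_le_partial:
  assumes "has_iter_partial (b # \<alpha>) f"
    and "\<And>s. s \<in> closed_segment 0 t \<Longrightarrow> norm (iter_partial (b # \<alpha>) f (x + s *\<^sub>R b)) \<le> B"
  shows "norm (iter_partial \<alpha> f (x + t *\<^sub>R b) - iter_partial \<alpha> f x) \<le> B * \<bar>t\<bar>"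
  using norm_diff_le_of_vector_derivative[where \<phi>="\<lambda>t. iter_partial \<alpha> f (x + t *\<^sub>R b)",
      OF has_vector_derivative_partial[OF assms(1)] assms(2)]
  by simp

lemma iter_partial_append: "iter_partial (\<alpha> @ \<beta>) f = iter_partial \<alpha> (iter_partial \<beta> f)"
  by (simp add: iter_partial_def)

lemma has_iter_partial_append:
  "has_iter_partial (\<alpha> @ \<beta>) f \<longleftrightarrow> has_iter_partial \<beta> f \<and> has_iter_partial \<alpha> (iter_partial \<beta> f)"
  by (induction \<alpha>) (auto simp: iter_partial_append)

lemma iter_partial_Nil [simp]: "iter_partial [] f = f"
  by (simp add: iter_partial_def)

lemma multi_index_simps [simp]: "multi_index []" "multi_index (b # \<alpha>) \<longleftrightarrow> b \<in> Basis \<and> multi_index \<alpha>"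
  "multi_index (\<alpha> @ \<beta>) \<longleftrightarrow> multi_index \<alpha> \<and> multi_index \<beta>"
  by (auto simp: multi_index_def)

section \<open>Schwartz functions\<close>

text \<open>The exponent is twice the dimension so that the function is dominated by the product of
  \<open>1 / (1 + t^2)\<close> over the coordinates, and hence is integrable.\<close>

definition decay :: "'a::euclidean_space \<Rightarrow> real" where
  "decay x = (1 / (1 + norm x)) ^ (2 * DIM('a))"

lemma decay_nonneg [simp]: "decay x \<ge> 0"
  by (simp add: decay_def)

lemma measurable_decay [measurable]: "decay \<in> borel_measurable borel"
  unfolding decay_def by measurable

lemma integrable_decay: "integrable lborel (decay :: 'a::euclidean_space \<Rightarrow> real)"
proof (rule Bochner_Integration.integrable_bound)
  have "integrable lborel (\<lambda>x::real. inverse (1 + x\<^sup>2))"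
    using integrable_inverse_1_plus_square by (simp add: set_integrable_def)
  then show "integrable lborel (\<lambda>x::'a. \<Prod>b\<in>Basis. inverse (1 + (x \<bullet> b)\<^sup>2))"
    by (intro integrable_lborel_prod)
  have "decay x \<le> (\<Prod>b\<in>Basis. inverse (1 + (x \<bullet> b)\<^sup>2))" for x :: 'a
  proof -
    have "decay x = (\<Prod>b\<in>(Basis::'a set). inverse ((1 + norm x)\<^sup>2))"
      by (simp add: decay_def power_mult inverse_eq_divide power_divide)
    also have "\<dots> \<le> (\<Prod>b\<in>Basis. inverse (1 + (x \<bullet> b)\<^sup>2))"
    proof (intro prod_mono conjI le_imp_inverse_le)
      fix b :: 'a assume "b \<in> Basis"
      then have "(x \<bullet> b)\<^sup>2 \<le> (norm x)\<^sup>2"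
        using Basis_le_norm[of b x] by (intro abs_le_square_iff[THEN iffD1]) auto
      also have "1 + \<dots> \<le> (1 + norm x)\<^sup>2"
        by (simp add: power2_sum)
      finally show "1 + (x \<bullet> b)\<^sup>2 \<le> (1 + norm x)\<^sup>2" by simp
    qed (auto simp: add_pos_nonneg)
    finally show ?thesis .
  qed
  then show "AE x in lborel. norm (decay x) \<le> norm (\<Prod>b\<in>Basis. inverse (1 + ((x::'a) \<bullet> b)\<^sup>2))"
    by (auto intro!: always_eventually simp: prod_nonneg)
qed auto

text \<open>Supplies one integrable majorant for a derivative along all segments of length at most 1
  that start at \<open>x\<close>, as dominated convergence of difference quotients requires.\<close>

lemma decay_shift:
  assumes "norm v \<le> 1"
  shows "decay (x + v) \<le> 4 ^ DIM('a) * decay (x :: 'a::euclidean_space)"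
proof -
  have "norm x \<le> norm (x + v) + norm v"
    using norm_triangle_ineq4[of "x + v" v] by simp
  then have "1 + norm x \<le> 1 + (norm (x + v) + 1)"
    using assms by simp
  then have "1 + norm x \<le> 2 * (1 + norm (x + v))"
    by (rule order_trans) simp
  then have "1 / (1 + norm (x + v)) \<le> 2 * (1 / (1 + norm x))"
    by (simp add: field_simps add_pos_nonneg)
  then have "(1 / (1 + norm (x + v))) ^ (2 * DIM('a)) \<le> (2 * (1 / (1 + norm x))) ^ (2 * DIM('a))"
    by (intro power_mono) auto
  also have "\<dots> = (2 ^ 2) ^ DIM('a) * (1 / (1 + norm x)) ^ (2 * DIM('a))"
    by (simp only: power_mult_distrib power_mult)
  finally show ?thesis
    by (simp add: decay_def)
qed

lemma schwartz_iter_partial: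
  assumes "schwartz f" "multi_index \<beta>"
  shows "schwartz (iter_partial \<beta> f)"
proof -
  have "C_class M (iter_partial \<beta> f)" for M
    using assms unfolding schwartz_def C_class_def
    by (metis has_iter_partial_append iter_partial_append le_refl multi_index_simps(3))
  moreover have "bounded (range (\<lambda>x. norm x ^ N *\<^sub>R iter_partial \<alpha> (iter_partial \<beta> f) x))"
    if "multi_index \<alpha>" for \<alpha> N
    using assms that unfolding schwartz_def by (metis iter_partial_append multi_index_simps(3))
  ultimately show ?thesis
    by (simp add: schwartz_def)
qed

lemma schwartz_has_iter_partial: "schwartz f \<Longrightarrow> multi_index \<alpha> \<Longrightarrow> has_iter_partial \<alpha> f"
  by (auto simp: schwartz_def C_class_def)

lemma schwartz_continuous: "schwartz f \<Longrightarrow> continuous_on UNIV f"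
  unfolding schwartz_def C_class_def
  by (metis iter_partial_Nil le0 list.size(3) multi_index_simps(1))

lemma schwartz_measurable: "schwartz f \<Longrightarrow> f \<in> borel_measurable borel"
  by (intro borel_measurable_continuous_onI schwartz_continuous)

lemma one_plus_power_le:
  fixes r :: real
  assumes "r \<ge> 0"
  shows "(1 + r) ^ k \<le> 2 ^ k * (1 + r ^ k)"
proof -
  have "(1 + r) ^ k \<le> (2 * max 1 r) ^ k"
    using assms by (intro power_mono) auto
  also have "\<dots> = 2 ^ k * max 1 (r ^ k)"
  proof (cases "r \<le> 1")
    case True
    then show ?thesis
      using power_le_one[OF assms True, of k] by (simp add: max_absorb1)
  next
    case False
    then show ?thesis
      using one_le_power[of r k] by (simp add: max_absorb2 power_mult_distrib)
  qed
  also have "\<dots> \<le> 2 ^ k * (1 + r ^ k)"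
    using assms by (intro mult_left_mono) auto
  finally show ?thesis .
qed

text \<open>Merges a bound without weight and one with the weight
  \<open>norm x ^ (2 * DIM('a))\<close> into an integrable majorant. It serves both for Schwartz
  functions and for their Fourier transforms.\<close>

lemma le_decayI:
  fixes x :: "'a::euclidean_space"
  assumes "a \<le> C0" "norm x ^ (2 * DIM('a)) * a \<le> C1"
  shows "a \<le> (4 ^ DIM('a) * (\<bar>C0\<bar> + \<bar>C1\<bar>)) * decay x"
proof (cases "a \<ge> 0")
  case True
  have four: "(2::real) ^ (2 * DIM('a)) = 4 ^ DIM('a)"
    by (subst power_mult) simp
  have "(1 + norm x) ^ (2 * DIM('a)) * a \<le> (2 ^ (2 * DIM('a)) * (1 + norm x ^ (2 * DIM('a)))) * a"
    using True by (intro mult_right_mono one_plus_power_le) auto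
  also have "\<dots> = 4 ^ DIM('a) * (a + norm x ^ (2 * DIM('a)) * a)"
    unfolding four by (simp add: algebra_simps)
  also have "\<dots> \<le> 4 ^ DIM('a) * (\<bar>C0\<bar> + \<bar>C1\<bar>)"
    using assms by (intro mult_left_mono) auto
  finally have "a \<le> (4 ^ DIM('a) * (\<bar>C0\<bar> + \<bar>C1\<bar>)) / (1 + norm x) ^ (2 * DIM('a))"
    by (subst pos_le_divide_eq) (auto simp: add_pos_nonneg mult.commute)
  then show ?thesis
    by (simp add: decay_def power_one_over divide_inverse power_inverse)
next
  case False
  then have "a \<le> 0" by simp
  also have "0 \<le> (4 ^ DIM('a) * (\<bar>C0\<bar> + \<bar>C1\<bar>)) * decay x"
    by (intro mult_nonneg_nonneg) auto
  finally show ?thesis .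
qed

lemma schwartz_decay:
  assumes "schwartz f"
  obtains C where "C > 0" "\<And>x::'a::euclidean_space. norm (f x) \<le> C * decay x"
proof -
  have b: "bounded (range (\<lambda>x. norm x ^ N *\<^sub>R f x))" for N
    using assms unfolding schwartz_def by (metis iter_partial_Nil multi_index_simps(1))
  obtain C0 where C0: "norm (norm x ^ 0 *\<^sub>R f x) \<le> C0" for x
    using b[of 0] by (auto simp: bounded_iff)
  obtain C1 where C1: "norm (norm x ^ (2 * DIM('a)) *\<^sub>R f x) \<le> C1" for x
    using b[of "2 * DIM('a)"] by (auto simp: bounded_iff)
  show thesis
  proof (rule that)
    show "4 ^ DIM('a) * (\<bar>C0\<bar> + \<bar>C1\<bar>) + 1 > 0"
      by (simp add: add_nonneg_pos)
    fix x
    have "norm (f x) \<le> 4 ^ DIM('a) * (\<bar>C0\<bar> + \<bar>C1\<bar>) * decay x"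
      using C0[of x] C1[of x] by (intro le_decayI) auto
    then show "norm (f x) \<le> (4 ^ DIM('a) * (\<bar>C0\<bar> + \<bar>C1\<bar>) + 1) * decay x"
      using decay_nonneg[of x] unfolding distrib_right by linarith
  qed
qed

lemma schwartz_integrable:
  assumes "schwartz f"
  shows "integrable lborel f"
proof -
  obtain C where C: "C > 0" "\<And>x. norm (f x) \<le> C * decay x"
    using schwartz_decay[OF assms] by blast
  show ?thesis
    by (rule Bochner_Integration.integrable_bound[OF integrable_mult_right[OF integrable_decay, of C]])
       (use C schwartz_measurable[OF assms] in auto)
qed

lemma schwartz_L2:
  assumes "schwartz f"
  shows "integrable lborel (\<lambda>x. (norm (f x))\<^sup>2)"
proof -
  have b: "bounded (range (\<lambda>x. norm x ^ 0 *\<^sub>R f x))"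
    using assms unfolding schwartz_def by (metis iter_partial_Nil multi_index_simps(1))
  then obtain B where B: "norm (f x) \<le> B" for x
    by (auto simp: bounded_iff)
  show ?thesis
  proof (rule Bochner_Integration.integrable_bound[OF integrable_mult_right[OF integrable_norm[OF schwartz_integrable[OF assms]], of B]])
    show "AE x in lborel. norm ((norm (f x))\<^sup>2) \<le> norm (B * norm (f x))"
    proof (intro always_eventually allI)
      fix x show "norm ((norm (f x))\<^sup>2) \<le> norm (B * norm (f x))"
        using mult_right_mono[OF order_trans[OF B[of x] abs_ge_self], of "norm (f x)"]
        by (simp add: power2_eq_square abs_mult)
    qed
  qed (use schwartz_measurable[OF assms] in auto)
qed

section \<open>The Fourier transform of a Schwartz function\<close>

lemma fourier_cis: "fourier f \<xi> = (LINT x|lborel. f x * cis (2 * pi * (-1) * (\<xi> \<bullet> x)))"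
  by (simp add: fourier_def cis_conv_exp inner_commute mult_ac)

lemma norm_fourier_le:
  assumes "integrable lborel f"
  shows "norm (fourier f \<xi>) \<le> (LINT x|lborel. norm (f x))"
  unfolding fourier_cis by (rule order_trans[OF integral_norm_bound]) (simp add: norm_mult)

lemma measurable_fourier [measurable]:
  assumes [measurable]: "f \<in> borel_measurable borel"
  shows "fourier f \<in> borel_measurable borel"
  unfolding fourier_cis by measurable

lemma integrable_mult_cis:
  assumes "integrable lborel f"
  shows "integrable lborel (\<lambda>x. f x * cis (2 * pi * (-1) * (\<xi> \<bullet> x)))"
  using borel_measurable_integrable[OF assms]
  by (intro Bochner_Integration.integrable_bound[OF assms]) (auto simp: norm_mult)

lemma fourier_shift:
  assumes [measurable]: "f \<in> borel_measurable borel"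
  shows "fourier (\<lambda>x. f (x + v)) \<xi> = cis (2 * pi * (\<xi> \<bullet> v)) * fourier f \<xi>"
proof -
  have "fourier (\<lambda>x. f (x + v)) \<xi> = (LINT x|lborel. cis (2 * pi * (\<xi> \<bullet> v)) * (f (v + x) * cis (2 * pi * (-1) * (\<xi> \<bullet> (v + x)))))"
    unfolding fourier_cis
    by (intro Bochner_Integration.integral_cong) (auto simp: cis_mult algebra_simps inner_add_right)
  also have "\<dots> = cis (2 * pi * (\<xi> \<bullet> v)) * (LINT x|lborel. f (v + x) * cis (2 * pi * (-1) * (\<xi> \<bullet> (v + x))))"
    by (rule integral_mult_right_zero)
  also have "(LINT x|lborel. f (v + x) * cis (2 * pi * (-1) * (\<xi> \<bullet> (v + x)))) = fourier f \<xi>"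
    unfolding fourier_cis by (rule integral_lborel_shift) measurable
  finally show ?thesis .
qed

lemma tendsto_difference_quotient:
  assumes "(\<phi> has_vector_derivative d) (at (0::real))"
  shows "(\<lambda>k. (1 / (1 / real (Suc k))) *\<^sub>R (\<phi> (1 / real (Suc k)) - \<phi> 0)) \<longlonglongrightarrow> d"
proof -
  have "((\<lambda>t. (1 / t) *\<^sub>R (\<phi> t - \<phi> 0)) \<longlongrightarrow> d) (at 0)"
  proof -
    have "((\<lambda>h. norm (\<phi> (0 + h) - \<phi> 0 - h *\<^sub>R d) / norm h) \<longlongrightarrow> 0) (at 0)"
      using assms unfolding has_vector_derivative_def has_derivative_at by blast
    moreover have "norm ((1 / h) *\<^sub>R (\<phi> h - \<phi> 0) - d) = norm (\<phi> (0 + h) - \<phi> 0 - h *\<^sub>R d) / norm h"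
      if "h \<noteq> 0" for h
    proof -
      have "(1 / h) *\<^sub>R (\<phi> h - \<phi> 0) - d = (1 / h) *\<^sub>R (\<phi> (0 + h) - \<phi> 0 - h *\<^sub>R d)"
        using that by (simp add: scaleR_diff_right)
      then show ?thesis
        by (simp only: norm_scaleR) simp
    qed
    ultimately have "((\<lambda>h. norm ((1 / h) *\<^sub>R (\<phi> h - \<phi> 0) - d)) \<longlongrightarrow> 0) (at 0)"
      by (subst tendsto_cong) (auto simp: eventually_at_filter)
    then show ?thesis
      by (simp add: tendsto_norm_zero_iff LIM_zero_iff)
  qed
  moreover have "filterlim (\<lambda>k. 1 / real (Suc k)) (at 0) sequentially"
    using lim_inverse_n'[THEN LIMSEQ_Suc]
    by (auto simp: filterlim_at inverse_eq_divide)
  ultimately show ?thesis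
    by (rule filterlim_compose)
qed

text \<open>Difference quotients take the place of integration by parts. The transform of a
  translate is a phase times the transform, so the transforms of the quotients converge to the right
  side; dominated convergence, with the shifted \<open>decay\<close> as majorant, shows that they
  also converge to the left side.\<close>

lemma fourier_partial_deriv:
  fixes f :: "'a::euclidean_space \<Rightarrow> complex"
  assumes f: "schwartz f" and b: "b \<in> Basis"
  shows "fourier (partial_deriv b f) \<xi> = (2 * pi * (\<xi> \<bullet> b)) *\<^sub>R (\<i> * fourier f \<xi>)"
proof -
  note [measurable] = schwartz_measurable[OF f]
  have pd: "iter_partial [b] f = partial_deriv b f"
    by (simp add: iter_partial_def)
  have [measurable]: "partial_deriv b f \<in> borel_measurable borel"
    using schwartz_measurable[OF schwartz_iter_partial[OF f, of "[b]"]] b by (simp add: pd)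
  obtain C where C: "C > 0" "norm (partial_deriv b f x) \<le> C * decay x" for x
    using schwartz_decay[OF schwartz_iter_partial[OF f, of "[b]"]] b by (auto simp: pd)
  have hp: "has_iter_partial [b] f"
    using schwartz_has_iter_partial[OF f, of "[b]"] b by simp
  define t where "t k = 1 / real (Suc k)" for k
  have t: "0 < t k" "t k \<le> 1" for k
    by (auto simp: t_def)
  define D where "D k x = (1 / t k) *\<^sub>R (f (x + t k *\<^sub>R b) - f x)" for k x
  have [measurable]: "D k \<in> borel_measurable borel" for k
    unfolding D_def by measurable
  have D_le: "norm (D k x) \<le> (C * 4 ^ DIM('a)) * decay x" for k x
  proof -
    have "norm (f (x + t k *\<^sub>R b) - f x) \<le> (C * (4 ^ DIM('a) * decay x)) * \<bar>t k\<bar>"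
    proof (rule norm_diff_le_partial[OF hp, of "t k" x, simplified pd iter_partial_Nil])
      fix s assume "s \<in> closed_segment 0 (t k)"
      then have "norm (s *\<^sub>R b) \<le> 1"
        using t[of k] b by (auto simp: closed_segment_eq_real_ivl)
      from decay_shift[OF this] C(1) have "C * decay (x + s *\<^sub>R b) \<le> C * (4 ^ DIM('a) * decay x)"
        by (intro mult_left_mono) auto
      with C(2) show "norm (partial_deriv b f (x + s *\<^sub>R b)) \<le> C * (4 ^ DIM('a) * decay x)"
        using order_trans by blast
    qed
    moreover have "norm (D k x) = norm (f (x + t k *\<^sub>R b) - f x) / t k"
      using t[of k] by (simp add: D_def flip: scaleR_diff_right)
    ultimately show ?thesis
      using t[of k] by (simp add: pos_divide_le_eq mult_ac)
  qed
  have lim1: "(\<lambda>k. fourier (D k) \<xi>) \<longlonglongrightarrow> fourier (partial_deriv b f) \<xi>"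
    unfolding fourier_cis
  proof (rule integral_dominated_convergence)
    show "integrable lborel (\<lambda>x::'a. (C * 4 ^ DIM('a)) * decay x)"
      by (rule integrable_mult_right[OF integrable_decay])
    show "AE x in lborel. (\<lambda>k. D k x * cis (2 * pi * - 1 * (\<xi> \<bullet> x))) \<longlonglongrightarrow> partial_deriv b f x * cis (2 * pi * - 1 * (\<xi> \<bullet> x))"
    proof (intro always_eventually allI tendsto_mult tendsto_const)
      fix x
      have "((\<lambda>t. f (x + t *\<^sub>R b)) has_vector_derivative partial_deriv b f x) (at 0)"
        using has_vector_derivative_partial[OF hp, of x 0] by (simp add: pd)
      from tendsto_difference_quotient[OF this]
      show "(\<lambda>k. D k x) \<longlonglongrightarrow> partial_deriv b f x"
        by (simp add: D_def t_def)
    qed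
    show "AE x in lborel. norm (D k x * cis (2 * pi * - 1 * (\<xi> \<bullet> x))) \<le> C * 4 ^ DIM('a) * decay x" for k
      using D_le by (auto simp: norm_mult)
  qed measurable
  have D_fourier: "fourier (D k) \<xi> = (1 / t k) *\<^sub>R (cis (2 * pi * (\<xi> \<bullet> b) * t k) - cis (2 * pi * (\<xi> \<bullet> b) * 0)) * fourier f \<xi>" for k
  proof -
    have int: "integrable lborel f" "integrable lborel (\<lambda>x. f (x + t k *\<^sub>R b))"
      using schwartz_integrable[OF f] integrable_lborel_shift[of f "t k *\<^sub>R b"]
      by (auto simp: add.commute)
    have "fourier (D k) \<xi> = (LINT x|lborel. (1 / t k) *\<^sub>R (f (x + t k *\<^sub>R b) * cis (2 * pi * (-1) * (\<xi> \<bullet> x)) - f x * cis (2 * pi * (-1) * (\<xi> \<bullet> x))))"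
      unfolding fourier_cis D_def by (simp add: left_diff_distrib)
    also have "\<dots> = (1 / t k) *\<^sub>R (fourier (\<lambda>x. f (x + t k *\<^sub>R b)) \<xi> - fourier f \<xi>)"
      unfolding fourier_cis using integrable_mult_cis[OF int(1)] integrable_mult_cis[OF int(2)]
      by (subst integral_scaleR_right, subst Bochner_Integration.integral_diff) auto
    also have "\<dots> = (1 / t k) *\<^sub>R (cis (2 * pi * (\<xi> \<bullet> b) * t k) - cis (2 * pi * (\<xi> \<bullet> b) * 0)) * fourier f \<xi>"
      by (subst fourier_shift) (auto simp: algebra_simps)
    finally show ?thesis .
  qed
  have lim2: "(\<lambda>k. fourier (D k) \<xi>) \<longlonglongrightarrow> ((2 * pi * (\<xi> \<bullet> b)) *\<^sub>R \<i>) * fourier f \<xi>"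
    unfolding D_fourier t_def
    by (intro tendsto_mult tendsto_const tendsto_difference_quotient)
       (auto intro!: derivative_eq_intros simp: has_vector_derivative_def)
  show ?thesis
    using LIMSEQ_unique[OF lim1 lim2] by simp
qed

text \<open>Taking \<open>2 * DIM('a)\<close> derivatives in one direction \<open>b\<close> bounds
  that power of the \<open>b\<close>-coordinate of \<xi> times the transform. The direction of the
  largest coordinate controls \<open>norm \<xi>\<close> up to the factor \<open>DIM('a)\<close>, and
  the exponent is the one in \<open>decay\<close>.\<close>

lemma integrable_fourier:
  fixes f :: "'a::euclidean_space \<Rightarrow> complex"
  assumes f: "schwartz f"
  shows "integrable lborel (fourier f)"
proof -
  note [measurable] = schwartz_measurable[OF f]
  have it: "norm (fourier (iter_partial (replicate k b) f) \<xi>) = (2 * pi * \<bar>\<xi> \<bullet> b\<bar>) ^ k * norm (fourier f \<xi>)"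
    if b: "b \<in> Basis" for k b \<xi>
  proof (induction k)
    case (Suc k)
    have "multi_index (replicate k b)"
      using b by (auto simp: multi_index_def)
    from fourier_partial_deriv[OF schwartz_iter_partial[OF f this] b, of \<xi>] Suc
    show ?case
      by (simp add: iter_partial_def norm_mult abs_mult)
  qed auto
  define k where "k = 2 * DIM('a)"
  define C where "C b = (LINT x|lborel. norm (iter_partial (replicate k b) f x))" for b
  have C: "(2 * pi * \<bar>\<xi> \<bullet> b\<bar>) ^ k * norm (fourier f \<xi>) \<le> C b" if b: "b \<in> Basis" for b \<xi>
  proof -
    have "multi_index (replicate k b)"
      using b by (auto simp: multi_index_def)
    from norm_fourier_le[OF schwartz_integrable[OF schwartz_iter_partial[OF f this]], of \<xi>]
    show ?thesis
      by (simp add: it[OF b] C_def)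
  qed
  have C': "\<bar>\<xi> \<bullet> b\<bar> ^ k * norm (fourier f \<xi>) \<le> C b" if b: "b \<in> Basis" for b \<xi>
  proof -
    have "\<bar>\<xi> \<bullet> b\<bar> \<le> 2 * pi * \<bar>\<xi> \<bullet> b\<bar>"
      using pi_ge_two by (intro mult_right_mono[of 1 "2 * pi", simplified]) auto
    then have "\<bar>\<xi> \<bullet> b\<bar> ^ k * norm (fourier f \<xi>) \<le> (2 * pi * \<bar>\<xi> \<bullet> b\<bar>) ^ k * norm (fourier f \<xi>)"
      by (intro mult_right_mono power_mono) auto
    with C[OF b] show ?thesis
      using order_trans by blast
  qed
  have "norm \<xi> ^ k * norm (fourier f \<xi>) \<le> real DIM('a) ^ k * (\<Sum>b\<in>Basis. C b)" for \<xi>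
  proof -
    have "Max ((\<lambda>b. \<bar>\<xi> \<bullet> b\<bar>) ` Basis) \<in> (\<lambda>b. \<bar>\<xi> \<bullet> b\<bar>) ` Basis"
      by (intro Max_in) auto
    then obtain b0 where "b0 \<in> Basis" "Max ((\<lambda>b. \<bar>\<xi> \<bullet> b\<bar>) ` Basis) = \<bar>\<xi> \<bullet> b0\<bar>"
      by blast
    moreover have "\<bar>\<xi> \<bullet> b\<bar> \<le> Max ((\<lambda>b. \<bar>\<xi> \<bullet> b\<bar>) ` Basis)" if "b \<in> Basis" for b
      using that by (intro Max_ge) auto
    ultimately have b0: "b0 \<in> Basis" "\<And>b. b \<in> Basis \<Longrightarrow> \<bar>\<xi> \<bullet> b\<bar> \<le> \<bar>\<xi> \<bullet> b0\<bar>"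
      by auto
    have "norm \<xi> \<le> (\<Sum>b\<in>Basis. \<bar>\<xi> \<bullet> b\<bar>)"
      by (rule norm_le_l1)
    also have "\<dots> \<le> real DIM('a) * \<bar>\<xi> \<bullet> b0\<bar>"
      using sum_bounded_above[of Basis "\<lambda>b. \<bar>\<xi> \<bullet> b\<bar>" "\<bar>\<xi> \<bullet> b0\<bar>"] b0 by simp
    finally have "norm \<xi> ^ k * norm (fourier f \<xi>) \<le> (real DIM('a) * \<bar>\<xi> \<bullet> b0\<bar>) ^ k * norm (fourier f \<xi>)"
      by (intro mult_right_mono power_mono) auto
    also have "\<dots> = real DIM('a) ^ k * (\<bar>\<xi> \<bullet> b0\<bar> ^ k * norm (fourier f \<xi>))"
      by (simp add: power_mult_distrib)
    also have "\<dots> \<le> real DIM('a) ^ k * C b0"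
      using C'[OF b0(1), of \<xi>] by (intro mult_left_mono) auto
    also have "\<dots> \<le> real DIM('a) ^ k * (\<Sum>b\<in>Basis. C b)"
      using b0(1) by (intro mult_left_mono member_le_sum) (auto simp: C_def)
    finally show ?thesis .
  qed
  then have le: "norm (fourier f \<xi>) \<le> (4 ^ DIM('a) * (\<bar>LINT x|lborel. norm (f x)\<bar> + \<bar>real DIM('a) ^ k * (\<Sum>b\<in>Basis. C b)\<bar>)) * decay \<xi>" for \<xi>
    using norm_fourier_le[OF schwartz_integrable[OF f], of \<xi>]
    by (intro le_decayI) (auto simp: k_def)
  show ?thesis
  proof (rule Bochner_Integration.integrable_bound[OF integrable_mult_right[OF integrable_decay]])
    show "AE \<xi> in lborel. norm (fourier f \<xi>) \<le> norm ((4 ^ DIM('a) * (\<bar>LINT x|lborel. norm (f x)\<bar> +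
        \<bar>real DIM('a) ^ k * (\<Sum>b\<in>Basis. C b)\<bar>)) * decay \<xi>)"
      unfolding real_norm_def by (intro always_eventually allI order_trans[OF le abs_ge_self])
  qed measurable
qed

lemma nn_integral_fourier_le:
  assumes f: "schwartz f"
  shows "(\<integral>\<^sup>+\<xi>. ennreal ((cmod (fourier f \<xi>))\<^sup>2) \<partial>lborel) \<le> ennreal ((Lp_norm 2 f)\<^sup>2)"
proof -
  have "(\<integral>\<^sup>+\<xi>. ennreal ((cmod (fourier f \<xi>))\<^sup>2) \<partial>lborel) \<le> (\<integral>\<^sup>+x. ennreal ((cmod (f x))\<^sup>2) \<partial>lborel)"
    unfolding fourier_cis by (rule plancherel_le[OF schwartz_integrable[OF f]]) simp
  also have "\<dots> = ennreal (LINT x|lborel. (cmod (f x))\<^sup>2)"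
    by (rule nn_integral_eq_integral[OF schwartz_L2[OF f]]) simp
  also have "(LINT x|lborel. (cmod (f x))\<^sup>2) = (Lp_norm 2 f)\<^sup>2"
    by (simp add: Lp_norm_def powr_half_sqrt)
  finally show ?thesis .
qed

section \<open>The bilinear form on the Fourier side\<close>

lemma
  fixes f :: "'a::euclidean_space \<Rightarrow> complex" and g :: "'b::euclidean_space \<Rightarrow> complex"
  assumes f: "integrable lborel f" and g: "integrable lborel g"
  shows integrable_pair_mult: "integrable (lborel \<Otimes>\<^sub>M lborel) (\<lambda>p. f (fst p) * g (snd p))"
    and integral_pair_mult: "(LINT p|(lborel \<Otimes>\<^sub>M lborel). f (fst p) * g (snd p)) =
      (LINT x|lborel. f x) * (LINT y|lborel. g y)"
proof -
  note [measurable] = borel_measurable_integrable[OF f, simplified] borel_measurable_integrable[OF g, simplified]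
  show *: "integrable (lborel \<Otimes>\<^sub>M lborel) (\<lambda>p. f (fst p) * g (snd p))"
    by (rule lborel_pair.Fubini_integrable) (use f g in \<open>auto simp: norm_mult\<close>)
  show "(LINT p|(lborel \<Otimes>\<^sub>M lborel). f (fst p) * g (snd p)) = (LINT x|lborel. f x) * (LINT y|lborel. g y)"
    by (subst lborel_pair.integral_fst'[symmetric, OF *]) simp
qed

text \<open>\<open>F\<close> and \<open>G\<close> take the place of the Fourier transforms, so that
  all estimates are made for arbitrary integrable functions on the frequency side. A single integral
  over the product space makes linearity in \<open>m\<close> immediate.\<close>

definition bil :: "('a::euclidean_space \<Rightarrow> complex) \<Rightarrow> ('a \<Rightarrow> complex) \<Rightarrow> ('a \<times> 'a \<Rightarrow> complex) \<Rightarrow> 'a \<Rightarrow> complex" where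
  "bil F G m x = (LINT p|lborel. m p * (F (fst p) * G (snd p) * cis (2 * pi * (x \<bullet> (fst p + snd p)))))"

lemma integrable_bil:
  fixes F G :: "'a::euclidean_space \<Rightarrow> complex" and m :: "'a \<times> 'a \<Rightarrow> complex"
  assumes F: "integrable lborel F" and G: "integrable lborel G"
    and m [measurable]: "m \<in> borel_measurable borel" and bnd: "\<And>p. norm (m p) \<le> B"
  shows "integrable lborel (\<lambda>p. m p * (F (fst p) * G (snd p) * cis (2 * pi * (x \<bullet> (fst p + snd p)))))"
proof -
  note [measurable] = borel_measurable_integrable[OF F, simplified] borel_measurable_integrable[OF G, simplified]
  have FG: "integrable lborel (\<lambda>p. B * norm (F (fst p) * G (snd p)))"
    using integrable_pair_mult[OF F G] by (simp add: lborel_prod integrable_norm)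
  show ?thesis
  proof (rule Bochner_Integration.integrable_bound[OF FG])
    have "(\<lambda>p. F (fst p) * G (snd p) * cis (2 * pi * (x \<bullet> (fst p + snd p)))) \<in>
       borel_measurable (borel \<Otimes>\<^sub>M borel)"
      by measurable
    then have [measurable]: "(\<lambda>p. F (fst p) * G (snd p) * cis (2 * pi * (x \<bullet> (fst p + snd p)))) \<in> borel_measurable borel"
      by (simp only: borel_prod)
    show "(\<lambda>p. m p * (F (fst p) * G (snd p) * cis (2 * pi * (x \<bullet> (fst p + snd p))))) \<in> borel_measurable lborel"
      by measurable
    show "AE p in lborel. norm (m p * (F (fst p) * G (snd p) * cis (2 * pi * (x \<bullet> (fst p + snd p))))) \<le> norm (B * norm (F (fst p) * G (snd p)))"
      using order_trans[OF bnd abs_ge_self]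
      by (auto intro!: always_eventually mult_right_mono simp: norm_mult abs_mult)
  qed
qed

lemma bilinear_mult_eq_bil:
  assumes "schwartz f" "schwartz g" "m \<in> borel_measurable borel" "\<And>p. norm (m p) \<le> B"
  shows "bilinear_mult m f g x = bil (fourier f) (fourier g) m x"
proof -
  have "integrable (lborel \<Otimes>\<^sub>M lborel) (\<lambda>p. m p * (fourier f (fst p) * fourier g (snd p) * cis (2 * pi * (x \<bullet> (fst p + snd p)))))"
    unfolding lborel_prod
    using assms by (intro integrable_bil[where B=B] integrable_fourier) auto
  from lborel_pair.integral_fst'[OF this]
  show ?thesis
    by (simp add: bil_def bilinear_mult_def cis_conv_exp lborel_prod mult_ac)
qed

lemma bil_add:
  "bil F G (\<lambda>p. m1 p + m2 p) x = bil F G m1 x + bil F G m2 x"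
  if "integrable lborel F" "integrable lborel G" "m1 \<in> borel_measurable borel" "m2 \<in> borel_measurable borel"
     "\<And>p. norm (m1 p) \<le> B1" "\<And>p. norm (m2 p) \<le> B2"
  unfolding bil_def distrib_right
  by (intro Bochner_Integration.integral_add integrable_bil[where B=B1] integrable_bil[where B=B2] that)

text \<open>For fixed \<open>u\<close> the tensor \<open>b u\<close> times \<open>c u\<close> is the
  multiplier of a pointwise product \<open>P u x * R u x\<close>. Cauchy-Schwarz is applied once,
  jointly in \<open>u\<close> and \<open>x\<close>, and the Plancherel inequality then for each
  \<open>u\<close> separately. The bound \<open>K\<close> guarantees the absolute convergence behind
  the exchange of the \<open>u\<close>-integral with the frequency integral. Squares are kept on
  both sides because the quantities are extended reals.\<close>

lemma bil_L1_le:
  fixes F G :: "'a::euclidean_space \<Rightarrow> complex" and b c :: "'a \<Rightarrow> 'a \<Rightarrow> complex"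
  assumes F: "integrable lborel F" and G: "integrable lborel G"
    and b [measurable]: "case_prod b \<in> borel_measurable (borel \<Otimes>\<^sub>M borel)" and b_le: "\<And>u \<xi>. norm (b u \<xi>) \<le> B"
    and c [measurable]: "case_prod c \<in> borel_measurable (borel \<Otimes>\<^sub>M borel)" and c_le: "\<And>u \<eta>. norm (c u \<eta>) \<le> C"
    and bc: "\<And>\<xi> \<eta>. (\<integral>\<^sup>+u. ennreal (norm (b u \<xi>) * norm (c u \<eta>)) \<partial>lborel) \<le> ennreal K"
    and m: "\<And>p. m p = (LINT u|lborel. b u (fst p) * c u (snd p))"
  shows "(\<integral>\<^sup>+x. ennreal (norm (bil F G m x)) \<partial>lborel)\<^sup>2 \<le>
    (\<integral>\<^sup>+u. \<integral>\<^sup>+\<xi>. ennreal ((norm (b u \<xi> * F \<xi>))\<^sup>2) \<partial>lborel \<partial>lborel) *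
    (\<integral>\<^sup>+u. \<integral>\<^sup>+\<eta>. ennreal ((norm (c u \<eta> * G \<eta>))\<^sup>2) \<partial>lborel \<partial>lborel)"
proof -
  note [measurable] = borel_measurable_integrable[OF F, simplified] borel_measurable_integrable[OF G, simplified]
  define P where "P u x = (LINT \<xi>|lborel. b u \<xi> * F \<xi> * cis (2 * pi * 1 * (x \<bullet> \<xi>)))" for u x
  define R where "R u x = (LINT \<eta>|lborel. c u \<eta> * G \<eta> * cis (2 * pi * 1 * (x \<bullet> \<eta>)))" for u x
  have bF: "integrable lborel (\<lambda>\<xi>. b u \<xi> * F \<xi>)" for u
    using order_trans[OF b_le abs_ge_self]
    by (intro Bochner_Integration.integrable_bound[OF integrable_mult_right[OF integrable_norm[OF F], of B]])
       (auto intro!: mult_right_mono simp: norm_mult abs_mult)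
  have cG: "integrable lborel (\<lambda>\<eta>. c u \<eta> * G \<eta>)" for u
    using order_trans[OF c_le abs_ge_self]
    by (intro Bochner_Integration.integrable_bound[OF integrable_mult_right[OF integrable_norm[OF G], of C]])
       (auto intro!: mult_right_mono simp: norm_mult abs_mult)
  have bF': "integrable lborel (\<lambda>\<xi>. b u \<xi> * F \<xi> * cis (2 * pi * 1 * (x \<bullet> \<xi>)))" for u x
    by (intro Bochner_Integration.integrable_bound[OF bF[of u]]) (auto simp: norm_mult)
  have cG': "integrable lborel (\<lambda>\<eta>. c u \<eta> * G \<eta> * cis (2 * pi * 1 * (x \<bullet> \<eta>)))" for u x
    by (intro Bochner_Integration.integrable_bound[OF cG[of u]]) (auto simp: norm_mult)
  have T_le: "ennreal (norm (bil F G m x)) \<le> (\<integral>\<^sup>+u. ennreal (norm (P u x)) * ennreal (norm (R u x)) \<partial>lborel)" for x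
  proof -
    define \<Phi> where "\<Phi> u p = (b u (fst p) * F (fst p) * cis (2 * pi * 1 * (x \<bullet> fst p))) *
      (c u (snd p) * G (snd p) * cis (2 * pi * 1 * (x \<bullet> snd p)))" for u and p :: "'a \<times> 'a"
    have "case_prod \<Phi> \<in> borel_measurable (borel \<Otimes>\<^sub>M (borel \<Otimes>\<^sub>M borel))"
      unfolding \<Phi>_def by measurable
    then have [measurable]: "case_prod \<Phi> \<in> borel_measurable (borel \<Otimes>\<^sub>M borel)"
      by (simp only: borel_prod)
    have \<Phi>_int: "integrable (lborel \<Otimes>\<^sub>M lborel) (case_prod \<Phi>)"
    proof (rule integrableI_bounded)
      have "(\<integral>\<^sup>+q. ennreal (norm (case_prod \<Phi> q)) \<partial>(lborel \<Otimes>\<^sub>M lborel)) =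
        (\<integral>\<^sup>+p. \<integral>\<^sup>+u. ennreal (norm (\<Phi> u p)) \<partial>lborel \<partial>lborel)"
        by (subst lborel_pair.nn_integral_snd[symmetric]) auto
      also have "\<dots> \<le> (\<integral>\<^sup>+p. ennreal K * ennreal (norm (F (fst p) * G (snd p))) \<partial>lborel)"
      proof (rule nn_integral_mono)
        fix p
        have "(\<integral>\<^sup>+u. ennreal (norm (\<Phi> u p)) \<partial>lborel) =
          (\<integral>\<^sup>+u. ennreal (norm (b u (fst p)) * norm (c u (snd p))) * ennreal (norm (F (fst p) * G (snd p))) \<partial>lborel)"
          by (intro nn_integral_cong) (simp add: \<Phi>_def norm_mult ennreal_mult'[symmetric] mult_ac)
        also have "\<dots> \<le> ennreal K * ennreal (norm (F (fst p) * G (snd p)))"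
          using bc by (subst nn_integral_multc) (auto intro!: mult_right_mono)
        finally show "(\<integral>\<^sup>+u. ennreal (norm (\<Phi> u p)) \<partial>lborel) \<le> ennreal K * ennreal (norm (F (fst p) * G (snd p)))" .
      qed
      also have "\<dots> = ennreal K * (\<integral>\<^sup>+p. ennreal (norm (F (fst p) * G (snd p))) \<partial>(lborel \<Otimes>\<^sub>M lborel))"
        unfolding lborel_prod[symmetric] by (rule nn_integral_cmult) measurable
      also have "\<dots> < \<infinity>"
        using integrable_pair_mult[OF F G]
        by (auto simp: integrable_iff_bounded ennreal_mult_less_top)
      finally show "(\<integral>\<^sup>+q. ennreal (norm (case_prod \<Phi> q)) \<partial>(lborel \<Otimes>\<^sub>M lborel)) < \<infinity>" .
    qed measurable
    have inner: "(LINT p|lborel. \<Phi> u p) = P u x * R u x" for u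
      unfolding \<Phi>_def P_def R_def lborel_prod[symmetric] by (rule integral_pair_mult[OF bF' cG'])
    have "bil F G m x = (LINT p|lborel. LINT u|lborel. \<Phi> u p)"
      unfolding bil_def m
      by (simp add: \<Phi>_def inner_add_right distrib_left cis_mult[symmetric] mult_ac flip: integral_mult_right_zero integral_mult_left_zero)
    also have "\<dots> = (LINT u|lborel. LINT p|lborel. \<Phi> u p)"
      by (rule lborel_pair.Fubini_integral[OF \<Phi>_int])
    finally have "bil F G m x = (LINT u|lborel. P u x * R u x)"
      by (simp add: inner)
    moreover have "integrable lborel (\<lambda>u. P u x * R u x)"
      using lborel_pair.integrable_fst[OF \<Phi>_int] by (simp add: inner)
    ultimately show ?thesis
      using integral_norm_bound_ennreal[of lborel "\<lambda>u. P u x * R u x"]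
      by (simp add: norm_mult ennreal_mult)
  qed
  have [measurable]: "case_prod P \<in> borel_measurable (lborel \<Otimes>\<^sub>M lborel)"
    "case_prod R \<in> borel_measurable (lborel \<Otimes>\<^sub>M lborel)"
    unfolding P_def R_def by measurable
  have "(\<integral>\<^sup>+x. ennreal (norm (bil F G m x)) \<partial>lborel) \<le>
      (\<integral>\<^sup>+x. \<integral>\<^sup>+u. ennreal (norm (P u x)) * ennreal (norm (R u x)) \<partial>lborel \<partial>lborel)"
    by (intro nn_integral_mono T_le)
  also have "\<dots> = (\<integral>\<^sup>+q. ennreal (norm (case_prod P q)) * ennreal (norm (case_prod R q)) \<partial>(lborel \<Otimes>\<^sub>M lborel))"
    by (subst lborel_pair.nn_integral_snd[symmetric]) auto
  finally have "(\<integral>\<^sup>+x. ennreal (norm (bil F G m x)) \<partial>lborel)\<^sup>2 \<le>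
      (\<integral>\<^sup>+q. ennreal (norm (case_prod P q)) * ennreal (norm (case_prod R q)) \<partial>(lborel \<Otimes>\<^sub>M lborel))\<^sup>2"
    by (rule power_mono_ennreal)
  also have "\<dots> \<le> (\<integral>\<^sup>+q. (ennreal (norm (case_prod P q)))\<^sup>2 \<partial>(lborel \<Otimes>\<^sub>M lborel)) *
      (\<integral>\<^sup>+q. (ennreal (norm (case_prod R q)))\<^sup>2 \<partial>(lborel \<Otimes>\<^sub>M lborel))"
    by (rule Cauchy_Schwarz_nn_integral) measurable
  also have "\<dots> = (\<integral>\<^sup>+u. \<integral>\<^sup>+x. ennreal ((norm (P u x))\<^sup>2) \<partial>lborel \<partial>lborel) *
       (\<integral>\<^sup>+u. \<integral>\<^sup>+x. ennreal ((norm (R u x))\<^sup>2) \<partial>lborel \<partial>lborel)"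
    by (subst (1 2) lborel.nn_integral_fst[symmetric]) (auto simp: ennreal_power)
  also have "\<dots> \<le> (\<integral>\<^sup>+u. \<integral>\<^sup>+\<xi>. ennreal ((norm (b u \<xi> * F \<xi>))\<^sup>2) \<partial>lborel \<partial>lborel) *
    (\<integral>\<^sup>+u. \<integral>\<^sup>+\<eta>. ennreal ((norm (c u \<eta> * G \<eta>))\<^sup>2) \<partial>lborel \<partial>lborel)"
    unfolding P_def R_def by (intro mult_mono nn_integral_mono plancherel_le[OF bF] plancherel_le[OF cG]) auto
  finally show ?thesis .
qed

section \<open>Averages with a tensor kernel\<close>

lemma measurable_bil:
  fixes F G :: "'a::euclidean_space \<Rightarrow> complex"
  assumes [measurable]: "F \<in> borel_measurable borel" "G \<in> borel_measurable borel"
    and m: "m \<in> borel_measurable borel"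
  shows "bil F G m \<in> borel_measurable borel"
proof -
  have [measurable]: "m \<in> borel_measurable (borel \<Otimes>\<^sub>M borel)"
    using m by (simp only: borel_prod)
  have "(\<lambda>x. LINT p|(lborel \<Otimes>\<^sub>M lborel). m p * (F (fst p) * G (snd p) * cis (2 * pi * (x \<bullet> (fst p + snd p)))))
     \<in> borel_measurable borel"
    by measurable
  then show ?thesis
    unfolding bil_def[abs_def] by (simp only: lborel_prod)
qed

text \<open>With the sign in \<open>x + v\<close> this is convolution with the reflected kernel; the
  ball kernels used later are even.\<close>

definition avg :: "('a::euclidean_space \<Rightarrow> real) \<Rightarrow> ('a \<Rightarrow> complex) \<Rightarrow> 'a \<Rightarrow> complex" where
  "avg k f x = (LINT v|lborel. of_real (k v) * f (x + v))"

definition prob_kernel :: "('a::euclidean_space \<Rightarrow> real) \<Rightarrow> bool" where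
  "prob_kernel k \<longleftrightarrow> k \<in> borel_measurable borel \<and> (\<forall>x. 0 \<le> k x) \<and> (\<integral>\<^sup>+x. ennreal (k x) \<partial>lborel) = 1"

definition tensor :: "('a \<Rightarrow> real) \<Rightarrow> 'a \<times> 'a \<Rightarrow> real" where
  "tensor k v = k (fst v) * k (snd v)"

lemma prob_kernelD:
  assumes "prob_kernel k"
  shows "k \<in> borel_measurable borel" "0 \<le> k x" "(\<integral>\<^sup>+x. ennreal (k x) \<partial>lborel) = 1"
    "integrable lborel k" "(LINT x|lborel. k x) = 1"
proof -
  show *: "k \<in> borel_measurable borel" "0 \<le> k x" "(\<integral>\<^sup>+x. ennreal (k x) \<partial>lborel) = 1" for x
    using assms by (auto simp: prob_kernel_def)
  show "integrable lborel k"
    using * by (intro integrableI_nonneg) auto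
  show "(LINT x|lborel. k x) = 1"
    using * by (subst integral_eq_nn_integral) auto
qed

lemma prob_kernel_shift:
  assumes k: "prob_kernel k"
  shows "prob_kernel (\<lambda>x. k (x - c))"
proof -
  note [measurable] = prob_kernelD(1)[OF k]
  have "(\<integral>\<^sup>+x. ennreal (k (x - c)) \<partial>lborel) = (\<integral>\<^sup>+x. ennreal (k x) \<partial>lborel)"
    using nn_integral_lborel_shift[of "\<lambda>x. ennreal (k x)" "- c"] by simp
  then show ?thesis
    using prob_kernelD[OF k] by (auto simp: prob_kernel_def)
qed

lemma prob_kernel_tensor:
  assumes k: "prob_kernel k"
  shows "prob_kernel (tensor k)"
proof -
  note [measurable] = prob_kernelD(1)[OF k]
  have m: "tensor k \<in> borel_measurable (borel \<Otimes>\<^sub>M borel)"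
    unfolding tensor_def by measurable
  have "(\<integral>\<^sup>+x. ennreal (tensor k x) \<partial>(lborel \<Otimes>\<^sub>M lborel)) =
    (\<integral>\<^sup>+x. \<integral>\<^sup>+y. ennreal (k x) * ennreal (k y) \<partial>lborel \<partial>lborel)"
    using m prob_kernelD(2)[OF k]
    by (subst lborel.nn_integral_fst[symmetric]) (auto simp: tensor_def ennreal_mult)
  also have "\<dots> = 1"
    using prob_kernelD(3)[OF k] by (simp add: nn_integral_cmult)
  finally show ?thesis
    using m prob_kernelD(2)[OF k] by (auto simp: prob_kernel_def tensor_def lborel_prod borel_prod)
qed

lemma
  fixes f :: "'a::euclidean_space \<Rightarrow> complex"
  assumes k: "prob_kernel k" and f [measurable]: "f \<in> borel_measurable borel" and le: "\<And>x. norm (f x) \<le> B"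
  shows integrable_kernel_mult: "integrable lborel (\<lambda>x. of_real (k x) * f x)"
    and norm_kernel_integral_le: "norm (LINT x|lborel. of_real (k x) * f x) \<le> B"
proof -
  note [measurable] = prob_kernelD(1)[OF k]
  have le': "norm (of_real (k x) * f x) \<le> B * k x" for x
    using mult_right_mono[OF le[of x] prob_kernelD(2)[OF k, of x]] prob_kernelD(2)[OF k, of x]
    by (simp add: norm_mult mult.commute)
  have int: "integrable lborel (\<lambda>x. B * k x)"
    using prob_kernelD(4)[OF k] by simp
  show *: "integrable lborel (\<lambda>x. of_real (k x) * f x)"
    by (rule Bochner_Integration.integrable_bound[OF int])
      (use order_trans[OF le' abs_ge_self] in auto)
  have "norm (LINT x|lborel. of_real (k x) * f x) \<le> (LINT x|lborel. B * k x)"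
    by (rule Bochner_Integration.integral_norm_bound_integral[OF * int le'])
  then show "norm (LINT x|lborel. of_real (k x) * f x) \<le> B"
    using prob_kernelD(5)[OF k] by simp
qed

lemma norm_avg_le:
  assumes "prob_kernel k" "f \<in> borel_measurable borel" "\<And>x. norm (f x) \<le> B"
  shows "norm (avg k f x) \<le> B"
  unfolding avg_def using assms by (intro norm_kernel_integral_le) auto

text \<open>Jensen's inequality for the square, obtained from Cauchy-Schwarz by writing
  \<open>k\<close> as the product of two factors \<open>sqrt k\<close>.\<close>

lemma kernel_integral_sq_le:
  fixes f :: "'a::euclidean_space \<Rightarrow> complex"
  assumes k: "prob_kernel k" and f [measurable]: "f \<in> borel_measurable borel" and le: "\<And>x. norm (f x) \<le> B"
  shows "ennreal ((norm (LINT x|lborel. of_real (k x) * f x))\<^sup>2) \<le> (\<integral>\<^sup>+x. ennreal (k x) * ennreal ((norm (f x))\<^sup>2) \<partial>lborel)"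
proof -
  note [measurable] = prob_kernelD(1)[OF k]
  have [simp]: "0 \<le> k x" for x by (rule prob_kernelD(2)[OF k])
  have "ennreal (norm (LINT x|lborel. of_real (k x) * f x)) \<le> (\<integral>\<^sup>+x. ennreal (norm (of_real (k x) * f x)) \<partial>lborel)"
    by (intro integral_norm_bound_ennreal integrable_kernel_mult[OF k f le])
  also have "\<dots> = (\<integral>\<^sup>+x. ennreal (sqrt (k x)) * ennreal (sqrt (k x) * norm (f x)) \<partial>lborel)"
    by (intro nn_integral_cong) (simp add: norm_mult flip: ennreal_mult' mult.assoc)
  finally have "(ennreal (norm (LINT x|lborel. of_real (k x) * f x)))\<^sup>2 \<le>
     (\<integral>\<^sup>+x. ennreal (sqrt (k x)) * ennreal (sqrt (k x) * norm (f x)) \<partial>lborel)\<^sup>2"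
    by (rule power_mono_ennreal)
  also have "\<dots> \<le> (\<integral>\<^sup>+x. (ennreal (sqrt (k x)))\<^sup>2 \<partial>lborel) * (\<integral>\<^sup>+x. (ennreal (sqrt (k x) * norm (f x)))\<^sup>2 \<partial>lborel)"
    by (rule Cauchy_Schwarz_nn_integral) measurable
  also have "(\<integral>\<^sup>+x. (ennreal (sqrt (k x)))\<^sup>2 \<partial>lborel) = 1"
    using prob_kernelD(3)[OF k] by (simp add: ennreal_power)
  also have "(\<lambda>x. (ennreal (sqrt (k x) * norm (f x)))\<^sup>2) = (\<lambda>x. ennreal (k x) * ennreal ((norm (f x))\<^sup>2))"
    by (auto simp: ennreal_power power_mult_distrib ennreal_mult)
  finally show ?thesis
    by (simp add: ennreal_power)
qed

text \<open>
  The multiplier is a superposition of the tensors \<open>k (u - \<xi>) k (v - \<eta>)\<close> with weights \<open>a (u, v)\<close>.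
  It is split into the part \<open>E\<close> of the plane where \<open>\<bar>a (u, v)\<bar>\<^sup>2\<close> is bounded by an integrable function \<open>W\<close>
  of \<open>u\<close> alone, and the rest, where the integral of \<open>\<bar>a\<bar>\<^sup>2\<close> over \<open>v\<close> is bounded. The threshold
  \<open>\<bar>a\<bar> ^ (p - 2) X\<^sup>2 \<le> S u\<close>, with \<open>S u\<close> the integral of \<open>\<bar>a (u, v)\<bar> ^ p\<close> over \<open>v\<close>, makes both
  bounds equal to \<open>X\<^sup>2\<close>.\<close>

lemma bil_tensor_avg_L1_le:
  fixes F G :: "'a::euclidean_space \<Rightarrow> complex" and a :: "'a \<times> 'a \<Rightarrow> complex" and k :: "'a \<Rightarrow> real"
  assumes F: "integrable lborel F" and G: "integrable lborel G"
    and F2: "(\<integral>\<^sup>+x. ennreal ((norm (F x))\<^sup>2) \<partial>lborel) \<le> ennreal (\<phi>\<^sup>2)" and \<phi>: "\<phi> \<ge> 0"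
    and G2: "(\<integral>\<^sup>+x. ennreal ((norm (G x))\<^sup>2) \<partial>lborel) \<le> ennreal (\<gamma>\<^sup>2)" and \<gamma>: "\<gamma> \<ge> 0"
    and k: "prob_kernel k" and k_le: "\<And>x. k x \<le> \<kappa>"
    and a: "a \<in> borel_measurable borel" and a_le: "\<And>w. norm (a w) \<le> A" and A: "A > 0"
    and p: "2 < p" "p < 4" and Q: "(\<integral>\<^sup>+w. ennreal (norm (a w) powr p) \<partial>lborel) \<le> ennreal Q"
    and X: "X > 0" "A powr (4 - p) * Q \<le> X ^ 4"
  shows "(\<integral>\<^sup>+x. ennreal (norm (bil F G (avg (tensor k) a) x)) \<partial>lborel) \<le> ennreal (2 * (sqrt \<kappa> * X * \<phi> * \<gamma>))"
proof -
  note [measurable] = borel_measurable_integrable[OF F, simplified] borel_measurable_integrable[OF G, simplified]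
    prob_kernelD(1)[OF k]
  have a' [measurable]: "a \<in> borel_measurable (borel \<Otimes>\<^sub>M borel)"
    using a by (simp only: borel_prod)
  have [simp]: "0 \<le> k x" for x by (rule prob_kernelD(2)[OF k])
  have \<kappa>: "\<kappa> \<ge> 0" using k_le[of 0] prob_kernelD(2)[OF k, of 0] by linarith
  define S where "S u = (\<integral>\<^sup>+v. ennreal (norm (a (u, v)) powr p) \<partial>lborel)" for u
  have [measurable]: "S \<in> borel_measurable borel"
    unfolding S_def by measurable
  have S_int: "(\<integral>\<^sup>+u. S u \<partial>lborel) \<le> ennreal Q"
  proof -
    have "(\<integral>\<^sup>+u. S u \<partial>lborel) = (\<integral>\<^sup>+w. ennreal (norm (a w) powr p) \<partial>(lborel \<Otimes>\<^sub>M lborel))"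
      unfolding S_def by (rule lborel.nn_integral_fst) measurable
    with Q show ?thesis
      by (simp add: lborel_prod)
  qed
  define E where "E w \<longleftrightarrow> ennreal (norm (a w) powr (p - 2) * X\<^sup>2) \<le> S (fst w)" for w
  have [measurable]: "Measurable.pred (borel \<Otimes>\<^sub>M borel) E"
    unfolding E_def by measurable
  define a1 where "a1 w = (if E w then a w else 0)" for w
  define a2 where "a2 w = (if E w then 0 else a w)" for w
  have [measurable]: "a1 \<in> borel_measurable (borel \<Otimes>\<^sub>M borel)" "a2 \<in> borel_measurable (borel \<Otimes>\<^sub>M borel)"
    unfolding a1_def a2_def by measurable
  have a_split: "a w = a1 w + a2 w" for w
    by (simp add: a1_def a2_def)
  have a1_le: "norm (a1 w) \<le> A" and a2_le: "norm (a2 w) \<le> A" for w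
    using a_le[of w] A by (auto simp: a1_def a2_def)

  \<comment> \<open>For \<open>a1\<close> the variable \<open>u\<close> stays outside as the
    superposition parameter and the average over \<open>v\<close> is absorbed into
    \<open>c1\<close>; for \<open>a2\<close> the roles of \<open>u\<close> and \<open>v\<close> are
    exchanged. The outer variable decides whether the sup over \<open>v\<close> or the integral over
    \<open>v\<close> of the squared modulus has to be controlled.\<close>
  define b1 where "b1 u \<xi> = complex_of_real (k (u - \<xi>))" for u \<xi>
  define c1 where "c1 u \<eta> = (LINT v|lborel. complex_of_real (k (v - \<eta>)) * a1 (u, v))" for u \<eta>
  define b2 where "b2 v \<xi> = (LINT u|lborel. complex_of_real (k (u - \<xi>)) * a2 (u, v))" for v \<xi>
  define c2 where "c2 v \<eta> = complex_of_real (k (v - \<eta>))" for v \<eta>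
  have [measurable]: "case_prod b1 \<in> borel_measurable (borel \<Otimes>\<^sub>M borel)" "case_prod c1 \<in> borel_measurable (borel \<Otimes>\<^sub>M borel)"
    "case_prod b2 \<in> borel_measurable (borel \<Otimes>\<^sub>M borel)" "case_prod c2 \<in> borel_measurable (borel \<Otimes>\<^sub>M borel)"
    unfolding b1_def c1_def b2_def c2_def by measurable
  have b1_le: "norm (b1 u \<xi>) \<le> \<kappa>" and c2_le: "norm (c2 u \<xi>) \<le> \<kappa>" for u \<xi>
    using k_le by (auto simp: b1_def c2_def)
  have c1_le: "norm (c1 u \<eta>) \<le> A" for u \<eta>
    unfolding c1_def by (intro norm_kernel_integral_le prob_kernel_shift k a1_le) measurable
  have b2_le: "norm (b2 v \<xi>) \<le> A" for v \<xi>
    unfolding b2_def by (intro norm_kernel_integral_le prob_kernel_shift k a2_le) measurable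
  define m1 where "m1 w = (LINT u|lborel. b1 u (fst w) * c1 u (snd w))" for w
  define m2 where "m2 w = (LINT v|lborel. b2 v (fst w) * c2 v (snd w))" for w

  have nnk: "(\<integral>\<^sup>+u. ennreal (k (u - \<xi>)) \<partial>lborel) = 1" for \<xi>
    by (rule prob_kernelD(3)[OF prob_kernel_shift[OF k]])
  have K1: "(\<integral>\<^sup>+u. ennreal (norm (b1 u \<xi>) * norm (c1 u \<eta>)) \<partial>lborel) \<le> ennreal A" for \<xi> \<eta>
  proof -
    have "(\<integral>\<^sup>+u. ennreal (norm (b1 u \<xi>) * norm (c1 u \<eta>)) \<partial>lborel) \<le> (\<integral>\<^sup>+u. ennreal (k (u - \<xi>)) * ennreal A \<partial>lborel)"
      using c1_le A by (intro nn_integral_mono) (auto simp: b1_def ennreal_mult'[symmetric] intro!: ennreal_leI mult_left_mono)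
    also have "\<dots> = ennreal A"
      by (subst nn_integral_multc) (auto simp: nnk)
    finally show ?thesis .
  qed
  have K2: "(\<integral>\<^sup>+u. ennreal (norm (b2 u \<xi>) * norm (c2 u \<eta>)) \<partial>lborel) \<le> ennreal A" for \<xi> \<eta>
  proof -
    have "(\<integral>\<^sup>+u. ennreal (norm (b2 u \<xi>) * norm (c2 u \<eta>)) \<partial>lborel) \<le> (\<integral>\<^sup>+u. ennreal A * ennreal (k (u - \<eta>)) \<partial>lborel)"
      using b2_le A by (intro nn_integral_mono) (auto simp: c2_def ennreal_mult'[symmetric] intro!: ennreal_leI mult_right_mono)
    also have "\<dots> = ennreal A"
      by (subst nn_integral_cmult) (auto simp: nnk)
    finally show ?thesis .
  qed

  have avg_eq: "avg (tensor k) a w = m1 w + m2 w" for w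
  proof -
    obtain \<xi> \<eta> where w: "w = (\<xi>, \<eta>)" by (cases w)
    have kt: "prob_kernel (\<lambda>q. tensor k (q - w))"
      by (intro prob_kernel_shift prob_kernel_tensor k)
    have mb: "a1 \<in> borel_measurable borel" "a2 \<in> borel_measurable borel"
      unfolding borel_prod[symmetric] by measurable
    have [measurable]: "tensor k \<in> borel_measurable borel"
      by (intro prob_kernelD prob_kernel_tensor k)
    have int1: "integrable lborel (\<lambda>q. complex_of_real (tensor k (q - w)) * a1 q)"
      by (rule integrable_kernel_mult[OF kt mb(1) a1_le])
    have int2: "integrable lborel (\<lambda>q. complex_of_real (tensor k (q - w)) * a2 q)"
      by (rule integrable_kernel_mult[OF kt mb(2) a2_le])
    have "avg (tensor k) a w = (LINT v|lborel. complex_of_real (tensor k ((w + v) - w)) * a (w + v))"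
      by (simp add: avg_def)
    also have "\<dots> = (LINT q|lborel. complex_of_real (tensor k (q - w)) * a q)"
      by (intro integral_lborel_shift borel_measurable_times a) measurable
    also have "\<dots> = (LINT q|lborel. complex_of_real (tensor k (q - w)) * a1 q) +
        (LINT q|lborel. complex_of_real (tensor k (q - w)) * a2 q)"
      unfolding a_split distrib_left by (rule Bochner_Integration.integral_add[OF int1 int2])
    also have "(LINT q|lborel. complex_of_real (tensor k (q - w)) * a1 q) =
        (LINT u|lborel. LINT v|lborel. complex_of_real (tensor k ((u, v) - w)) * a1 (u, v))"
      using lborel_pair.integral_fst'[of "\<lambda>q. complex_of_real (tensor k (q - w)) * a1 q"] int1
      by (simp add: lborel_prod)
    also have "\<dots> = m1 w"
      by (simp add: m1_def b1_def c1_def w tensor_def mult.assoc)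
    also have "(LINT q|lborel. complex_of_real (tensor k (q - w)) * a2 q) =
        (LINT v|lborel. LINT u|lborel. complex_of_real (tensor k ((u, v) - w)) * a2 (u, v))"
      using lborel_pair.integral_snd[of "\<lambda>u v. complex_of_real (tensor k ((u, v) - w)) * a2 (u, v)"] int2
      by (simp add: lborel_prod case_prod_beta')
    also have "\<dots> = m2 w"
      by (simp add: m2_def b2_def c2_def w tensor_def mult_ac flip: integral_mult_right_zero)
    finally show ?thesis .
  qed

  \<comment> \<open>Only one of the two factors \<open>k\<close> is replaced by its maximum
    \<kappa>, while the other one still integrates to 1. This is why the final bound contains
    \<open>sqrt \<kappa>\<close> and not \<kappa>.\<close>
  have F_k: "(\<integral>\<^sup>+u. \<integral>\<^sup>+\<xi>. ennreal ((norm (complex_of_real (k (u - \<xi>)) * H \<xi>))\<^sup>2) \<partial>lborel \<partial>lborel) \<le> ennreal \<kappa> * ennreal (h\<^sup>2)"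
    if [measurable]: "H \<in> borel_measurable borel" and H: "(\<integral>\<^sup>+x. ennreal ((norm (H x))\<^sup>2) \<partial>lborel) \<le> ennreal (h\<^sup>2)" for H :: "'a \<Rightarrow> complex" and h
  proof -
    have "(\<integral>\<^sup>+u. \<integral>\<^sup>+\<xi>. ennreal ((norm (complex_of_real (k (u - \<xi>)) * H \<xi>))\<^sup>2) \<partial>lborel \<partial>lborel) =
       (\<integral>\<^sup>+\<xi>. \<integral>\<^sup>+u. ennreal ((norm (complex_of_real (k (u - \<xi>)) * H \<xi>))\<^sup>2) \<partial>lborel \<partial>lborel)"
      by (rule lborel_pair.Fubini') measurable
    also have "\<dots> \<le> (\<integral>\<^sup>+\<xi>. ennreal \<kappa> * ennreal ((norm (H \<xi>))\<^sup>2) \<partial>lborel)"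
    proof (rule nn_integral_mono)
      fix \<xi>
      have "(\<integral>\<^sup>+u. ennreal ((norm (complex_of_real (k (u - \<xi>)) * H \<xi>))\<^sup>2) \<partial>lborel) \<le>
          (\<integral>\<^sup>+u. ennreal (k (u - \<xi>)) * (ennreal \<kappa> * ennreal ((norm (H \<xi>))\<^sup>2)) \<partial>lborel)"
      proof (rule nn_integral_mono)
        fix u
        have "(k (u - \<xi>))\<^sup>2 * (norm (H \<xi>))\<^sup>2 \<le> (k (u - \<xi>) * \<kappa>) * (norm (H \<xi>))\<^sup>2"
          using k_le by (intro mult_right_mono) (auto simp: power2_eq_square intro!: mult_left_mono)
        then show "ennreal ((norm (complex_of_real (k (u - \<xi>)) * H \<xi>))\<^sup>2) \<le> ennreal (k (u - \<xi>)) * (ennreal \<kappa> * ennreal ((norm (H \<xi>))\<^sup>2))"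
          using \<kappa> by (auto simp: norm_mult power_mult_distrib mult.assoc ennreal_mult[symmetric] intro!: ennreal_leI)
      qed
      also have "\<dots> = ennreal \<kappa> * ennreal ((norm (H \<xi>))\<^sup>2)"
        by (subst nn_integral_multc) (auto simp: nnk)
      finally show "(\<integral>\<^sup>+u. ennreal ((norm (complex_of_real (k (u - \<xi>)) * H \<xi>))\<^sup>2) \<partial>lborel) \<le> ennreal \<kappa> * ennreal ((norm (H \<xi>))\<^sup>2)" .
    qed
    also have "\<dots> = ennreal \<kappa> * (\<integral>\<^sup>+\<xi>. ennreal ((norm (H \<xi>))\<^sup>2) \<partial>lborel)"
      by (rule nn_integral_cmult) measurable
    also have "\<dots> \<le> ennreal \<kappa> * ennreal (h\<^sup>2)"
      using H by (rule mult_left_mono) simp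
    finally show ?thesis .
  qed

  \<comment> \<open>On \<open>E\<close> the modulus \<open>r\<close> satisfies
    \<open>r^2 \<le> A powr (4 - p) * r powr (p - 2)\<close>, and the threshold bounds the last
    factor by \<open>S u / X^2\<close>. The hypothesis on \<open>X\<close> says exactly that the
    resulting \<open>W\<close> has integral at most \<open>X^2\<close>.\<close>
  define W where "W u = ennreal (A powr (4 - p) / X\<^sup>2) * S u" for u
  have [measurable]: "W \<in> borel_measurable borel"
    unfolding W_def by measurable
  have a1_W: "ennreal ((norm (a1 (u, v)))\<^sup>2) \<le> W u" for u v
  proof (cases "E (u, v)")
    case True
    define r where "r = norm (a (u, v))"
    have r: "0 \<le> r" "r \<le> A" using a_le by (auto simp: r_def)
    have "r\<^sup>2 \<le> A powr (4 - p) * r powr (p - 2)"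
    proof (cases "r = 0")
      case False
      with r have "r\<^sup>2 = r powr (4 - p) * r powr (p - 2)"
        by (simp add: powr_add[symmetric] powr_numeral)
      also have "\<dots> \<le> A powr (4 - p) * r powr (p - 2)"
        using r p by (intro mult_right_mono powr_mono2) auto
      finally show ?thesis .
    qed auto
    also have "\<dots> = A powr (4 - p) / X\<^sup>2 * (r powr (p - 2) * X\<^sup>2)"
      using X by simp
    finally have "ennreal (r\<^sup>2) \<le> ennreal (A powr (4 - p) / X\<^sup>2) * ennreal (r powr (p - 2) * X\<^sup>2)"
      by (subst ennreal_mult[symmetric]) (auto intro!: ennreal_leI)
    also have "\<dots> \<le> W u"
      using True unfolding W_def E_def r_def by (intro mult_left_mono) auto
    finally show ?thesis
      using True by (simp add: a1_def r_def)
  qed (simp add: a1_def)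
  have c1_W: "ennreal ((norm (c1 u \<eta>))\<^sup>2) \<le> W u" for u \<eta>
  proof -
    have "ennreal ((norm (c1 u \<eta>))\<^sup>2) \<le> (\<integral>\<^sup>+v. ennreal (k (v - \<eta>)) * ennreal ((norm (a1 (u, v)))\<^sup>2) \<partial>lborel)"
      unfolding c1_def by (rule kernel_integral_sq_le[OF prob_kernel_shift[OF k] _ a1_le]) measurable
    also have "\<dots> \<le> (\<integral>\<^sup>+v. ennreal (k (v - \<eta>)) * W u \<partial>lborel)"
      by (intro nn_integral_mono mult_left_mono a1_W) auto
    also have "\<dots> = W u"
      by (subst nn_integral_multc) (auto simp: nnk)
    finally show ?thesis .
  qed
  have W_int: "(\<integral>\<^sup>+u. W u \<partial>lborel) \<le> ennreal (X\<^sup>2)"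
  proof -
    have "(\<integral>\<^sup>+u. W u \<partial>lborel) = ennreal (A powr (4 - p) / X\<^sup>2) * (\<integral>\<^sup>+u. S u \<partial>lborel)"
      unfolding W_def by (rule nn_integral_cmult) measurable
    also have "\<dots> \<le> ennreal (A powr (4 - p) / X\<^sup>2) * ennreal Q"
      by (intro mult_left_mono S_int) auto
    also have "\<dots> = ennreal (A powr (4 - p) * Q / X\<^sup>2)"
      by (subst ennreal_mult'[symmetric]) auto
    also have "\<dots> \<le> ennreal (X\<^sup>2)"
      using X by (intro ennreal_leI) (simp add: pos_divide_le_eq power_add[symmetric])
    finally show ?thesis .
  qed
  have G1: "(\<integral>\<^sup>+u. \<integral>\<^sup>+\<eta>. ennreal ((norm (c1 u \<eta> * G \<eta>))\<^sup>2) \<partial>lborel \<partial>lborel) \<le> ennreal (X\<^sup>2) * ennreal (\<gamma>\<^sup>2)"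
  proof -
    have "(\<integral>\<^sup>+u. \<integral>\<^sup>+\<eta>. ennreal ((norm (c1 u \<eta> * G \<eta>))\<^sup>2) \<partial>lborel \<partial>lborel) \<le>
      (\<integral>\<^sup>+u. \<integral>\<^sup>+\<eta>. W u * ennreal ((norm (G \<eta>))\<^sup>2) \<partial>lborel \<partial>lborel)"
      by (intro nn_integral_mono) (auto simp: norm_mult power_mult_distrib ennreal_mult intro!: mult_right_mono c1_W)
    also have "\<dots> = (\<integral>\<^sup>+u. W u \<partial>lborel) * (\<integral>\<^sup>+\<eta>. ennreal ((norm (G \<eta>))\<^sup>2) \<partial>lborel)"
      by (simp add: nn_integral_cmult nn_integral_multc)
    also have "\<dots> \<le> ennreal (X\<^sup>2) * ennreal (\<gamma>\<^sup>2)"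
      by (intro mult_mono W_int G2) auto
    finally show ?thesis .
  qed

  \<comment> \<open>Off \<open>E\<close> the threshold fails, which for
    \<open>0 < S u < \<infinity>\<close> gives \<open>r^2 \<le> X^2 / S u * r powr p\<close>;
    integrating over \<open>v\<close> cancels \<open>S u\<close>. If \<open>S u\<close> is infinite
    then \<open>E\<close> holds everywhere, and if \<open>S u\<close> is 0 then \<open>a\<close>
    vanishes almost everywhere on the slice.\<close>
  have a2_int: "(\<integral>\<^sup>+v. ennreal ((norm (a2 (u, v)))\<^sup>2) \<partial>lborel) \<le> ennreal (X\<^sup>2)" for u
  proof (cases "S u")
    case top
    then have "a2 (u, v) = 0" for v
      by (simp add: a2_def E_def)
    then show ?thesis by simp
  next
    case (real s)
    show ?thesis
    proof (cases "s = 0")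
      case True
      with real have "(\<integral>\<^sup>+v. ennreal (norm (a (u, v)) powr p) \<partial>lborel) = 0"
        by (simp add: S_def)
      then have "AE v in lborel. a (u, v) = 0"
        by (subst (asm) nn_integral_0_iff_AE) auto
      then have "AE v in lborel. ennreal ((norm (a2 (u, v)))\<^sup>2) = 0"
        by eventually_elim (simp add: a2_def)
      then have "(\<integral>\<^sup>+v. ennreal ((norm (a2 (u, v)))\<^sup>2) \<partial>lborel) = 0"
        by (subst nn_integral_0_iff_AE) auto
      then show ?thesis by simp
    next
      case False
      with real have s: "s > 0" by simp
      have "ennreal ((norm (a2 (u, v)))\<^sup>2) \<le> ennreal (X\<^sup>2 / s) * ennreal (norm (a (u, v)) powr p)" for v
      proof (cases "E (u, v) \<or> a (u, v) = 0")
        case False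
        define r where "r = norm (a (u, v))"
        have r: "r > 0" using False by (simp add: r_def)
        have "s \<le> r powr (p - 2) * X\<^sup>2"
          using False real by (simp add: E_def r_def not_le ennreal_less_iff)
        then have "s * r\<^sup>2 \<le> (r powr (p - 2) * X\<^sup>2) * r\<^sup>2"
          by (rule mult_right_mono) simp
        also have "\<dots> = (r powr (p - 2) * r powr 2) * X\<^sup>2"
          using r by (simp add: powr_numeral)
        also have "r powr (p - 2) * r powr 2 = r powr p"
          by (simp add: powr_add[symmetric])
        finally have "r\<^sup>2 \<le> X\<^sup>2 / s * r powr p"
          using s by (simp add: field_simps)
        then show ?thesis
          using False s by (subst ennreal_mult[symmetric]) (auto simp: a2_def r_def intro!: ennreal_leI)
      qed (auto simp: a2_def)
      then have "(\<integral>\<^sup>+v. ennreal ((norm (a2 (u, v)))\<^sup>2) \<partial>lborel) \<le> (\<integral>\<^sup>+v. ennreal (X\<^sup>2 / s) * ennreal (norm (a (u, v)) powr p) \<partial>lborel)"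
        by (intro nn_integral_mono)
      also have "\<dots> = ennreal (X\<^sup>2 / s) * S u"
        unfolding S_def by (rule nn_integral_cmult) measurable
      also have "\<dots> = ennreal (X\<^sup>2)"
        using real s by (simp add: ennreal_mult'[symmetric])
      finally show ?thesis .
    qed
  qed
  have F2': "(\<integral>\<^sup>+v. \<integral>\<^sup>+\<xi>. ennreal ((norm (b2 v \<xi> * F \<xi>))\<^sup>2) \<partial>lborel \<partial>lborel) \<le> ennreal (X\<^sup>2) * ennreal (\<phi>\<^sup>2)"
  proof -
    have "(\<integral>\<^sup>+v. \<integral>\<^sup>+\<xi>. ennreal ((norm (b2 v \<xi> * F \<xi>))\<^sup>2) \<partial>lborel \<partial>lborel) =
      (\<integral>\<^sup>+\<xi>. \<integral>\<^sup>+v. ennreal ((norm (b2 v \<xi> * F \<xi>))\<^sup>2) \<partial>lborel \<partial>lborel)"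
      by (rule lborel_pair.Fubini') measurable
    also have "\<dots> \<le> (\<integral>\<^sup>+\<xi>. ennreal (X\<^sup>2) * ennreal ((norm (F \<xi>))\<^sup>2) \<partial>lborel)"
    proof (rule nn_integral_mono)
      fix \<xi>
      have "(\<integral>\<^sup>+v. ennreal ((norm (b2 v \<xi> * F \<xi>))\<^sup>2) \<partial>lborel) =
         (\<integral>\<^sup>+v. ennreal ((norm (b2 v \<xi>))\<^sup>2) \<partial>lborel) * ennreal ((norm (F \<xi>))\<^sup>2)"
        by (simp add: norm_mult power_mult_distrib ennreal_mult nn_integral_multc)
      also have "(\<integral>\<^sup>+v. ennreal ((norm (b2 v \<xi>))\<^sup>2) \<partial>lborel) \<le>
         (\<integral>\<^sup>+v. \<integral>\<^sup>+u. ennreal (k (u - \<xi>)) * ennreal ((norm (a2 (u, v)))\<^sup>2) \<partial>lborel \<partial>lborel)"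
        unfolding b2_def by (intro nn_integral_mono kernel_integral_sq_le[OF prob_kernel_shift[OF k] _ a2_le]) measurable
      also have "\<dots> = (\<integral>\<^sup>+u. \<integral>\<^sup>+v. ennreal (k (u - \<xi>)) * ennreal ((norm (a2 (u, v)))\<^sup>2) \<partial>lborel \<partial>lborel)"
        by (rule lborel_pair.Fubini') measurable
      also have "\<dots> = (\<integral>\<^sup>+u. ennreal (k (u - \<xi>)) * (\<integral>\<^sup>+v. ennreal ((norm (a2 (u, v)))\<^sup>2) \<partial>lborel) \<partial>lborel)"
        by (intro nn_integral_cong nn_integral_cmult) measurable
      also have "\<dots> \<le> (\<integral>\<^sup>+u. ennreal (k (u - \<xi>)) * ennreal (X\<^sup>2) \<partial>lborel)"
        by (intro nn_integral_mono mult_left_mono a2_int) auto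
      also have "\<dots> = ennreal (X\<^sup>2)"
        by (subst nn_integral_multc) (auto simp: nnk)
      finally show "(\<integral>\<^sup>+v. ennreal ((norm (b2 v \<xi> * F \<xi>))\<^sup>2) \<partial>lborel) \<le> ennreal (X\<^sup>2) * ennreal ((norm (F \<xi>))\<^sup>2)"
        by (simp add: mult_right_mono)
    qed
    also have "\<dots> = ennreal (X\<^sup>2) * (\<integral>\<^sup>+\<xi>. ennreal ((norm (F \<xi>))\<^sup>2) \<partial>lborel)"
      by (rule nn_integral_cmult) measurable
    also have "\<dots> \<le> ennreal (X\<^sup>2) * ennreal (\<phi>\<^sup>2)"
      by (intro mult_left_mono F2) auto
    finally show ?thesis .
  qed

  have sq: "I \<le> ennreal (sqrt \<kappa> * X * \<phi> * \<gamma>)"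
    if "I\<^sup>2 \<le> J1 * J2" "J1 * J2 \<le> ennreal (\<kappa> * X\<^sup>2 * \<phi>\<^sup>2 * \<gamma>\<^sup>2)" for I J1 J2 :: ennreal
  proof -
    have "I\<^sup>2 \<le> ennreal (\<kappa> * X\<^sup>2 * \<phi>\<^sup>2 * \<gamma>\<^sup>2)"
      using that by (rule order_trans)
    also have "\<kappa> * X\<^sup>2 * \<phi>\<^sup>2 * \<gamma>\<^sup>2 = (sqrt \<kappa> * X * \<phi> * \<gamma>)\<^sup>2"
      using \<kappa> by (simp add: power_mult_distrib)
    finally have le: "I\<^sup>2 \<le> ennreal ((sqrt \<kappa> * X * \<phi> * \<gamma>)\<^sup>2)" .
    have nn: "0 \<le> sqrt \<kappa> * X * \<phi> * \<gamma>"
      using \<kappa> X \<phi> \<gamma> by simp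
    show ?thesis
    proof (cases I)
      case (real r)
      with le have "r\<^sup>2 \<le> (sqrt \<kappa> * X * \<phi> * \<gamma>)\<^sup>2"
        by (simp add: ennreal_power)
      then show ?thesis
        using real nn by (auto intro!: ennreal_leI power2_le_imp_le)
    qed (use le in \<open>auto simp: power2_eq_square ennreal_top_mult top_unique\<close>)
  qed
  have I1: "(\<integral>\<^sup>+x. ennreal (norm (bil F G m1 x)) \<partial>lborel) \<le> ennreal (sqrt \<kappa> * X * \<phi> * \<gamma>)"
  proof (rule sq[OF bil_L1_le[where b=b1 and c=c1]])
    show "(\<integral>\<^sup>+u. \<integral>\<^sup>+\<xi>. ennreal ((norm (b1 u \<xi> * F \<xi>))\<^sup>2) \<partial>lborel \<partial>lborel) *
      (\<integral>\<^sup>+u. \<integral>\<^sup>+\<eta>. ennreal ((norm (c1 u \<eta> * G \<eta>))\<^sup>2) \<partial>lborel \<partial>lborel) \<le> ennreal (\<kappa> * X\<^sup>2 * \<phi>\<^sup>2 * \<gamma>\<^sup>2)"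
      using mult_mono[OF F_k[of F \<phi>, OF _ F2, folded b1_def] G1] \<kappa>
      by (simp add: ennreal_mult[symmetric] mult_ac)
  qed (use F G b1_le c1_le K1 in \<open>auto simp: m1_def\<close>)
  have I2: "(\<integral>\<^sup>+x. ennreal (norm (bil F G m2 x)) \<partial>lborel) \<le> ennreal (sqrt \<kappa> * X * \<phi> * \<gamma>)"
  proof (rule sq[OF bil_L1_le[where b=b2 and c=c2]])
    show "(\<integral>\<^sup>+u. \<integral>\<^sup>+\<xi>. ennreal ((norm (b2 u \<xi> * F \<xi>))\<^sup>2) \<partial>lborel \<partial>lborel) *
      (\<integral>\<^sup>+u. \<integral>\<^sup>+\<eta>. ennreal ((norm (c2 u \<eta> * G \<eta>))\<^sup>2) \<partial>lborel \<partial>lborel) \<le> ennreal (\<kappa> * X\<^sup>2 * \<phi>\<^sup>2 * \<gamma>\<^sup>2)"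
      using mult_mono[OF F2' F_k[of G \<gamma>, OF _ G2, folded c2_def]] \<kappa>
      by (simp add: ennreal_mult[symmetric] mult_ac)
  qed (use F G b2_le c2_le K2 in \<open>auto simp: m2_def\<close>)
  have mm: "m1 \<in> borel_measurable borel" "m2 \<in> borel_measurable borel"
    unfolding m1_def m2_def borel_prod[symmetric] by measurable
  have m1_le: "norm (m1 w) \<le> A" for w
    unfolding m1_def b1_def by (rule norm_kernel_integral_le[OF prob_kernel_shift[OF k] _ c1_le]) measurable
  have m2_le: "norm (m2 w) \<le> A" for w
    unfolding m2_def c2_def mult.commute[of "b2 _ _"]
    by (rule norm_kernel_integral_le[OF prob_kernel_shift[OF k] _ b2_le]) measurable
  note [measurable] = mm
  have [measurable]: "bil F G m1 \<in> borel_measurable borel" "bil F G m2 \<in> borel_measurable borel"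
    by (intro measurable_bil; measurable)+
  have "avg (tensor k) a = (\<lambda>w. m1 w + m2 w)"
    using avg_eq by auto
  then have "(\<integral>\<^sup>+x. ennreal (norm (bil F G (avg (tensor k) a) x)) \<partial>lborel) =
    (\<integral>\<^sup>+x. ennreal (norm (bil F G m1 x + bil F G m2 x)) \<partial>lborel)"
    using bil_add[OF F G mm m1_le m2_le] by simp
  also have "\<dots> \<le> (\<integral>\<^sup>+x. ennreal (norm (bil F G m1 x)) + ennreal (norm (bil F G m2 x)) \<partial>lborel)"
    by (intro nn_integral_mono) (simp add: norm_triangle_ineq ennreal_leI flip: ennreal_plus)
  also have "\<dots> = (\<integral>\<^sup>+x. ennreal (norm (bil F G m1 x)) \<partial>lborel) + (\<integral>\<^sup>+x. ennreal (norm (bil F G m2 x)) \<partial>lborel)"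
    by (rule nn_integral_add) measurable
  also have "\<dots> \<le> ennreal (sqrt \<kappa> * X * \<phi> * \<gamma>) + ennreal (sqrt \<kappa> * X * \<phi> * \<gamma>)"
    by (intro add_mono I1 I2)
  also have "\<dots> = ennreal (2 * (sqrt \<kappa> * X * \<phi> * \<gamma>))"
    using \<kappa> X \<phi> \<gamma> by (subst ennreal_plus[symmetric]) auto
  finally show ?thesis .
qed

section \<open>Finite differences\<close>

definition delta :: "'a::euclidean_space \<Rightarrow> ('a \<Rightarrow> complex) \<Rightarrow> 'a \<Rightarrow> complex" where
  "delta h f x = f (x + h) - f x"

definition diffs :: "'a::euclidean_space list \<Rightarrow> ('a \<Rightarrow> complex) \<Rightarrow> 'a \<Rightarrow> complex" where
  "diffs hs f = foldr delta hs f"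

text \<open>The integrated form of a bound on all derivatives of order \<open>k\<close>. Differences
  commute with averages by linearity, without differentiation under the integral, and a displacement
  \<open>v\<close> of the kernel can itself serve as one of the steps.\<close>

definition diff_bnd :: "nat \<Rightarrow> real \<Rightarrow> ('a::euclidean_space \<Rightarrow> complex) \<Rightarrow> bool" where
  "diff_bnd k K f \<longleftrightarrow> (\<forall>hs x. length hs = k \<longrightarrow> norm (diffs hs f x) \<le> K * (\<Prod>h\<leftarrow>hs. norm h))"

lemma diffs_simps [simp]: "diffs [] f = f" "diffs (h # hs) f = delta h (diffs hs f)"
  by (simp_all add: diffs_def)

lemma diffs_snoc: "diffs (hs @ [h]) f = diffs hs (delta h f)"
  by (simp add: diffs_def)

lemma diff_bndD: "diff_bnd k K f \<Longrightarrow> length hs = k \<Longrightarrow> norm (diffs hs f x) \<le> K * (\<Prod>h\<leftarrow>hs. norm h)"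
  by (auto simp: diff_bnd_def)

lemma diff_bnd_0: "diff_bnd 0 K f \<longleftrightarrow> (\<forall>x. norm (f x) \<le> K)"
  by (auto simp: diff_bnd_def)

lemma prod_list_norm_nonneg: "0 \<le> (\<Prod>h\<leftarrow>hs. norm h)"
  by (induction hs) auto

lemma diff_bnd_mono: "diff_bnd k K f \<Longrightarrow> K \<le> K' \<Longrightarrow> diff_bnd k K' f"
  unfolding diff_bnd_def using mult_right_mono[OF _ prod_list_norm_nonneg] order_trans by blast

section \<open>Finite differences controlled by partial derivatives\<close>

lemma iter_partial_translate: "iter_partial \<alpha> (\<lambda>x. f (x + h)) = (\<lambda>x. iter_partial \<alpha> f (x + h))"
proof (induction \<alpha>)
  case (Cons b \<alpha>)
  have "iter_partial (b # \<alpha>) (\<lambda>x. f (x + h)) x = partial_deriv b (\<lambda>x. iter_partial \<alpha> f (x + h)) x" for x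
    using Cons.IH by (simp add: iter_partial_def)
  also have "\<dots> x = iter_partial (b # \<alpha>) f (x + h)" for x
    by (simp add: partial_deriv_def iter_partial_def add_ac)
  finally show ?case by blast
qed simp

lemma has_iter_partial_translate: "has_iter_partial \<alpha> f \<Longrightarrow> has_iter_partial \<alpha> (\<lambda>x. f (x + h))"
proof (induction \<alpha>)
  case (Cons b \<alpha>)
  have "(\<lambda>t. iter_partial \<alpha> f ((x + h) + t *\<^sub>R b)) differentiable (at 0)" for x
    using Cons.prems by simp
  with Cons show ?case
    by (simp add: iter_partial_translate add_ac)
qed simp

lemma has_iter_partial_diff:
  assumes "has_iter_partial \<alpha> f" "has_iter_partial \<alpha> g"
  shows "has_iter_partial \<alpha> (\<lambda>x. f x - g x) \<and>
    iter_partial \<alpha> (\<lambda>x. f x - g x) = (\<lambda>x. iter_partial \<alpha> f x - iter_partial \<alpha> g x)"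
  using assms
proof (induction \<alpha>)
  case (Cons b \<alpha>)
  then have IH: "has_iter_partial \<alpha> (\<lambda>x. f x - g x)"
    "iter_partial \<alpha> (\<lambda>x. f x - g x) = (\<lambda>x. iter_partial \<alpha> f x - iter_partial \<alpha> g x)"
    by auto
  have d: "(\<lambda>t. iter_partial \<alpha> f (x + t *\<^sub>R b)) differentiable (at 0)"
    "(\<lambda>t. iter_partial \<alpha> g (x + t *\<^sub>R b)) differentiable (at 0)" for x
    using Cons.prems by auto
  have "iter_partial (b # \<alpha>) (\<lambda>x. f x - g x) x = partial_deriv b (\<lambda>x. iter_partial \<alpha> f x - iter_partial \<alpha> g x) x" for x
    using IH(2) by (simp add: iter_partial_def)
  also have "\<dots> x = iter_partial (b # \<alpha>) f x - iter_partial (b # \<alpha>) g x" for x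
    using d[of x] by (simp add: partial_deriv_def iter_partial_def vector_derivative_diff_at)
  finally show ?case
    using IH d by (auto intro!: differentiable_diff)
qed simp

text \<open>The point \<open>x + h\<close> is reached from \<open>x\<close> along the coordinate
  directions one after the other, so that control of the partial derivatives is enough and no total
  derivative enters.\<close>

lemma norm_diff_le_sum_Basis:
  fixes g :: "'a::euclidean_space \<Rightarrow> complex"
  assumes "\<And>b x t. b \<in> Basis \<Longrightarrow> norm (g (x + t *\<^sub>R b) - g x) \<le> C * \<bar>t\<bar>" and C: "C \<ge> 0"
  shows "norm (g (x + h) - g x) \<le> real DIM('a) * C * norm h"
proof -
  have *: "norm (g (x + (\<Sum>b\<in>B. (h \<bullet> b) *\<^sub>R b)) - g x) \<le> C * (\<Sum>b\<in>B. \<bar>h \<bullet> b\<bar>)" if "B \<subseteq> Basis" for B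
    using finite_subset[OF that finite_Basis] that
  proof (induction B rule: finite_induct)
    case (insert b B)
    let ?y = "x + (\<Sum>b\<in>B. (h \<bullet> b) *\<^sub>R b)"
    have "g (x + (\<Sum>b\<in>insert b B. (h \<bullet> b) *\<^sub>R b)) - g x = (g (?y + (h \<bullet> b) *\<^sub>R b) - g ?y) + (g ?y - g x)"
      using insert.hyps by (simp add: add_ac)
    also have "norm \<dots> \<le> C * \<bar>h \<bullet> b\<bar> + C * (\<Sum>b\<in>B. \<bar>h \<bullet> b\<bar>)"
      using insert assms(1) by (intro order_trans[OF norm_triangle_ineq add_mono]) auto
    finally show ?case
      using insert.hyps by (simp add: distrib_left)
  qed (use C in auto)
  have "norm (g (x + h) - g x) \<le> C * (\<Sum>b\<in>Basis. \<bar>h \<bullet> b\<bar>)"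
    using *[of Basis] by (simp add: euclidean_representation)
  also have "\<dots> \<le> C * (real DIM('a) * norm h)"
    using C sum_bounded_above[of Basis "\<lambda>b. \<bar>h \<bullet> b\<bar>" "norm h"]
    by (intro mult_left_mono) (auto simp: Basis_le_norm)
  finally show ?thesis
    by (simp add: mult_ac)
qed

text \<open>Induction on \<open>k\<close> with the function varying: the difference that is applied
  first, \<open>delta h f\<close>, has partial derivatives up to order \<open>k\<close> bounded by
  \<open>DIM('a) * C * norm h\<close>, because each of them is an increment of a partial derivative
  of \<open>f\<close> that has one more derivative to spend.\<close>

lemma diff_bnd_of_partials:
  fixes f :: "'a::euclidean_space \<Rightarrow> complex"
  assumes "\<And>\<alpha>. multi_index \<alpha> \<Longrightarrow> length \<alpha> \<le> k \<Longrightarrow> has_iter_partial \<alpha> f"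
    and "\<And>\<alpha> x. multi_index \<alpha> \<Longrightarrow> length \<alpha> \<le> k \<Longrightarrow> norm (iter_partial \<alpha> f x) \<le> C" and "C \<ge> 0"
  shows "diff_bnd k (real DIM('a) ^ k * C) f"
  using assms
proof (induction k arbitrary: f C)
  case 0
  from "0.prems"(2)[of "[]"] show ?case by (simp add: diff_bnd_0)
next
  case (Suc k)
  have 1: "norm (diffs hs (delta h f) x) \<le> real DIM('a) ^ k * (real DIM('a) * C * norm h) * (\<Prod>h\<leftarrow>hs. norm h)"
    if "length hs = k" for h hs x
  proof (rule diff_bndD[OF Suc.IH that])
    fix \<alpha> :: "'a list" and x assume \<alpha>: "multi_index \<alpha>" "length \<alpha> \<le> k"
    have h: "has_iter_partial \<alpha> f"
      using \<alpha> Suc.prems by simp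
    note hd = has_iter_partial_diff[OF has_iter_partial_translate[OF h, of h] h]
    then show "has_iter_partial \<alpha> (delta h f)"
      by (simp add: delta_def[abs_def])
    have "norm (iter_partial \<alpha> f (x + h) - iter_partial \<alpha> f x) \<le> real DIM('a) * C * norm h"
    proof (rule norm_diff_le_sum_Basis)
      fix b x t assume b: "(b::'a) \<in> Basis"
      show "norm (iter_partial \<alpha> f (x + t *\<^sub>R b) - iter_partial \<alpha> f x) \<le> C * \<bar>t\<bar>"
        using \<alpha> b Suc.prems(1)[of "b # \<alpha>"] Suc.prems(2)[of "b # \<alpha>"]
        by (intro norm_diff_le_partial) auto
    qed fact
    then show "norm (iter_partial \<alpha> (delta h f) x) \<le> real DIM('a) * C * norm h"
      using hd by (simp add: delta_def[abs_def] iter_partial_translate)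
  qed (use Suc.prems in auto)
  show ?case
    unfolding diff_bnd_def
  proof (intro allI impI)
    fix hs :: "'a list" and x assume "length hs = Suc k"
    then obtain hs' h where "hs = hs' @ [h]" "length hs' = k"
      by (metis length_Suc_conv_rev)
    with 1[of hs' h x] show "norm (diffs hs f x) \<le> real DIM('a) ^ Suc k * C * (\<Prod>h\<leftarrow>hs. norm h)"
      by (simp add: diffs_snoc mult_ac)
  qed
qed

section \<open>Finite differences of averages and residuals\<close>

lemma measurable_diffs_bounded:
  assumes f: "f \<in> borel_measurable borel" and "\<And>x. norm (f x) \<le> B"
  shows "diffs hs f \<in> borel_measurable borel" "norm (diffs hs f x) \<le> 2 ^ length hs * B"
proof -
  show "diffs hs f \<in> borel_measurable borel"
  proof (induction hs)
    case (Cons h hs)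
    note [measurable] = this
    show ?case by (simp add: delta_def[abs_def])
  qed (use f in auto)
  show "norm (diffs hs f x) \<le> 2 ^ length hs * B"
  proof (induction hs arbitrary: x)
    case (Cons h hs)
    have "norm (diffs (h # hs) f x) \<le> norm (diffs hs f (x + h)) + norm (diffs hs f x)"
      by (simp add: delta_def norm_triangle_ineq4)
    also have "\<dots> \<le> 2 ^ length hs * B + 2 ^ length hs * B"
      by (intro add_mono Cons.IH)
    finally show ?case by (simp add: mult_ac)
  qed (use assms in auto)
qed

lemma measurable_avg:
  assumes "prob_kernel k" and [measurable]: "f \<in> borel_measurable borel"
  shows "avg k f \<in> borel_measurable borel"
proof -
  note [measurable] = prob_kernelD(1)[OF assms(1)]
  show ?thesis unfolding avg_def by measurable
qed

lemma diffs_avg: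
  assumes k: "prob_kernel k" and f: "f \<in> borel_measurable borel" "\<And>x. norm (f x) \<le> B"
  shows "diffs hs (avg k f) = avg k (diffs hs f)"
proof (induction hs)
  case (Cons h hs)
  let ?g = "diffs hs f"
  note [measurable] = measurable_diffs_bounded(1)[OF f, of hs] prob_kernelD(1)[OF k]
  have int: "integrable lborel (\<lambda>v. complex_of_real (k v) * ?g (x + v))" for x
    by (rule integrable_kernel_mult[OF k _ measurable_diffs_bounded(2)[OF f]]) measurable
  have "delta h (avg k ?g) x = avg k (delta h ?g) x" for x
    using int[of x] int[of "x + h"]
    by (simp add: delta_def avg_def right_diff_distrib add_ac)
  with Cons show ?case by auto
qed simp

lemma diffs_minus: "diffs hs (\<lambda>x. f x - g x) = (\<lambda>x. diffs hs f x - diffs hs g x)"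
  by (induction hs) (auto simp: delta_def[abs_def] algebra_simps)

text \<open>The bound for the top order, where no further difference of \<open>f\<close> is
  controlled and hence no power of the radius can be gained.\<close>

lemma diff_bnd_residual_double:
  fixes f :: "'a::euclidean_space \<Rightarrow> complex"
  assumes k: "prob_kernel k" and f: "f \<in> borel_measurable borel" "\<And>x. norm (f x) \<le> B"
    and d: "diff_bnd j K f"
  shows "diff_bnd j (2 * K) (\<lambda>x. f x - avg k f x)"
  unfolding diff_bnd_def
proof (intro allI impI)
  fix hs :: "'a list" and x assume l: "length hs = j"
  let ?P = "\<Prod>h\<leftarrow>hs. norm h"
  have "norm (diffs hs (\<lambda>x. f x - avg k f x) x) = norm (diffs hs f x - avg k (diffs hs f) x)"
    unfolding diffs_minus diffs_avg[OF k f] ..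
  also have "\<dots> \<le> norm (diffs hs f x) + norm (avg k (diffs hs f) x)"
    by (rule norm_triangle_ineq4)
  also have "\<dots> \<le> K * ?P + K * ?P"
    by (intro add_mono norm_avg_le k measurable_diffs_bounded[OF f] diff_bndD[OF d l])
  finally show "norm (diffs hs (\<lambda>x. f x - avg k f x) x) \<le> 2 * K * ?P"
    by simp
qed

text \<open>The residual is an average of \<open>- delta v f\<close> over the displacements
  \<open>v\<close> of the kernel. Hence one of the \<open>Suc j\<close> controlled differences can
  be spent on \<open>v\<close>, and its length is at most \<open>r\<close>.\<close>

lemma diff_bnd_residual_gain:
  fixes f :: "'a::euclidean_space \<Rightarrow> complex"
  assumes k: "prob_kernel k" and f: "f \<in> borel_measurable borel" "\<And>x. norm (f x) \<le> B"
    and d: "diff_bnd (Suc j) K f" and K: "K \<ge> 0" and r: "\<And>v. k v \<noteq> 0 \<Longrightarrow> norm v \<le> r" "r \<ge> 0"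
  shows "diff_bnd j (r * K) (\<lambda>x. f x - avg k f x)"
  unfolding diff_bnd_def
proof (intro allI impI)
  fix hs :: "'a list" and x assume l: "length hs = j"
  let ?P = "\<Prod>h\<leftarrow>hs. norm h"
  let ?g = "diffs hs f"
  note [measurable] = measurable_diffs_bounded(1)[OF f, of hs] prob_kernelD(1)[OF k]
  have int: "integrable lborel (\<lambda>v. complex_of_real (k v) * ?g (x + v))"
    by (rule integrable_kernel_mult[OF k _ measurable_diffs_bounded(2)[OF f]]) measurable
  have int1: "integrable lborel (\<lambda>v. complex_of_real (k v))"
    using prob_kernelD(4)[OF k] by simp
  \<comment> \<open>The truncation makes the bound uniform in \<open>v\<close> and leaves the
    integral unchanged, since the kernel vanishes for \<open>norm v > r\<close>.\<close>
  define w where "w v = (if norm v \<le> r then ?g x - ?g (x + v) else 0)" for v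
  have [measurable]: "w \<in> borel_measurable borel"
    unfolding w_def by measurable
  have w: "norm (w v) \<le> r * K * ?P" for v
  proof (cases "norm v \<le> r")
    case True
    have "norm (delta v ?g x) \<le> K * (norm v * ?P)"
      using diff_bndD[OF d, of "v # hs" x] l by simp
    also have "\<dots> \<le> K * (r * ?P)"
      using True K prod_list_norm_nonneg[of hs] by (intro mult_left_mono mult_right_mono) auto
    finally show ?thesis
      using True by (simp add: w_def delta_def norm_minus_commute mult_ac)
  qed (use r K prod_list_norm_nonneg[of hs] in \<open>simp add: w_def\<close>)
  have "?g x - avg k ?g x = (LINT v|lborel. complex_of_real (k v) * ?g x) - (LINT v|lborel. complex_of_real (k v) * ?g (x + v))"
    using prob_kernelD(5)[OF k] by (simp add: avg_def)
  also have "\<dots> = (LINT v|lborel. complex_of_real (k v) * ?g x - complex_of_real (k v) * ?g (x + v))"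
    using int int1 by (intro Bochner_Integration.integral_diff[symmetric]) auto
  also have "\<dots> = (LINT v|lborel. complex_of_real (k v) * w v)"
    using r by (intro Bochner_Integration.integral_cong) (auto simp: w_def right_diff_distrib)
  also have "norm \<dots> \<le> r * K * ?P"
    by (rule norm_kernel_integral_le[OF k _ w]) measurable
  finally show "norm (diffs hs (\<lambda>x. f x - avg k f x) x) \<le> r * K * ?P"
    unfolding diffs_minus diffs_avg[OF k f] .
qed

section \<open>Lebesgue norms of averages\<close>

text \<open>The graph of the convex function \<open>t powr q / q\<close> lies above its tangent at
  \<open>t = 1\<close>; this is Young's inequality with second factor 1.\<close>

lemma powr_tangent:
  fixes t q :: real
  assumes "t \<ge> 0" "q \<ge> 1"
  shows "t \<le> t powr q / q + (1 - 1 / q)"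
proof (cases "q = 1")
  case False
  with assms have q: "q > 1" by simp
  have "t * 1 \<le> t powr q / q + 1 powr (q / (q - 1)) / (q / (q - 1))"
    using q assms by (intro Youngs_inequality) (auto simp: field_simps)
  also have "1 powr (q / (q - 1)) / (q / (q - 1)) = 1 - 1 / q"
    using q by (simp add: field_simps)
  finally show ?thesis by simp
qed (use assms in auto)

text \<open>Jensen's inequality: \<open>powr_tangent\<close> is applied to
  \<open>\<phi> x / m\<close>, where \<open>m\<close> is the mean of \<phi>, and integrated against
  the kernel. The left side then integrates to 1.\<close>

lemma kernel_jensen_powr:
  fixes \<phi> :: "'a::euclidean_space \<Rightarrow> real"
  assumes k: "prob_kernel k" and [measurable]: "\<phi> \<in> borel_measurable borel"
    and \<phi>: "\<And>x. 0 \<le> \<phi> x" "\<And>x. \<phi> x \<le> B" and q: "q \<ge> 1"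
  shows "(LINT x|lborel. k x * \<phi> x) powr q \<le> (LINT x|lborel. k x * \<phi> x powr q)"
    and "integrable lborel (\<lambda>x. k x * \<phi> x powr q)"
proof -
  note [measurable] = prob_kernelD(1)[OF k]
  have [simp]: "0 \<le> k x" for x by (rule prob_kernelD(2)[OF k])
  have int: "integrable lborel (\<lambda>x. k x * \<psi> x)"
    if [measurable]: "\<psi> \<in> borel_measurable borel" and "\<And>x. 0 \<le> \<psi> x" "\<And>x. \<psi> x \<le> C" for \<psi> C
  proof (rule Bochner_Integration.integrable_bound)
    show "integrable lborel (\<lambda>x. C * k x)"
      using prob_kernelD(4)[OF k] by simp
    show "AE x in lborel. norm (k x * \<psi> x) \<le> norm (C * k x)"
      using that(2,3) by (intro always_eventually allI) (auto simp: abs_mult mult.commute[of _ "k _"] intro!: mult_left_mono intro: order_trans[OF _ abs_ge_self])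
  qed measurable
  have int1: "integrable lborel (\<lambda>x. k x * \<phi> x)"
    using \<phi> by (intro int) auto
  show int2: "integrable lborel (\<lambda>x. k x * \<phi> x powr q)"
    using \<phi> q by (intro int[where C="B powr q"]) (auto intro!: powr_mono2)
  define m where "m = (LINT x|lborel. k x * \<phi> x)"
  have "m \<ge> 0"
    unfolding m_def using \<phi> by (intro Bochner_Integration.integral_nonneg) auto
  show "m powr q \<le> (LINT x|lborel. k x * \<phi> x powr q)"
  proof (cases "m = 0")
    case True
    then show ?thesis using \<phi> by (auto intro!: Bochner_Integration.integral_nonneg)
  next
    case False
    with \<open>m \<ge> 0\<close> have m: "m > 0" by simp
    have "k x * \<phi> x / m \<le> (k x * \<phi> x powr q) / (m powr q * q) + (1 - 1 / q) * k x" for x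
    proof -
      have "\<phi> x / m \<le> (\<phi> x / m) powr q / q + (1 - 1 / q)"
        using \<phi> m q by (intro powr_tangent) auto
      also have "(\<phi> x / m) powr q = \<phi> x powr q / m powr q"
        using \<phi> m by (simp add: powr_divide)
      finally have "k x * (\<phi> x / m) \<le> k x * (\<phi> x powr q / m powr q / q + (1 - 1 / q))"
        by (rule mult_left_mono) simp
      then show ?thesis by (simp add: algebra_simps)
    qed
    then have "(LINT x|lborel. k x * \<phi> x / m) \<le> (LINT x|lborel. (k x * \<phi> x powr q) / (m powr q * q) + (1 - 1 / q) * k x)"
      using int1 int2 prob_kernelD(4)[OF k] by (intro integral_mono) auto
    also have "\<dots> = (LINT x|lborel. k x * \<phi> x powr q) / (m powr q * q) + (1 - 1 / q)"
      using int2 prob_kernelD(4,5)[OF k] by (subst Bochner_Integration.integral_add) auto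
    also have "(LINT x|lborel. k x * \<phi> x / m) = 1"
      using m by (simp add: m_def)
    finally have "1 / q \<le> (LINT x|lborel. k x * \<phi> x powr q) / (m powr q * q)"
      by simp
    then show ?thesis
      using m q by (simp add: field_simps)
  qed
qed

lemma nn_integral_avg_powr_le:
  fixes f :: "'a::euclidean_space \<Rightarrow> complex"
  assumes k: "prob_kernel k" and f [measurable]: "f \<in> borel_measurable borel" and B: "\<And>x. norm (f x) \<le> B" and q: "q \<ge> 1"
  shows "(\<integral>\<^sup>+x. ennreal (norm (avg k f x) powr q) \<partial>lborel) \<le> (\<integral>\<^sup>+x. ennreal (norm (f x) powr q) \<partial>lborel)"
proof -
  note [measurable] = prob_kernelD(1)[OF k]
  have [simp]: "0 \<le> k x" for x by (rule prob_kernelD(2)[OF k])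
  have "ennreal (norm (avg k f x) powr q) \<le> (\<integral>\<^sup>+v. ennreal (k v * norm (f (x + v)) powr q) \<partial>lborel)" for x
  proof -
    have "norm (avg k f x) \<le> (LINT v|lborel. norm (of_real (k v) * f (x + v)))"
      unfolding avg_def by (rule integral_norm_bound)
    then have "norm (avg k f x) powr q \<le> (LINT v|lborel. k v * norm (f (x + v))) powr q"
      using q by (intro powr_mono2) (auto simp: norm_mult)
    also have "\<dots> \<le> (LINT v|lborel. k v * norm (f (x + v)) powr q)"
      using B q by (intro kernel_jensen_powr(1)[OF k]) auto
    finally have "ennreal (norm (avg k f x) powr q) \<le> ennreal (LINT v|lborel. k v * norm (f (x + v)) powr q)"
      by (rule ennreal_leI)
    also have "\<dots> = (\<integral>\<^sup>+v. ennreal (k v * norm (f (x + v)) powr q) \<partial>lborel)"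
      using B q by (intro nn_integral_eq_integral[symmetric] kernel_jensen_powr(2)[OF k]) auto
    finally show ?thesis .
  qed
  then have "(\<integral>\<^sup>+x. ennreal (norm (avg k f x) powr q) \<partial>lborel) \<le> (\<integral>\<^sup>+x. \<integral>\<^sup>+v. ennreal (k v * norm (f (x + v)) powr q) \<partial>lborel \<partial>lborel)"
    by (rule nn_integral_mono)
  also have "\<dots> = (\<integral>\<^sup>+v. \<integral>\<^sup>+x. ennreal (k v * norm (f (x + v)) powr q) \<partial>lborel \<partial>lborel)"
    by (rule lborel_pair.Fubini') measurable
  also have "\<dots> = (\<integral>\<^sup>+v. ennreal (k v) * (\<integral>\<^sup>+x. ennreal (norm (f x) powr q) \<partial>lborel) \<partial>lborel)"
  proof (rule nn_integral_cong)
    fix v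
    have "(\<integral>\<^sup>+x. ennreal (k v * norm (f (x + v)) powr q) \<partial>lborel) = ennreal (k v) * (\<integral>\<^sup>+x. ennreal (norm (f (v + x)) powr q) \<partial>lborel)"
      by (subst nn_integral_cmult[symmetric]) (auto simp: ennreal_mult add.commute)
    also have "(\<integral>\<^sup>+x. ennreal (norm (f (v + x)) powr q) \<partial>lborel) = (\<integral>\<^sup>+x. ennreal (norm (f x) powr q) \<partial>lborel)"
      by (rule nn_integral_lborel_shift) measurable
    finally show "(\<integral>\<^sup>+x. ennreal (k v * norm (f (x + v)) powr q) \<partial>lborel) = ennreal (k v) * (\<integral>\<^sup>+x. ennreal (norm (f x) powr q) \<partial>lborel)" .
  qed
  also have "\<dots> = (\<integral>\<^sup>+x. ennreal (norm (f x) powr q) \<partial>lborel)"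
    using prob_kernelD(3)[OF k] by (simp add: nn_integral_multc)
  finally show ?thesis .
qed

text \<open>The factor is 2 times \<open>2 ^ 4\<close>: the power of a difference is at most
  \<open>2 powr q\<close> times the sum of the powers, \<open>q\<close> is at most 4, and averaging
  does not increase the integral. What matters later is that the constant does not depend on the
  kernel.\<close>

lemma nn_integral_residual_powr_le:
  fixes f :: "'a::euclidean_space \<Rightarrow> complex"
  assumes k: "prob_kernel k" and f [measurable]: "f \<in> borel_measurable borel" and B: "\<And>x. norm (f x) \<le> B"
    and q: "1 \<le> q" "q \<le> 4"
  shows "(\<integral>\<^sup>+x. ennreal (norm (f x - avg k f x) powr q) \<partial>lborel) \<le> 32 * (\<integral>\<^sup>+x. ennreal (norm (f x) powr q) \<partial>lborel)"
proof -
  note [measurable] = measurable_avg[OF k f]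
  have pw: "norm (a - b) powr q \<le> 16 * norm a powr q + 16 * norm b powr q" for a b :: complex
  proof -
    have "norm (a - b) \<le> 2 * max (norm a) (norm b)"
      using norm_triangle_ineq4[of a b] by (auto simp: max_def)
    then have "norm (a - b) powr q \<le> (2 * max (norm a) (norm b)) powr q"
      using q by (intro powr_mono2) auto
    also have "\<dots> = 2 powr q * max (norm a) (norm b) powr q"
      by (simp add: powr_mult)
    also have "\<dots> \<le> 2 powr 4 * (norm a powr q + norm b powr q)"
      using q by (intro mult_mono powr_mono) (auto simp: max_def)
    finally show ?thesis by simp
  qed
  have "(\<integral>\<^sup>+x. ennreal (norm (f x - avg k f x) powr q) \<partial>lborel) \<le>
     (\<integral>\<^sup>+x. 16 * ennreal (norm (f x) powr q) + 16 * ennreal (norm (avg k f x) powr q) \<partial>lborel)"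
  proof (rule nn_integral_mono)
    fix x
    from pw[of "f x" "avg k f x"]
    have "ennreal (norm (f x - avg k f x) powr q) \<le> ennreal (16 * norm (f x) powr q + 16 * norm (avg k f x) powr q)"
      by (rule ennreal_leI)
    then show "ennreal (norm (f x - avg k f x) powr q) \<le> 16 * ennreal (norm (f x) powr q) + 16 * ennreal (norm (avg k f x) powr q)"
      by (simp add: ennreal_mult')
  qed
  also have "\<dots> = 16 * (\<integral>\<^sup>+x. ennreal (norm (f x) powr q) \<partial>lborel) + 16 * (\<integral>\<^sup>+x. ennreal (norm (avg k f x) powr q) \<partial>lborel)"
    by (subst nn_integral_add) (auto simp: nn_integral_cmult)
  also have "\<dots> \<le> 16 * (\<integral>\<^sup>+x. ennreal (norm (f x) powr q) \<partial>lborel) + 16 * (\<integral>\<^sup>+x. ennreal (norm (f x) powr q) \<partial>lborel)"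
    by (intro add_left_mono mult_left_mono nn_integral_avg_powr_le[OF k f B q(1)]) auto
  also have "\<dots> = 32 * (\<integral>\<^sup>+x. ennreal (norm (f x) powr q) \<partial>lborel)"
    by (simp flip: distrib_right)
  finally show ?thesis .
qed

section \<open>Sufficiency\<close>

definition ball_kernel :: "real \<Rightarrow> 'a::euclidean_space \<Rightarrow> real" where
  "ball_kernel r x = indicator (cball 0 r) x / (unit_ball_vol (real DIM('a)) * r ^ DIM('a))"

lemma
  assumes r: "r > 0"
  shows prob_kernel_ball_kernel: "prob_kernel (ball_kernel r :: 'a::euclidean_space \<Rightarrow> real)"
    and ball_kernel_le: "ball_kernel r (x :: 'a) \<le> 1 / (unit_ball_vol (real DIM('a)) * r ^ DIM('a))"
    and ball_kernel_tensor_support: "tensor (ball_kernel r :: 'a \<Rightarrow> real) v \<noteq> 0 \<Longrightarrow> norm v \<le> 2 * r"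
proof -
  let ?V = "unit_ball_vol (real DIM('a)) * r ^ DIM('a)"
  have V: "?V > 0"
    using r by simp
  have m: "(ball_kernel r :: 'a \<Rightarrow> real) \<in> borel_measurable borel"
    unfolding ball_kernel_def[abs_def]
    by (intro borel_measurable_divide borel_measurable_indicator borel_measurable_const) auto
  have e: "emeasure lborel (cball (0::'a) r) = ennreal ?V"
    using r by (simp add: emeasure_cball)
  have "(\<integral>\<^sup>+x. ennreal (ball_kernel r (x::'a)) \<partial>lborel) = (\<integral>\<^sup>+x. ennreal (1 / ?V) * indicator (cball (0::'a) r) x \<partial>lborel)"
    using V by (intro nn_integral_cong) (auto simp: ball_kernel_def indicator_def)
  also have "\<dots> = ennreal (1 / ?V) * ennreal ?V"
    unfolding e[symmetric] by (rule nn_integral_cmult_indicator) simp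
  also have "\<dots> = ennreal (1 / ?V * ?V)"
    using V by (intro ennreal_mult[symmetric]) auto
  also have "1 / ?V * ?V = 1"
    using V by (metis less_irrefl nonzero_divide_eq_eq)
  finally have "(\<integral>\<^sup>+x. ennreal (ball_kernel r (x::'a)) \<partial>lborel) = 1"
    by simp
  then show "prob_kernel (ball_kernel r :: 'a \<Rightarrow> real)"
    using r m unfolding prob_kernel_def by (auto simp: ball_kernel_def)
  show "ball_kernel r (x :: 'a) \<le> 1 / ?V"
    using V unfolding ball_kernel_def by (intro divide_right_mono) (auto simp: indicator_def)
  assume "tensor (ball_kernel r :: 'a \<Rightarrow> real) v \<noteq> 0"
  then have "norm (fst v) \<le> r" "norm (snd v) \<le> r"
    by (auto simp: tensor_def ball_kernel_def indicator_def split: if_splits)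
  then show "norm v \<le> 2 * r"
    using norm_Pair_le[of "fst v" "snd v"] by simp
qed

text \<open>The splitting behind \<open>bil_tensor_avg_L1_le\<close> requires an exponent above 2. A
  smaller \<open>q\<close> is raised to \<open>p = max q 3\<close>, which costs the factor
  \<open>A powr (p - q)\<close> in the integral. Since \<open>A powr (4 - p)\<close> times this
  factor is \<open>A powr (4 - q)\<close>, the final bound does not remember
  \<open>p\<close>.\<close>

lemma bil_tensor_avg_Lq_le:
  fixes F G :: "'a::euclidean_space \<Rightarrow> complex" and a :: "'a \<times> 'a \<Rightarrow> complex" and k :: "'a \<Rightarrow> real"
  assumes F: "integrable lborel F" and G: "integrable lborel G"
    and F2: "(\<integral>\<^sup>+x. ennreal ((norm (F x))\<^sup>2) \<partial>lborel) \<le> ennreal (\<phi>\<^sup>2)" and \<phi>: "\<phi> \<ge> 0"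
    and G2: "(\<integral>\<^sup>+x. ennreal ((norm (G x))\<^sup>2) \<partial>lborel) \<le> ennreal (\<gamma>\<^sup>2)" and \<gamma>: "\<gamma> \<ge> 0"
    and k: "prob_kernel k" and k_le: "\<And>x. k x \<le> \<kappa>"
    and a: "a \<in> borel_measurable borel" and a_le: "\<And>w. norm (a w) \<le> A" and A: "A > 0"
    and q: "1 \<le> q" "q < 4" and Q: "(\<integral>\<^sup>+w. ennreal (norm (a w) powr q) \<partial>lborel) \<le> ennreal Q" "Q > 0"
  shows "(\<integral>\<^sup>+x. ennreal (norm (bil F G (avg (tensor k) a) x)) \<partial>lborel) \<le>
    ennreal (2 * (sqrt \<kappa> * (A powr (1 - q / 4) * Q powr (1 / 4)) * \<phi> * \<gamma>))"
proof (rule bil_tensor_avg_L1_le[OF F G F2 \<phi> G2 \<gamma> k k_le a a_le A])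
  note [measurable] = a
  define p where "p = max q 3"
  show "2 < max q 3" "max q 3 < 4"
    using q by auto
  have pw: "norm (a w) powr p \<le> A powr (p - q) * norm (a w) powr q" for w
  proof (cases "a w = 0")
    case False
    then have "norm (a w) powr p = norm (a w) powr (p - q) * norm (a w) powr q"
      by (simp add: powr_add[symmetric])
    also have "\<dots> \<le> A powr (p - q) * norm (a w) powr q"
      using a_le[of w] by (intro mult_right_mono powr_mono2) (auto simp: p_def)
    finally show ?thesis .
  qed auto
  have "(\<integral>\<^sup>+w. ennreal (norm (a w) powr p) \<partial>lborel) \<le> (\<integral>\<^sup>+w. ennreal (A powr (p - q)) * ennreal (norm (a w) powr q) \<partial>lborel)"
    using pw by (intro nn_integral_mono) (auto simp: ennreal_mult[symmetric] intro!: ennreal_leI)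
  also have "\<dots> = ennreal (A powr (p - q)) * (\<integral>\<^sup>+w. ennreal (norm (a w) powr q) \<partial>lborel)"
    by (rule nn_integral_cmult) measurable
  also have "\<dots> \<le> ennreal (A powr (p - q)) * ennreal Q"
    by (intro mult_left_mono Q) auto
  also have "\<dots> = ennreal (A powr (p - q) * Q)"
    by (simp add: ennreal_mult')
  finally show "(\<integral>\<^sup>+w. ennreal (norm (a w) powr (max q 3)) \<partial>lborel) \<le> ennreal (A powr (max q 3 - q) * Q)"
    by (simp add: p_def)
  show "0 < A powr (1 - q / 4) * Q powr (1 / 4)"
    using A Q by simp
  have "(A powr (1 - q / 4) * Q powr (1 / 4)) ^ 4 = A powr (4 - q) * Q"
    using A Q by (simp add: power_mult_distrib powr_power algebra_simps)
  moreover have "A powr (4 - p) * (A powr (p - q) * Q) = A powr (4 - q) * Q"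
    using A by (simp add: powr_add[symmetric] mult.assoc[symmetric])
  ultimately show "A powr (4 - max q 3) * (A powr (max q 3 - q) * Q) \<le> (A powr (1 - q / 4) * Q powr (1 / 4)) ^ 4"
    by (simp only: p_def[symmetric] order_refl)
qed

text \<open>Since \<open>residual k f l - residual k f (l + 1)\<close> is an average of \<open>residual k f l\<close>, the function
  \<open>f\<close> is the telescoping sum of averages to which \<open>bil_tensor_avg_Lq_le\<close> applies.\<close>

primrec residual :: "(nat \<Rightarrow> 'a::euclidean_space \<Rightarrow> real) \<Rightarrow> ('a \<Rightarrow> complex) \<Rightarrow> nat \<Rightarrow> 'a \<Rightarrow> complex" where
  "residual k f 0 = f"
| "residual k f (Suc l) = (\<lambda>x. residual k f l x - avg (k l) (residual k f l) x)"

lemma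
  fixes f :: "'a::euclidean_space \<Rightarrow> complex"
  assumes k: "\<And>l. prob_kernel (k l)" and f: "f \<in> borel_measurable borel" "\<And>x. norm (f x) \<le> C"
  shows measurable_residual: "residual k f l \<in> borel_measurable borel"
    and residual_le: "norm (residual k f l x) \<le> 2 ^ l * C"
proof -
  have "residual k f l \<in> borel_measurable borel \<and> (\<forall>x. norm (residual k f l x) \<le> 2 ^ l * C)"
  proof (induction l)
    case (Suc l)
    then have IH: "residual k f l \<in> borel_measurable borel" "\<And>x. norm (residual k f l x) \<le> 2 ^ l * C"
      by auto
    note [measurable] = IH(1) measurable_avg[OF k IH(1)]
    have "norm (residual k f l x - avg (k l) (residual k f l) x) \<le> 2 ^ l * C + 2 ^ l * C" for x
      by (intro order_trans[OF norm_triangle_ineq4] add_mono IH norm_avg_le k)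
    then show ?case by (simp add: mult_ac)
  qed (use f in auto)
  then show "residual k f l \<in> borel_measurable borel" "norm (residual k f l x) \<le> 2 ^ l * C"
    by auto
qed

lemma nn_integral_residual_le:
  fixes f :: "'a::euclidean_space \<Rightarrow> complex"
  assumes k: "\<And>l. prob_kernel (k l)" and f: "f \<in> borel_measurable borel" "\<And>x. norm (f x) \<le> C"
    and q: "1 \<le> q" "q \<le> 4"
  shows "(\<integral>\<^sup>+x. ennreal (norm (residual k f l x) powr q) \<partial>lborel) \<le> 32 ^ l * (\<integral>\<^sup>+x. ennreal (norm (f x) powr q) \<partial>lborel)"
proof (induction l)
  case (Suc l)
  have "(\<integral>\<^sup>+x. ennreal (norm (residual k f (Suc l) x) powr q) \<partial>lborel) \<le> 32 * (\<integral>\<^sup>+x. ennreal (norm (residual k f l x) powr q) \<partial>lborel)"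
    unfolding residual.simps
    by (rule nn_integral_residual_powr_le[OF k measurable_residual[of k, OF k f] residual_le[of k, OF k f] q])
  also have "\<dots> \<le> 32 * (32 ^ l * (\<integral>\<^sup>+x. ennreal (norm (f x) powr q) \<partial>lborel))"
    by (intro mult_left_mono Suc) auto
  finally show ?case by (simp add: mult_ac)
qed simp

text \<open>Passing from \<open>l\<close> to \<open>Suc l\<close> by
  \<open>diff_bnd_residual_gain\<close> contributes only \<open>\<beta> ^ l\<close>, while the
  claimed exponent \<open>Suc l * (M - j)\<close> asks for a further
  \<open>\<beta> ^ (M - j)\<close>. The prefactor pays for it: it grows by
  \<open>(1 / \<beta>) ^ M\<close> each time the order drops by one, and as there are only
  \<open>M\<close> orders it remains independent of \<open>l\<close>. At \<open>j = M\<close> no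
  power of \<beta> is claimed and the factor 2 of the trivial bound suffices.\<close>

lemma diff_bnd_residual:
  fixes f :: "'a::euclidean_space \<Rightarrow> complex"
  assumes k: "\<And>l. prob_kernel (k l)" and f: "f \<in> borel_measurable borel" "\<And>x. norm (f x) \<le> C"
    and supp: "\<And>l v. k l v \<noteq> 0 \<Longrightarrow> norm v \<le> 2 * \<beta> ^ l"
    and d: "\<And>j. j \<le> M \<Longrightarrow> diff_bnd j K f" and K: "K \<ge> 0" and \<beta>: "0 < \<beta>" "\<beta> \<le> 1"
    and j: "j \<le> M"
  shows "diff_bnd j ((1 / \<beta>) ^ (M * (M - j)) * 2 ^ l * \<beta> ^ (l * (M - j)) * K) (residual k f l)"
  using j
proof (induction l arbitrary: j)
  case 0
  have "1 \<le> (1 / \<beta>) ^ (M * (M - j))"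
    using \<beta> by (intro one_le_power) simp
  from mult_right_mono[OF this K] d[OF 0] show ?case
    by (auto intro: diff_bnd_mono)
next
  case (Suc l)
  note ms = measurable_residual[of k, OF k f, of l] and bd = residual_le[of k, OF k f, of l]
  show ?case
  proof (cases "j = M")
    case True
    have "diff_bnd M (2 * (2 ^ l * K)) (residual k f (Suc l))"
      unfolding residual.simps using Suc.IH[of M] by (intro diff_bnd_residual_double[OF k ms bd]) simp
    then show ?thesis
      using True by (simp add: mult_ac)
  next
    case False
    with Suc.prems obtain i where i: "M - j = Suc i" "M - Suc j = i" "Suc j \<le> M"
      by (metis Suc_diff_Suc le_neq_implies_less less_eq_Suc_le)
    have "diff_bnd j (2 * \<beta> ^ l * ((1 / \<beta>) ^ (M * i) * 2 ^ l * \<beta> ^ (l * i) * K)) (residual k f (Suc l))"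
      unfolding residual.simps
    proof (rule diff_bnd_residual_gain[OF k ms bd])
      show "diff_bnd (Suc j) ((1 / \<beta>) ^ (M * i) * 2 ^ l * \<beta> ^ (l * i) * K) (residual k f l)"
        using Suc.IH[OF i(3)] by (simp add: i)
    qed (use supp \<beta> K in auto)
    then show ?thesis
    proof (rule diff_bnd_mono)
      have "2 * \<beta> ^ l * ((1 / \<beta>) ^ (M * i) * 2 ^ l * \<beta> ^ (l * i) * K) =
        1 * ((1 / \<beta>) ^ (M * i) * 2 ^ Suc l * \<beta> ^ (l * Suc i) * K)"
        by (simp add: power_add mult_ac)
      also have "\<dots> \<le> ((1 / \<beta>) ^ M * \<beta> ^ (Suc i)) * ((1 / \<beta>) ^ (M * i) * 2 ^ Suc l * \<beta> ^ (l * Suc i) * K)"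
      proof (rule mult_right_mono)
        have "1 = (1 / \<beta>) ^ M * \<beta> ^ M"
          using \<beta> by (simp add: power_mult_distrib[symmetric])
        also have "\<dots> \<le> (1 / \<beta>) ^ M * \<beta> ^ Suc i"
          using \<beta> i by (intro mult_left_mono power_decreasing) auto
        finally show "1 \<le> (1 / \<beta>) ^ M * \<beta> ^ Suc i" .
      qed (use \<beta> K in auto)
      also have "\<dots> = (1 / \<beta>) ^ (M * (M - j)) * 2 ^ Suc l * \<beta> ^ (Suc l * (M - j)) * K"
        unfolding i by (simp add: power_add mult_ac)
      finally show "2 * \<beta> ^ l * ((1 / \<beta>) ^ (M * i) * 2 ^ l * \<beta> ^ (l * i) * K) \<le>
         (1 / \<beta>) ^ (M * (M - j)) * 2 ^ Suc l * \<beta> ^ (Suc l * (M - j)) * K" .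
    qed
  qed
qed

text \<open>Telescoping. The remainder after \<open>L\<close> steps is at most \<open>A L\<close>
  times the integral of \<open>norm (F (fst p) * G (snd p))\<close>, uniformly in \<open>x\<close>,
  and so tends to 0. The pointwise bound by a series of nonnegative functions is then integrated
  term by term.\<close>

lemma bil_L1_le_suminf_residual:
  fixes F G :: "'a::euclidean_space \<Rightarrow> complex"
  assumes F: "integrable lborel F" and G: "integrable lborel G"
    and k: "\<And>l. prob_kernel (k l)" and m: "m \<in> borel_measurable borel" "\<And>x. norm (m x) \<le> C"
    and A: "\<And>l x. norm (residual k m l x) \<le> A l" "A \<longlonglongrightarrow> 0"
  shows "(\<integral>\<^sup>+x. ennreal (norm (bil F G m x)) \<partial>lborel) \<le>
    (\<Sum>l. \<integral>\<^sup>+x. ennreal (norm (bil F G (avg (k l) (residual k m l)) x)) \<partial>lborel)"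
proof -
  note [measurable] = borel_measurable_integrable[OF F, simplified] borel_measurable_integrable[OF G, simplified]
  note ms = measurable_residual[of k, OF k m] and bd = residual_le[of k, OF k m]
  define t where "t l = bil F G (avg (k l) (residual k m l))" for l
  have [measurable]: "t l \<in> borel_measurable borel" for l
    unfolding t_def by (intro measurable_bil measurable_avg k ms) measurable
  have split: "bil F G m x = (\<Sum>l<L. t l x) + bil F G (residual k m L) x" for L x
  proof (induction L)
    case (Suc L)
    have "bil F G (residual k m L) x = bil F G (\<lambda>w. avg (k L) (residual k m L) w + residual k m (Suc L) w) x"
      by simp
    also have "\<dots> = t L x + bil F G (residual k m (Suc L)) x"
      unfolding t_def by (rule bil_add[OF F G measurable_avg[OF k ms] ms norm_avg_le[OF k ms bd] bd])
    finally show ?case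
      using Suc by simp
  qed simp
  define J where "J = (LINT p|lborel. norm (F (fst p) * G (snd p)))"
  have FG: "integrable lborel (\<lambda>p. F (fst p) * G (snd p))"
    using integrable_pair_mult[OF F G] by (simp add: lborel_prod)
  have rest: "norm (bil F G (residual k m L) x) \<le> A L * J" for L x
  proof -
    have "norm (bil F G (residual k m L) x) \<le> (LINT p|lborel. A L * norm (F (fst p) * G (snd p)))"
      unfolding bil_def
    proof (rule Bochner_Integration.integral_norm_bound_integral)
      show "integrable lborel (\<lambda>p. residual k m L p * (F (fst p) * G (snd p) * cis (2 * pi * (x \<bullet> (fst p + snd p)))))"
        by (rule integrable_bil[OF F G ms bd])
      show "integrable lborel (\<lambda>p. A L * norm (F (fst p) * G (snd p)))"
        using FG by (intro integrable_mult_right integrable_norm)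
      show "norm (residual k m L p * (F (fst p) * G (snd p) * cis (2 * pi * (x \<bullet> (fst p + snd p))))) \<le> A L * norm (F (fst p) * G (snd p))" for p
        using A(1)[of L p] by (auto simp: norm_mult mult.assoc[symmetric] intro!: mult_right_mono)
    qed
    then show ?thesis by (simp add: J_def)
  qed
  have "ennreal (norm (bil F G m x)) \<le> (\<Sum>l. ennreal (norm (t l x)))" for x
  proof (rule ennreal_le_epsilon)
    fix e :: real assume "e > 0"
    have "(\<lambda>L. A L * J) \<longlonglongrightarrow> 0 * J"
      by (intro tendsto_intros A)
    then have "eventually (\<lambda>L. A L * J < e) sequentially"
      using \<open>e > 0\<close> by (auto dest: order_tendstoD)
    then obtain L where L: "A L * J < e"
      by (auto simp: eventually_sequentially)
    have "norm (bil F G m x) \<le> (\<Sum>l<L. norm (t l x)) + e"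
      unfolding split[of x L]
      using L rest[of L x] by (intro order_trans[OF norm_triangle_ineq add_mono] norm_sum) auto
    then have "ennreal (norm (bil F G m x)) \<le> ennreal ((\<Sum>l<L. norm (t l x)) + e)"
      by (rule ennreal_leI)
    also have "\<dots> = (\<Sum>l<L. ennreal (norm (t l x))) + ennreal e"
      using \<open>e > 0\<close> by (simp add: sum_nonneg)
    also have "\<dots> \<le> (\<Sum>l. ennreal (norm (t l x))) + ennreal e"
      by (intro add_right_mono sum_le_suminf) auto
    finally show "ennreal (norm (bil F G m x)) \<le> (\<Sum>l. ennreal (norm (t l x))) + ennreal e" .
  qed
  then have "(\<integral>\<^sup>+x. ennreal (norm (bil F G m x)) \<partial>lborel) \<le> (\<integral>\<^sup>+x. (\<Sum>l. ennreal (norm (t l x))) \<partial>lborel)"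
    by (rule nn_integral_mono)
  also have "\<dots> = (\<Sum>l. \<integral>\<^sup>+x. ennreal (norm (t l x)) \<partial>lborel)"
    by (rule nn_integral_suminf) measurable
  finally show ?thesis
    by (simp add: t_def)
qed

text \<open>The set where the bound fails is open, and a nonempty open set is not a null set. This
  makes essential suprema of continuous derivatives into pointwise bounds.\<close>

lemma AE_le_imp_le:
  fixes f :: "'a::euclidean_space \<Rightarrow> real"
  assumes f: "continuous_on UNIV f" and ae: "AE x in lborel. f x \<le> c"
  shows "f x \<le> c"
proof (rule ccontr)
  assume "\<not> f x \<le> c"
  then have ne: "{x. c < f x} \<noteq> {}" by (auto simp: not_le)
  have op: "open {x. c < f x}"
    using f by (intro open_Collect_less continuous_on_const)
  have "{x. c < f x} \<in> null_sets lborel"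
    using ae op by (subst (asm) AE_iff_null) (auto simp: not_le)
  then have "negligible {x. c < f x}"
    by (simp add: negligible_iff_null_sets null_sets_completionI)
  then show False
    using open_not_negligible[OF op ne] by blast
qed

lemma Linf_norm_imp_le:
  assumes f: "continuous_on UNIV f" and le: "Linf_norm f \<le> ennreal C" and C: "C \<ge> 0"
  shows "norm (f x) \<le> C"
proof (rule AE_le_imp_le[where f="\<lambda>x. norm (f x)"])
  show "continuous_on UNIV (\<lambda>x. norm (f x))"
    using f by (rule continuous_on_norm)
  have "AE x in lborel. ennreal (norm (f x)) \<le> Linf_norm f"
    unfolding Linf_norm_def by (rule esssup_AE)
  then show "AE x in lborel. norm (f x) \<le> C"
  proof eventually_elim
    case (elim x)
    then have "ennreal (norm (f x)) \<le> ennreal C"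
      using le by (rule order_trans)
    then show ?case using C by (simp add: ennreal_le_iff)
  qed
qed

theorem mult_norm_le:
  fixes q :: real and M :: nat
  assumes q: "1 \<le> q" "q < 4" and M: "2 * real DIM('a::euclidean_space) < real M * (4 - q)"
  obtains D where "D > 0"
    "\<And>(m :: 'a \<times> 'a \<Rightarrow> complex) C. in_Lp q m \<Longrightarrow> C_class M m \<Longrightarrow> C \<ge> 0 \<Longrightarrow>
      (\<And>\<alpha>. multi_index \<alpha> \<Longrightarrow> length \<alpha> \<le> M \<Longrightarrow> Linf_norm (iter_partial \<alpha> m) \<le> ennreal C) \<Longrightarrow>
      mult_norm m \<le> ennreal (D * C powr (1 - q / 4) * Lp_norm q m powr (q / 4))"
proof -
  define n where "n = real DIM('a)"
  define s where "s = 1 - q / 4"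
  have s: "0 < s" "s \<le> 1" using q by (auto simp: s_def)
  \<comment> \<open>The net power of \<beta> gained per scale: \<open>M * s\<close> from the sup
    bound raised to the power \<open>s\<close>, minus \<open>n / 2\<close> from the height of the
    kernel. The hypothesis on \<open>M\<close> is equivalent to its positivity.\<close>
  define \<epsilon> where "\<epsilon> = real M * s - n / 2"
  have \<epsilon>: "\<epsilon> > 0" using M by (simp add: \<epsilon>_def s_def n_def field_simps)
  \<comment> \<open>With \<open>R powr (- \<epsilon>) = 1 / 16\<close> the factors per scale that
    are free of \<beta>, at most 2 * 4 in total, are absorbed and the ratio of the geometric series
    is at most 1/2.\<close>
  define R where "R = 16 powr (1 / \<epsilon>)"
  have R: "R \<ge> 1" using \<epsilon> by (simp add: R_def ge_one_powr_ge_zero)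
  have R\<epsilon>: "R powr \<epsilon> = 16" using \<epsilon> by (simp add: R_def powr_powr)
  define \<beta> where "\<beta> = 1 / R"
  have \<beta>: "0 < \<beta>" "\<beta> \<le> 1" using R by (auto simp: \<beta>_def)
  define V where "V = unit_ball_vol n"
  have V: "V > 0" by (simp add: V_def n_def)
  \<comment> \<open>\<open>R ^ (M * M)\<close> is the prefactor of \<open>diff_bnd_residual\<close>
    at order 0, and \<open>(2 * n) ^ M\<close> is the cost of passing from partial derivatives to
    differences in dimension \<open>2 * n\<close>.\<close>
  define E where "E = R ^ (M * M) * (2 * n) ^ M"
  have n: "n \<ge> 1" using DIM_positive[where 'a='a] by (simp add: n_def Suc_le_eq del: DIM_positive)
  have E: "E > 0" using R n by (simp add: E_def)
  \<comment> \<open>Up to a constant, the contribution of the scale \<open>\<beta> ^ l\<close> is \<open>\<theta> ^ l\<close>.\<close>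
  define \<theta> where "\<theta> = R powr (n / 2) * (2 * \<beta> ^ M) powr s * 32 powr (1 / 4)"
  have "\<beta> ^ M = R powr (- real M)"
    using R by (simp add: \<beta>_def power_one_over powr_minus powr_realpow inverse_eq_divide)
  then have "(2 * \<beta> ^ M) powr s = 2 powr s * R powr (- real M * s)"
    using R by (simp add: powr_mult powr_powr)
  then have "\<theta> = (R powr (n / 2) * R powr (- real M * s)) * (2 powr s * 32 powr (1 / 4))"
    by (simp add: \<theta>_def mult_ac)
  also have "R powr (n / 2) * R powr (- real M * s) = R powr (- \<epsilon>)"
    by (simp add: powr_add[symmetric] \<epsilon>_def)
  also have "\<dots> = 1 / 16"
    using R\<epsilon> by (simp add: powr_minus inverse_eq_divide)
  also have "2 powr s * 32 powr (1 / 4) \<le> 2 powr 1 * 256 powr (1/4)"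
    using s by (intro mult_mono powr_mono powr_mono2) auto
  also have "(256::real) powr (1/4) = (4 powr 4) powr (1/4)"
    by (simp add: powr_numeral)
  also have "\<dots> = 4"
    by (subst powr_powr) simp
  finally have \<theta>: "\<theta> \<le> 1/2" by simp
  have \<theta>0: "\<theta> \<ge> 0" by (simp add: \<theta>_def)
  \<comment> \<open>One factor 2 comes from the two parts of the splitting, the other from the sum
    of the geometric series; \<open>1 / sqrt V\<close> belongs to the height of the ball
    kernel.\<close>
  define D where "D = 4 / sqrt V * E powr s"
  have D: "D > 0" using V E by (simp add: D_def)
  \<comment> \<open>Gives \<open>2 * \<beta> ^ M \<le> 1 / 8\<close>, so that the sup bounds of the
    residuals tend to 0.\<close>
  have "R powr \<epsilon> \<le> R powr (real M)"
    using R s n mult_left_mono[of s 1 "real M"] by (intro powr_mono) (auto simp: \<epsilon>_def)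
  then have RM: "R ^ M \<ge> 16"
    using R R\<epsilon> by (simp add: powr_realpow)

  show thesis
  proof (rule that[OF D])
    fix m :: "'a \<times> 'a \<Rightarrow> complex" and C :: real
    assume m: "in_Lp q m" "C_class M m" "C \<ge> 0"
      and Lf: "\<And>\<alpha>. multi_index \<alpha> \<Longrightarrow> length \<alpha> \<le> M \<Longrightarrow> Linf_norm (iter_partial \<alpha> m) \<le> ennreal C"
    have cls: "has_iter_partial \<alpha> m" "continuous_on UNIV (iter_partial \<alpha> m)" if "multi_index \<alpha>" "length \<alpha> \<le> M" for \<alpha>
      using m(2) that by (auto simp: C_class_def)
    have le: "norm (iter_partial \<alpha> m x) \<le> C" if "multi_index \<alpha>" "length \<alpha> \<le> M" for \<alpha> x
      using Linf_norm_imp_le[OF cls(2)[OF that] Lf[OF that] m(3)] .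
    have cont: "continuous_on UNIV m"
      using cls(2)[of "[]"] by simp
    have mm [measurable]: "m \<in> borel_measurable borel"
      by (rule borel_measurable_continuous_onI[OF cont])
    have m_le: "norm (m x) \<le> C" for x
      using le[of "[]" x] by simp
    define Q where "Q = (LINT x|lborel. norm (m x) powr q)"
    have Q0: "Q \<ge> 0" by (simp add: Q_def)
    have Qnn: "(\<integral>\<^sup>+x. ennreal (norm (m x) powr q) \<partial>lborel) = ennreal Q"
      unfolding Q_def using m(1) by (intro nn_integral_eq_integral) (auto simp: in_Lp_def)
    have LQ: "Lp_norm q m powr (q / 4) = Q powr (1 / 4)"
      using q by (simp add: Lp_norm_def Q_def powr_powr)
    \<comment> \<open>The one-scale estimate asks for a positive sup bound and a positive integral
      \<open>Q\<close>. Both hold for a continuous multiplier that is not identically zero, so the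
      zero multiplier is treated apart.\<close>
    show "mult_norm m \<le> ennreal (D * C powr (1 - q / 4) * Lp_norm q m powr (q / 4))"
    proof (cases "\<forall>x. m x = 0")
      case True
      then have "L1_norm (bilinear_mult m f g) = 0" for f g
        by (simp add: L1_norm_def bilinear_mult_def)
      then have "mult_norm m \<le> 0"
        unfolding mult_norm_def by (intro Inf_lower) auto
      then show ?thesis by simp
    next
      case False
      then obtain x0 where x0: "m x0 \<noteq> 0" by auto
      have C: "C > 0"
        using m_le[of x0] x0 by (smt (verit) zero_less_norm_iff)
      have Q: "Q > 0"
      proof (rule ccontr)
        assume "\<not> Q > 0"
        with Q0 Qnn have "(\<integral>\<^sup>+x. ennreal (norm (m x) powr q) \<partial>lborel) = 0" by simp
        then have "AE x in lborel. norm (m x) \<le> 0"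
          by (subst (asm) nn_integral_0_iff_AE) auto
        then have "norm (m x0) \<le> 0"
          by (rule AE_le_imp_le[where f="\<lambda>x. norm (m x)", OF continuous_on_norm[OF cont]])
        with x0 show False by simp
      qed
      define K where "K = (2 * n) ^ M * C"
      have K: "K \<ge> 0" using C n by (simp add: K_def)
      define k where "k l = tensor (ball_kernel (\<beta> ^ l) :: 'a \<Rightarrow> real)" for l
      have pk: "prob_kernel (ball_kernel (\<beta> ^ l) :: 'a \<Rightarrow> real)" for l
        using \<beta> by (intro prob_kernel_ball_kernel) simp
      have k: "prob_kernel (k l)" for l
        unfolding k_def by (intro prob_kernel_tensor pk)
      have supp: "norm v \<le> 2 * \<beta> ^ l" if "k l v \<noteq> 0" for l v
        using that \<beta> ball_kernel_tensor_support[of "\<beta> ^ l" v] by (simp add: k_def)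
      have dm: "diff_bnd j K m" if "j \<le> M" for j
      proof (rule diff_bnd_mono)
        show "diff_bnd j (real DIM('a \<times> 'a) ^ j * C) m"
          using that le cls m(3) by (intro diff_bnd_of_partials) auto
        have "(2 * n) ^ j \<le> (2 * n) ^ M"
          using n that by (intro power_increasing) auto
        then show "real DIM('a \<times> 'a) ^ j * C \<le> K"
          using C unfolding K_def n_def by (intro mult_right_mono) auto
      qed
      define A where "A l = E * C * (2 * \<beta> ^ M) ^ l" for l
      have A: "A l > 0" for l
        using E C \<beta> by (simp add: A_def)
      have a_le: "norm (residual k m l x) \<le> A l" for l x
      proof -
        have "diff_bnd 0 ((1 / \<beta>) ^ (M * (M - 0)) * 2 ^ l * \<beta> ^ (l * (M - 0)) * K) (residual k m l)"
          by (rule diff_bnd_residual[of k, OF k mm m_le supp dm K \<beta>]) auto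
        then have "norm (residual k m l x) \<le> (1 / \<beta>) ^ (M * M) * 2 ^ l * \<beta> ^ (l * M) * K"
          unfolding diff_bnd_0 diff_zero by blast
        also have "\<dots> = A l"
          by (simp add: A_def E_def K_def \<beta>_def power_mult_distrib power_mult[symmetric] mult_ac)
        finally show ?thesis .
      qed
      have "(\<lambda>l. E * C * (2 * \<beta> ^ M) ^ l) \<longlonglongrightarrow> E * C * 0"
      proof (intro tendsto_intros LIMSEQ_power_zero)
        have "\<beta> ^ M \<le> 1 / 16"
          using RM R by (simp add: \<beta>_def power_one_over field_simps)
        then show "norm (2 * \<beta> ^ M) < 1"
          using \<beta> by simp
      qed
      then have A0: "A \<longlonglongrightarrow> 0"
        by (simp add: A_def[abs_def])
      have ms: "residual k m l \<in> borel_measurable borel" for l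
        by (rule measurable_residual[of k, OF k mm m_le])
      have Ql: "(\<integral>\<^sup>+x. ennreal (norm (residual k m l x) powr q) \<partial>lborel) \<le> ennreal (32 ^ l * Q)" for l
        using nn_integral_residual_le[of k, OF k mm m_le, of q l] q Q0 unfolding Qnn
        by (simp add: ennreal_mult ennreal_power[symmetric])
      have "L1_norm (bilinear_mult m f g) \<le> ennreal (D * C powr s * Q powr (1/4)) * ennreal (Lp_norm 2 f) * ennreal (Lp_norm 2 g)"
        if f: "schwartz f" and g: "schwartz g" for f g
      proof -
        define \<phi> where "\<phi> = Lp_norm 2 f"
        define \<gamma> where "\<gamma> = Lp_norm 2 g"
        have \<phi>: "\<phi> \<ge> 0" and \<gamma>: "\<gamma> \<ge> 0"
          by (auto simp: \<phi>_def \<gamma>_def Lp_norm_def)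
        let ?F = "fourier f" and ?G = "fourier g"
        have T: "(\<integral>\<^sup>+x. ennreal (norm (bil ?F ?G (avg (k l) (residual k m l)) x)) \<partial>lborel) \<le>
           ennreal (D / 2 * C powr s * Q powr (1/4) * \<phi> * \<gamma> * (1/2) ^ l)" for l
        proof -
          define \<kappa> where "\<kappa> = 1 / (unit_ball_vol (real DIM('a)) * (\<beta> ^ l) ^ DIM('a))"
          have \<kappa>: "\<kappa> = R ^ (DIM('a) * l) / V"
            using R by (simp add: \<kappa>_def V_def n_def \<beta>_def power_one_over power_mult[symmetric] mult.commute)
          have "sqrt (R ^ (DIM('a) * l)) = (R powr (n / 2)) ^ l"
          proof -
            have "sqrt (R ^ (DIM('a) * l)) = (R powr (real (DIM('a) * l))) powr (1/2)"
              using R by (subst powr_realpow) (simp_all add: powr_half_sqrt)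
            also have "\<dots> = R powr (real l * (n / 2))"
              by (simp add: powr_powr n_def mult.commute)
            also have "\<dots> = (R powr (n / 2)) ^ l"
              using R by (simp add: powr_power)
            finally show ?thesis .
          qed
          then have sk: "sqrt \<kappa> = (R powr (n / 2)) ^ l / sqrt V"
            by (simp add: \<kappa> real_sqrt_divide)
          have pl: "(x ^ l) powr y = (x powr y) ^ l" if "x > 0" for x y :: real
            using that by (simp add: powr_realpow[symmetric] powr_powr powr_power mult.commute)
          have Al: "A l powr s = E powr s * C powr s * ((2 * \<beta> ^ M) powr s) ^ l"
            unfolding A_def using E C \<beta> by (simp add: powr_mult pl power_mult_distrib)
          have Ql': "(32 ^ l * Q) powr (1/4) = (32 powr (1/4)) ^ l * Q powr (1/4)"
            using Q by (simp add: powr_mult pl)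
          have "(\<integral>\<^sup>+x. ennreal (norm (bil ?F ?G (avg (k l) (residual k m l)) x)) \<partial>lborel) \<le>
             ennreal (2 * (sqrt \<kappa> * (A l powr (1 - q / 4) * (32 ^ l * Q) powr (1 / 4)) * \<phi> * \<gamma>))"
            unfolding k_def
          proof (rule bil_tensor_avg_Lq_le)
            show "ball_kernel (\<beta> ^ l) x \<le> \<kappa>" for x :: 'a
              unfolding \<kappa>_def using \<beta> by (intro ball_kernel_le) simp
          qed (use f g pk ms a_le A q Ql Q \<phi> \<gamma> nn_integral_fourier_le[OF f] nn_integral_fourier_le[OF g]
              in \<open>auto simp: \<phi>_def \<gamma>_def k_def[symmetric] intro: integrable_fourier\<close>)
          also have "2 * (sqrt \<kappa> * (A l powr (1 - q / 4) * (32 ^ l * Q) powr (1 / 4)) * \<phi> * \<gamma>) =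
             (D / 2 * C powr s * Q powr (1/4) * \<phi> * \<gamma>) * \<theta> ^ l"
            unfolding sk Ql' s_def[symmetric] Al
            by (simp add: D_def \<theta>_def power_mult_distrib)
          also have "\<dots> \<le> (D / 2 * C powr s * Q powr (1/4) * \<phi> * \<gamma>) * (1/2) ^ l"
            using D \<phi> \<gamma> \<theta> \<theta>0 by (intro mult_left_mono power_mono) auto
          finally show ?thesis
            by (simp add: ennreal_leI)
        qed
        have "L1_norm (bilinear_mult m f g) = (\<integral>\<^sup>+x. ennreal (norm (bil ?F ?G m x)) \<partial>lborel)"
          by (simp add: L1_norm_def bilinear_mult_eq_bil[OF f g mm m_le])
        also have "\<dots> \<le> (\<Sum>l. \<integral>\<^sup>+x. ennreal (norm (bil ?F ?G (avg (k l) (residual k m l)) x)) \<partial>lborel)"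
          by (rule bil_L1_le_suminf_residual[of _ _ k, OF integrable_fourier[OF f] integrable_fourier[OF g] k mm m_le a_le A0])
        also have "\<dots> \<le> (\<Sum>l. ennreal (D / 2 * C powr s * Q powr (1/4) * \<phi> * \<gamma> * (1/2) ^ l))"
          by (intro suminf_le T) auto
        also have "\<dots> = ennreal (D / 2 * C powr s * Q powr (1/4) * \<phi> * \<gamma> * 2)"
        proof (rule suminf_ennreal_eq)
          show "(\<lambda>l. D / 2 * C powr s * Q powr (1/4) * \<phi> * \<gamma> * (1/2) ^ l) sums (D / 2 * C powr s * Q powr (1/4) * \<phi> * \<gamma> * 2)"
            using geometric_sums[of "1/2 :: real"] by (intro sums_mult) simp
        qed (use D \<phi> \<gamma> in auto)
        also have "\<dots> = ennreal (D * C powr s * Q powr (1/4)) * ennreal \<phi> * ennreal \<gamma>"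
          using D \<phi> \<gamma> by (simp add: ennreal_mult[symmetric])
        finally show ?thesis
          by (simp add: \<phi>_def \<gamma>_def)
      qed
      then show ?thesis
        unfolding mult_norm_def LQ s_def[symmetric] by (intro Inf_lower) auto
    qed
  qed
qed

section \<open>Chirped Gaussians\<close>

definition chirp :: "real \<Rightarrow> real \<Rightarrow> 'a::euclidean_space \<Rightarrow> complex" where
  "chirp \<rho> \<sigma> p = of_real (exp (- pi * \<rho> * (norm p)\<^sup>2)) * cis (- pi * \<sigma> * (norm p)\<^sup>2)"

lemma norm_chirp: "norm (chirp \<rho> \<sigma> p) = exp (- pi * \<rho> * (norm p)\<^sup>2)"
  by (simp add: chirp_def norm_mult)

lemma measurable_chirp [measurable]: "chirp \<rho> \<sigma> \<in> borel_measurable borel"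
  unfolding chirp_def[abs_def] by measurable

lemma integrable_chirp_cis:
  assumes "\<rho> > 0"
  shows "integrable lborel (\<lambda>p::'a::euclidean_space. chirp \<rho> \<sigma> p * cis (2 * pi * (p \<bullet> x)))"
  by (rule Bochner_Integration.integrable_bound[OF integrable_gaussian[OF assms]])
     (auto simp: norm_mult norm_chirp)

text \<open>Squaring the modulus and passing to the variables \<open>s \<plusminus> u / 2\<close> leaves only Gaussians with a real
  parameter, so no branch of a complex root is needed.\<close>

lemma cmod_integral_chirp:
  fixes x :: "'a::euclidean_space"
  assumes \<rho>: "\<rho> > 0"
  shows "(cmod (LINT p|lborel. chirp \<rho> \<sigma> p * cis (2 * pi * (p \<bullet> x))))\<^sup>2 =
    exp (- 2 * pi * \<rho> * (norm x)\<^sup>2 / (\<rho>\<^sup>2 + \<sigma>\<^sup>2)) * (\<rho>\<^sup>2 + \<sigma>\<^sup>2) powr (- real DIM('a) / 2)"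
proof -
  define E where "E p = chirp \<rho> \<sigma> p * cis (2 * pi * (p \<bullet> x))" for p
  have [measurable]: "E \<in> borel_measurable borel"
    unfolding E_def by measurable
  have E_eq: "E p = complex_of_real (exp (- pi * \<rho> * (norm p)\<^sup>2)) * cis (- pi * \<sigma> * (norm p)\<^sup>2 + 2 * pi * (p \<bullet> x))" for p
    unfolding E_def chirp_def cis_mult[symmetric] by (simp only: mult.assoc)
  have cc: "(complex_of_real a * cis \<alpha>) * cnj (complex_of_real b * cis \<beta>) = complex_of_real (a * b) * cis (\<alpha> - \<beta>)" for a b \<alpha> \<beta>
    using cis_mult[of \<alpha> "- \<beta>", symmetric] by (simp add: cis_cnj mult_ac)
  have E_int: "integrable lborel E"
    unfolding E_def by (rule integrable_chirp_cis[OF \<rho>])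
  define I where "I = (LINT p|lborel. E p)"
  define \<Phi> where "\<Phi> s u = E (s + u) * cnj (E s)" for s u
  have [measurable]: "case_prod \<Phi> \<in> borel_measurable (borel \<Otimes>\<^sub>M borel)"
    unfolding \<Phi>_def by measurable
  have m\<Phi>: "(\<lambda>s. \<Phi> s u) \<in> borel_measurable borel" for u
    unfolding \<Phi>_def by measurable
  have \<Phi>_int: "integrable (lborel \<Otimes>\<^sub>M lborel) (case_prod \<Phi>)"
  proof (rule lborel_pair.Fubini_integrable)
    have "(LINT u|lborel. norm (E (s + u))) = (LINT u|lborel. norm (E u))" for s
      by (rule integral_lborel_shift) measurable
    then show "integrable lborel (\<lambda>s. LINT u|lborel. norm (case_prod \<Phi> (s, u)))"
      using E_int by (simp add: \<Phi>_def norm_mult)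
    have "integrable lborel (\<lambda>u. E (s + u))" for s
      using E_int by (subst integrable_lborel_shift) auto
    then show "AE s in lborel. integrable lborel (\<lambda>u. case_prod \<Phi> (s, u))"
      by (simp add: \<Phi>_def)
  qed measurable
  \<comment> \<open>This is \<open>\<rho> / 2 + \<sigma>^2 / (2 * \<rho>)\<close>: the first term is
    what the two Gaussian weights leave in \<open>u\<close>, the second comes from integrating out
    \<open>s\<close>.\<close>
  define \<tau> where "\<tau> = (\<rho>\<^sup>2 + \<sigma>\<^sup>2) / (2 * \<rho>)"
  have \<tau>: "\<tau> > 0" using \<rho> by (simp add: \<tau>_def add_pos_nonneg)
  have inner: "(LINT s|lborel. \<Phi> s u) = of_real ((2 * \<rho>) powr (- real DIM('a) / 2)) *
      (complex_of_real (exp (- pi * \<tau> * (norm u)\<^sup>2)) * cis (2 * pi * (u \<bullet> x)))" for u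
  proof -
    \<comment> \<open>In the symmetric variables the squares of \<open>s\<close> and
      \<open>u\<close> cancel in the difference of the two phases. What remains of the quadratic
      phase is bilinear in \<open>s\<close> and \<open>u\<close>, hence a plain character in
      \<open>s\<close> with frequency \<open>- \<sigma> *\<^sub>R u\<close>.\<close>
    have ph: "E (s + u /\<^sub>R 2) * cnj (E (s - u /\<^sub>R 2)) = (complex_of_real (exp (- pi * (\<rho> / 2) * (norm u)\<^sup>2)) * cis (2 * pi * (u \<bullet> x))) *
        (complex_of_real (exp (- pi * (2 * \<rho>) * (norm s)\<^sup>2)) * cis (2 * pi * (s \<bullet> (- \<sigma> *\<^sub>R u))))" for s
    proof -
      have n1: "(norm (s + u /\<^sub>R 2))\<^sup>2 = (norm s)\<^sup>2 + s \<bullet> u + (norm u)\<^sup>2 / 4"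
        and n2: "(norm (s - u /\<^sub>R 2))\<^sup>2 = (norm s)\<^sup>2 - s \<bullet> u + (norm u)\<^sup>2 / 4"
        by (simp_all add: power2_norm_eq_inner inner_add_left inner_add_right inner_diff_left inner_diff_right inner_commute)
      have "E (s + u /\<^sub>R 2) * cnj (E (s - u /\<^sub>R 2)) =
          complex_of_real (exp (- pi * \<rho> * (norm (s + u /\<^sub>R 2))\<^sup>2) * exp (- pi * \<rho> * (norm (s - u /\<^sub>R 2))\<^sup>2)) *
          cis ((- pi * \<sigma> * (norm (s + u /\<^sub>R 2))\<^sup>2 + 2 * pi * ((s + u /\<^sub>R 2) \<bullet> x)) - (- pi * \<sigma> * (norm (s - u /\<^sub>R 2))\<^sup>2 + 2 * pi * ((s - u /\<^sub>R 2) \<bullet> x)))"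
        unfolding E_eq by (rule cc)
      also have "exp (- pi * \<rho> * (norm (s + u /\<^sub>R 2))\<^sup>2) * exp (- pi * \<rho> * (norm (s - u /\<^sub>R 2))\<^sup>2) =
          exp (- pi * (\<rho> / 2) * (norm u)\<^sup>2) * exp (- pi * (2 * \<rho>) * (norm s)\<^sup>2)"
        unfolding exp_add[symmetric] n1 n2 by (simp add: algebra_simps)
      also have "(- pi * \<sigma> * (norm (s + u /\<^sub>R 2))\<^sup>2 + 2 * pi * ((s + u /\<^sub>R 2) \<bullet> x)) - (- pi * \<sigma> * (norm (s - u /\<^sub>R 2))\<^sup>2 + 2 * pi * ((s - u /\<^sub>R 2) \<bullet> x))
         = 2 * pi * (u \<bullet> x) + 2 * pi * (s \<bullet> (- \<sigma> *\<^sub>R u))"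
        unfolding n1 n2 by (simp add: algebra_simps inner_add_left inner_diff_left)
      finally show ?thesis
        by (simp only: cis_mult[symmetric] of_real_mult mult_ac)
    qed
    have "(LINT s|lborel. \<Phi> s u) = (LINT s|lborel. \<Phi> (- (u /\<^sub>R 2) + s) u)"
      by (rule integral_lborel_shift[OF m\<Phi>, symmetric])
    also have "\<dots> = (LINT s|lborel. E (s + u /\<^sub>R 2) * cnj (E (s - u /\<^sub>R 2)))"
    proof (intro Bochner_Integration.integral_cong refl)
      fix s
      have "- (u /\<^sub>R 2) + s + u = s + u /\<^sub>R 2"
      proof -
        have "s + u /\<^sub>R 2 = s + (1 - 1 / 2) *\<^sub>R u"
          by simp
        also have "\<dots> = - (u /\<^sub>R 2) + s + u"
          unfolding scaleR_left_diff_distrib by simp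
        finally show ?thesis by simp
      qed
      then show "\<Phi> (- (u /\<^sub>R 2) + s) u = E (s + u /\<^sub>R 2) * cnj (E (s - u /\<^sub>R 2))"
        unfolding \<Phi>_def by (simp only: minus_add_cancel uminus_add_conv_diff)
    qed
    also have "\<dots> = (complex_of_real (exp (- pi * (\<rho> / 2) * (norm u)\<^sup>2)) * cis (2 * pi * (u \<bullet> x))) *
        (LINT s|lborel. complex_of_real (exp (- pi * (2 * \<rho>) * (norm s)\<^sup>2)) * cis (2 * pi * (s \<bullet> (- \<sigma> *\<^sub>R u))))"
      unfolding ph by (rule integral_mult_right_zero)
    also have "(LINT s|lborel. complex_of_real (exp (- pi * (2 * \<rho>) * (norm s)\<^sup>2)) * cis (2 * pi * (s \<bullet> (- \<sigma> *\<^sub>R u)))) =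
       complex_of_real (exp (- pi * (norm (- \<sigma> *\<^sub>R u))\<^sup>2 / (2 * \<rho>)) * (2 * \<rho>) powr (- real DIM('a) / 2))"
      by (rule integral_gaussian_cis) (use \<rho> in simp)
    also have "(complex_of_real (exp (- pi * (\<rho> / 2) * (norm u)\<^sup>2)) * cis (2 * pi * (u \<bullet> x))) * \<dots> =
      of_real ((2 * \<rho>) powr (- real DIM('a) / 2)) *
      (complex_of_real (exp (- pi * (\<rho> / 2) * (norm u)\<^sup>2) * exp (- pi * (norm (- \<sigma> *\<^sub>R u))\<^sup>2 / (2 * \<rho>))) * cis (2 * pi * (u \<bullet> x)))"
      by (simp add: mult_ac)
    also have "exp (- pi * (\<rho> / 2) * (norm u)\<^sup>2) * exp (- pi * (norm (- \<sigma> *\<^sub>R u))\<^sup>2 / (2 * \<rho>)) = exp (- pi * \<tau> * (norm u)\<^sup>2)"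
      unfolding exp_add[symmetric] using \<rho> by (simp add: \<tau>_def field_simps power2_eq_square)
    finally show ?thesis .
  qed
  have "I * cnj I = (LINT s|lborel. cnj (E s) * I)"
    unfolding integral_mult_left_zero by (simp add: I_def mult.commute)
  also have "\<dots> = (LINT s|lborel. LINT u|lborel. \<Phi> s u)"
  proof (intro Bochner_Integration.integral_cong refl)
    fix s
    have "I = (LINT u|lborel. E (s + u))"
      unfolding I_def by (rule integral_lborel_shift[of E s, symmetric]) measurable
    then show "cnj (E s) * I = (LINT u|lborel. \<Phi> s u)"
      by (simp add: \<Phi>_def mult.commute)
  qed
  also have "\<dots> = (LINT u|lborel. LINT s|lborel. \<Phi> s u)"
    by (rule lborel_pair.Fubini_integral[OF \<Phi>_int, symmetric])
  also have "\<dots> = of_real ((2 * \<rho>) powr (- real DIM('a) / 2)) *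
     (LINT u|lborel. complex_of_real (exp (- pi * \<tau> * (norm u)\<^sup>2)) * cis (2 * pi * (u \<bullet> x)))"
    unfolding inner by (rule integral_mult_right_zero)
  also have "\<dots> = of_real ((2 * \<rho>) powr (- real DIM('a) / 2) * (exp (- pi * (norm x)\<^sup>2 / \<tau>) * \<tau> powr (- real DIM('a) / 2)))"
    unfolding integral_gaussian_cis[OF \<tau>] by simp
  also have "(2 * \<rho>) powr (- real DIM('a) / 2) * (exp (- pi * (norm x)\<^sup>2 / \<tau>) * \<tau> powr (- real DIM('a) / 2)) =
     exp (- pi * (norm x)\<^sup>2 / \<tau>) * (2 * \<rho> * \<tau>) powr (- real DIM('a) / 2)"
    using \<rho> \<tau> by (simp add: powr_mult)
  also have "2 * \<rho> * \<tau> = \<rho>\<^sup>2 + \<sigma>\<^sup>2"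
    using \<rho> by (simp add: \<tau>_def)
  also have "- pi * (norm x)\<^sup>2 / \<tau> = - 2 * pi * \<rho> * (norm x)\<^sup>2 / (\<rho>\<^sup>2 + \<sigma>\<^sup>2)"
    using \<rho> by (simp add: \<tau>_def)
  finally have "complex_of_real ((cmod I)\<^sup>2) = complex_of_real (exp (- 2 * pi * \<rho> * (norm x)\<^sup>2 / (\<rho>\<^sup>2 + \<sigma>\<^sup>2)) * (\<rho>\<^sup>2 + \<sigma>\<^sup>2) powr (- real DIM('a) / 2))"
    by (simp only: complex_norm_square)
  then show ?thesis
    unfolding I_def E_def by (simp only: of_real_eq_iff)
qed

section \<open>Test Gaussians and chirp multipliers\<close>

definition gauss :: "real \<Rightarrow> 'a::euclidean_space \<Rightarrow> complex" where
  "gauss N \<xi> = of_real (exp (- pi * (norm \<xi>)\<^sup>2 / N\<^sup>2))"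

text \<open>The gradient of the phase has size of order \<open>norm z / K\<close>, bounded on the
  region \<open>norm z \<le> K\<close> where the amplitude is not small. The phase depends on
  \<open>fst z + snd z\<close> alone, the frequency dual to \<open>x\<close>, so that it survives as
  a chirp in one variable and spreads the output.\<close>

definition chirp_mult :: "real \<Rightarrow> 'a::euclidean_space \<times> 'a \<Rightarrow> complex" where
  "chirp_mult K z = of_real (exp (- pi * (norm z)\<^sup>2 / K\<^sup>2)) * cis (pi * (norm (fst z + snd z))\<^sup>2 / K)"

lemma norm_chirp_mult: "norm (chirp_mult K z) = exp (- pi * (norm z)\<^sup>2 / K\<^sup>2)"
  by (simp add: chirp_mult_def norm_mult)

lemma norm_chirp_mult_le_1: "norm (chirp_mult K z) \<le> 1"
  by (simp add: norm_chirp_mult)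

lemma measurable_chirp_mult: "chirp_mult K \<in> borel_measurable borel"
  unfolding chirp_mult_def[abs_def] divide_inverse
  by (intro borel_measurable_continuous_onI continuous_intros)

lemma measurable_gauss [measurable]: "gauss N \<in> borel_measurable borel"
  unfolding gauss_def[abs_def] by measurable

lemma integrable_gauss:
  assumes "N > 0"
  shows "integrable lborel (gauss N)"
proof -
  have "integrable lborel (\<lambda>\<xi>::'a. complex_of_real (exp (- pi * (1 / N\<^sup>2) * (norm \<xi>)\<^sup>2)))"
    by (intro integrable_of_real integrable_gaussian) (use assms in simp)
  then show ?thesis
    by (simp add: gauss_def[abs_def])
qed

text \<open>In the variables \<xi> and \<open>p = \<xi> + \<eta>\<close> the phase involves
  \<open>p\<close> only, and the parallelogram law splits the weight into Gaussians in
  \<open>\<xi> - p /\<^sub>R 2\<close> and in \<open>p\<close>. The first is integrated out. The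
  minus sign in \<open>- 1 / K\<close> comes from the sign convention in
  \<open>chirp\<close>.\<close>

lemma bil_gauss_chirp_mult:
  fixes x :: "'a::euclidean_space"
  assumes N: "N > 0" and K: "K > 0"
  defines "a \<equiv> 1 / N\<^sup>2 + 1 / K\<^sup>2"
  shows "bil (gauss N) (gauss N) (chirp_mult K) x = of_real ((2 * a) powr (- real DIM('a) / 2)) *
    (LINT p|lborel. chirp (a / 2) (- 1 / K) p * cis (2 * pi * (p \<bullet> x)))"
proof -
  have a: "a > 0" using N K by (simp add: a_def add_pos_pos)
  define \<Psi> where "\<Psi> z = complex_of_real (exp (- pi * a * ((norm (fst z))\<^sup>2 + (norm (snd z))\<^sup>2))) *
     cis (pi * (norm (fst z + snd z))\<^sup>2 / K + 2 * pi * (x \<bullet> (fst z + snd z)))" for z :: "'a \<times> 'a"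
  define \<Theta> where "\<Theta> \<xi> p = \<Psi> (\<xi>, p - \<xi>)" for \<xi> p
  have m\<Psi> [measurable]: "\<Psi> \<in> borel_measurable (borel \<Otimes>\<^sub>M borel)"
    unfolding \<Psi>_def by measurable
  have [measurable]: "case_prod \<Theta> \<in> borel_measurable (borel \<Otimes>\<^sub>M borel)"
    unfolding \<Theta>_def by measurable
  have eq: "chirp_mult K z * (gauss N (fst z) * gauss N (snd z) * cis (2 * pi * (x \<bullet> (fst z + snd z)))) = \<Psi> z" for z :: "'a \<times> 'a"
  proof -
    have nz: "(norm z)\<^sup>2 = (norm (fst z))\<^sup>2 + (norm (snd z))\<^sup>2"
      by (cases z) (simp add: norm_Pair)
    have "exp (- pi * (norm z)\<^sup>2 / K\<^sup>2) * (exp (- pi * (norm (fst z))\<^sup>2 / N\<^sup>2) * exp (- pi * (norm (snd z))\<^sup>2 / N\<^sup>2)) =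
       exp (- pi * a * ((norm (fst z))\<^sup>2 + (norm (snd z))\<^sup>2))"
      unfolding exp_add[symmetric] nz a_def
      by (simp add: algebra_simps add_divide_distrib diff_divide_distrib)
    then have *: "complex_of_real (exp (- pi * (norm z)\<^sup>2 / K\<^sup>2)) * (complex_of_real (exp (- pi * (norm (fst z))\<^sup>2 / N\<^sup>2)) * complex_of_real (exp (- pi * (norm (snd z))\<^sup>2 / N\<^sup>2))) =
       complex_of_real (exp (- pi * a * ((norm (fst z))\<^sup>2 + (norm (snd z))\<^sup>2)))"
      by (simp only: of_real_mult[symmetric])
    show ?thesis
      unfolding \<Psi>_def *[symmetric] chirp_mult_def gauss_def cis_mult[symmetric] by (simp add: mult_ac)
  qed
  have \<Psi>_int: "integrable (lborel \<Otimes>\<^sub>M lborel) \<Psi>"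
    using integrable_bil[OF integrable_gauss[OF N] integrable_gauss[OF N] measurable_chirp_mult norm_chirp_mult_le_1, of K x]
    unfolding eq lborel_prod by simp
  have g: "integrable lborel (\<lambda>\<xi>::'a. exp (- pi * a * (norm \<xi>)\<^sup>2))"
    by (rule integrable_gaussian[OF a])
  have \<Theta>_int: "integrable (lborel \<Otimes>\<^sub>M lborel) (case_prod \<Theta>)"
  proof (rule lborel_pair.Fubini_integrable)
    have nT: "norm (\<Theta> \<xi> p) = exp (- pi * a * (norm \<xi>)\<^sup>2) * exp (- pi * a * (norm (- \<xi> + p))\<^sup>2)" for \<xi> p
      unfolding exp_add[symmetric] by (simp add: \<Theta>_def \<Psi>_def norm_mult algebra_simps)
    have "(LINT p|lborel. exp (- pi * a * (norm (- \<xi> + p))\<^sup>2)) = (LINT p|lborel. exp (- pi * a * (norm (p::'a))\<^sup>2))" for \<xi> :: 'a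
      by (rule integral_lborel_shift[of "\<lambda>p. exp (- pi * a * (norm p)\<^sup>2)" "- \<xi>"]) measurable
    then show "integrable lborel (\<lambda>\<xi>. LINT p|lborel. norm (case_prod \<Theta> (\<xi>, p)))"
      unfolding split_conv nT integral_mult_right_zero using g by simp
    have "integrable lborel (\<lambda>p. exp (- pi * a * (norm (- \<xi> + p))\<^sup>2))" for \<xi> :: 'a
      using g by (subst integrable_lborel_shift) auto
    then have "integrable lborel (\<lambda>p. norm (\<Theta> \<xi> p))" for \<xi>
      unfolding nT by (rule integrable_mult_right)
    moreover have "\<Theta> \<xi> \<in> borel_measurable lborel" for \<xi>
      by measurable
    ultimately have "integrable lborel (\<Theta> \<xi>)" for \<xi>
      using integrable_norm_cancel by blast
    then show "AE \<xi> in lborel. integrable lborel (\<lambda>p. case_prod \<Theta> (\<xi>, p))"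
      by simp
  qed measurable
  have inner: "(LINT \<xi>|lborel. \<Theta> \<xi> p) = of_real ((2 * a) powr (- real DIM('a) / 2)) * (chirp (a / 2) (- 1 / K) p * cis (2 * pi * (p \<bullet> x)))" for p
  proof -
    have nn: "(norm \<xi>)\<^sup>2 + (norm (p - \<xi>))\<^sup>2 = 2 * (norm (- (p /\<^sub>R 2) + \<xi>))\<^sup>2 + (norm p)\<^sup>2 / 2" for \<xi>
      unfolding power2_norm_eq_inner
      by (simp add: inner_add_left inner_add_right inner_diff_left inner_diff_right inner_commute)
    have "\<Theta> \<xi> p = (chirp (a / 2) (- 1 / K) p * cis (2 * pi * (p \<bullet> x))) *
        complex_of_real (exp (- pi * (2 * a) * (norm (- (p /\<^sub>R 2) + \<xi>))\<^sup>2))" for \<xi>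
    proof -
      have "exp (- pi * a * ((norm \<xi>)\<^sup>2 + (norm (p - \<xi>))\<^sup>2)) = exp (- pi * (a / 2) * (norm p)\<^sup>2) * exp (- pi * (2 * a) * (norm (- (p /\<^sub>R 2) + \<xi>))\<^sup>2)"
        unfolding exp_add[symmetric] nn by (simp add: algebra_simps)
      then show ?thesis
        by (simp add: \<Theta>_def \<Psi>_def chirp_def cis_mult[symmetric] inner_commute mult_ac)
    qed
    then have "(LINT \<xi>|lborel. \<Theta> \<xi> p) = (chirp (a / 2) (- 1 / K) p * cis (2 * pi * (p \<bullet> x))) *
        complex_of_real (LINT \<xi>|lborel. exp (- pi * (2 * a) * (norm (- (p /\<^sub>R 2) + \<xi>))\<^sup>2))"
      by simp
    also have "(LINT \<xi>|lborel. exp (- pi * (2 * a) * (norm (- (p /\<^sub>R 2) + \<xi>))\<^sup>2)) = (LINT \<xi>|lborel. exp (- pi * (2 * a) * (norm (\<xi>::'a))\<^sup>2))"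
      by (rule integral_lborel_shift[of "\<lambda>\<xi>. exp (- pi * (2 * a) * (norm \<xi>)\<^sup>2)" "- (p /\<^sub>R 2)"]) measurable
    also have "\<dots> = (2 * a) powr (- real DIM('a) / 2)"
      by (rule integral_gaussian) (use a in simp)
    finally show ?thesis by (simp add: mult_ac)
  qed
  have "bil (gauss N) (gauss N) (chirp_mult K) x = (LINT z|(lborel \<Otimes>\<^sub>M lborel). \<Psi> z)"
    unfolding bil_def eq by (simp add: lborel_prod)
  also have "\<dots> = (LINT \<xi>|lborel. LINT \<eta>|lborel. \<Psi> (\<xi>, \<eta>))"
    by (rule lborel_pair.integral_fst'[OF \<Psi>_int, symmetric])
  also have "\<dots> = (LINT \<xi>|lborel. LINT p|lborel. \<Theta> \<xi> p)"
  proof (rule Bochner_Integration.integral_cong[OF refl])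
    fix \<xi>
    have "(LINT p|lborel. \<Psi> (\<xi>, - \<xi> + p)) = (LINT \<eta>|lborel. \<Psi> (\<xi>, \<eta>))"
      by (rule integral_lborel_shift[of "\<lambda>\<eta>. \<Psi> (\<xi>, \<eta>)" "- \<xi>"]) measurable
    then show "(LINT \<eta>|lborel. \<Psi> (\<xi>, \<eta>)) = (LINT p|lborel. \<Theta> \<xi> p)"
      by (simp add: \<Theta>_def)
  qed
  also have "\<dots> = (LINT p|lborel. LINT \<xi>|lborel. \<Theta> \<xi> p)"
    by (rule lborel_pair.Fubini_integral[OF \<Theta>_int, symmetric])
  also have "\<dots> = of_real ((2 * a) powr (- real DIM('a) / 2)) *
    (LINT p|lborel. chirp (a / 2) (- 1 / K) p * cis (2 * pi * (p \<bullet> x)))"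
    unfolding inner by (rule integral_mult_right_zero)
  finally show ?thesis .
qed

text \<open>By \<open>cmod_integral_chirp\<close> the modulus of the output is itself a Gaussian in
  \<open>x\<close>, so its integral is explicit. The three powers with exponent \<open>- d\<close>
  then combine to \<open>(w / a^2) powr d\<close>, where \<open>w^2\<close> is the sum of the
  squares of the two chirp parameters \<open>a / 2\<close> and \<open>- 1 / K\<close>.\<close>

lemma L1_bil_gauss_chirp_mult:
  assumes N: "N > 0" and K: "K > 0"
  defines "a \<equiv> 1 / N\<^sup>2 + 1 / K\<^sup>2"
  shows "(\<integral>\<^sup>+x. ennreal (norm (bil (gauss N) (gauss N) (chirp_mult K) (x::'a::euclidean_space))) \<partial>lborel) =
    ennreal ((sqrt (a\<^sup>2 / 4 + 1 / K\<^sup>2) / a\<^sup>2) powr (real DIM('a) / 2))"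
proof -
  have a: "a > 0" using N K by (simp add: a_def add_pos_pos)
  define d where "d = real DIM('a) / 2"
  define w where "w = sqrt (a\<^sup>2 / 4 + 1 / K\<^sup>2)"
  have w2: "w\<^sup>2 = (a / 2)\<^sup>2 + (- 1 / K)\<^sup>2"
    by (simp add: w_def power_divide)
  have w: "w > 0" using a K by (simp add: w_def add_pos_pos)
  have "norm (bil (gauss N) (gauss N) (chirp_mult K) (x::'a)) =
     ((2 * a) powr (- d) * w powr (- d)) * exp (- pi * (a / (2 * w\<^sup>2)) * (norm x)\<^sup>2)" for x
  proof -
    have "(cmod (LINT p|lborel. chirp (a / 2) (- 1 / K) p * cis (2 * pi * (p \<bullet> x))))\<^sup>2 =
      exp (- 2 * pi * (a / 2) * (norm x)\<^sup>2 / w\<^sup>2) * (w\<^sup>2) powr (- d)"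
      using cmod_integral_chirp[of "a / 2" "- 1 / K" x] a unfolding w2 d_def by simp
    also have "(w\<^sup>2) powr (- d) = (w powr (- d))\<^sup>2"
      using w by (simp add: power2_eq_square powr_mult)
    also have "exp (- 2 * pi * (a / 2) * (norm x)\<^sup>2 / w\<^sup>2) = (exp (- pi * (a / (2 * w\<^sup>2)) * (norm x)\<^sup>2))\<^sup>2"
      by (simp add: exp_double[symmetric])
    finally have "cmod (LINT p|lborel. chirp (a / 2) (- 1 / K) p * cis (2 * pi * (p \<bullet> x))) = exp (- pi * (a / (2 * w\<^sup>2)) * (norm x)\<^sup>2) * w powr (- d)"
      unfolding power_mult_distrib[symmetric] by (rule power2_eq_imp_eq) auto
    then show ?thesis
      using bil_gauss_chirp_mult[OF N K, of x] by (simp add: a_def[symmetric] norm_mult d_def)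
  qed
  then have "(\<integral>\<^sup>+x. ennreal (norm (bil (gauss N) (gauss N) (chirp_mult K) (x::'a))) \<partial>lborel) =
     (\<integral>\<^sup>+x. ennreal ((2 * a) powr (- d) * w powr (- d)) * ennreal (exp (- pi * (a / (2 * w\<^sup>2)) * (norm (x::'a))\<^sup>2)) \<partial>lborel)"
    by (simp add: ennreal_mult)
  also have "\<dots> = ennreal ((2 * a) powr (- d) * w powr (- d)) * ennreal ((a / (2 * w\<^sup>2)) powr (- d))"
    using nn_integral_gaussian[of "a / (2 * w\<^sup>2)", where 'a='a] a w
    by (subst nn_integral_cmult) (auto simp: d_def)
  also have "\<dots> = ennreal ((2 * a) powr (- d) * w powr (- d) * (a / (2 * w\<^sup>2)) powr (- d))"
    by (simp add: ennreal_mult)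
  also have "(2 * a) powr (- d) * w powr (- d) * (a / (2 * w\<^sup>2)) powr (- d) = (2 * a * w * (a / (2 * w\<^sup>2))) powr (- d)"
    using a w by (simp only: powr_mult[symmetric])
  also have "2 * a * w * (a / (2 * w\<^sup>2)) = inverse (w / a\<^sup>2)"
    using a w by (simp add: field_simps power2_eq_square)
  also have "inverse (w / a\<^sup>2) powr (- d) = (w / a\<^sup>2) powr d"
    using a w by (simp add: powr_minus inverse_powr[symmetric])
  finally show ?thesis
    by (simp add: w_def d_def)
qed

section \<open>Series of polynomials times Gaussians\<close>

text \<open>Reduces the existence and the form of all iterated partials to a single differentiation
  within a closed family; it is used with \<open>gauss_series\<close> as the family.\<close>

lemma iter_partial_closed:
  assumes closed: "\<And>g b. g \<in> S \<Longrightarrow> b \<in> Basis \<Longrightarrow> \<exists>g'\<in>S. \<forall>x. ((\<lambda>t. g (x + t *\<^sub>R b)) has_vector_derivative g' x) (at 0)"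
    and f: "f \<in> S" and "multi_index \<alpha>"
  shows "has_iter_partial \<alpha> f \<and> iter_partial \<alpha> f \<in> S"
  using \<open>multi_index \<alpha>\<close>
proof (induction \<alpha>)
  case (Cons b \<alpha>)
  then have IH: "has_iter_partial \<alpha> f" "iter_partial \<alpha> f \<in> S" and b: "b \<in> Basis"
    by auto
  from closed[OF IH(2) b] obtain g' where g': "g' \<in> S"
    "\<And>x. ((\<lambda>t. iter_partial \<alpha> f (x + t *\<^sub>R b)) has_vector_derivative g' x) (at 0)"
    by blast
  then have "iter_partial (b # \<alpha>) f = g'"
    by (auto simp: iter_partial_def partial_deriv_def vector_derivative_at)
  with g' IH show ?case
    by (auto intro: differentiableI_vector)
qed (use f in auto)

text \<open>Sequences of polynomials in \<open>z / N k\<close> with degree and coefficients bounded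
  uniformly in \<open>k\<close>. The scaling matches the width of the Gaussian factors, so products
  with those are bounded uniformly in \<open>k\<close>, and differentiation stays in the class as
  long as \<open>1 / N k\<close> is bounded.\<close>

inductive poly_family :: "(nat \<Rightarrow> real) \<Rightarrow> (nat \<Rightarrow> 'a::euclidean_space \<Rightarrow> complex) \<Rightarrow> bool" for N where
  const: "(\<And>k. norm (c k) \<le> C) \<Longrightarrow> poly_family N (\<lambda>k z. c k)"
| coord: "poly_family N (\<lambda>k z. of_real (z \<bullet> v / N k))"
| add: "poly_family N p \<Longrightarrow> poly_family N q \<Longrightarrow> poly_family N (\<lambda>k z. p k z + q k z)"
| mult: "poly_family N p \<Longrightarrow> poly_family N q \<Longrightarrow> poly_family N (\<lambda>k z. p k z * q k z)"

lemma poly_family_bound: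
  assumes N: "\<And>k. N k > 0" and "poly_family N p"
  shows "\<exists>C d. C \<ge> 0 \<and> (\<forall>k z. norm (p k z) \<le> C * (1 + norm z / N k) ^ d)"
  using \<open>poly_family N p\<close>
proof induction
  case (const c C)
  then show ?case
    by (intro exI[of _ "\<bar>C\<bar>"] exI[of _ 0]) (auto intro: order_trans[OF _ abs_ge_self])
next
  case (coord v)
  have "norm (complex_of_real (z \<bullet> v / N k)) \<le> norm v * (1 + norm z / N k) ^ 1" for k and z :: 'a
  proof -
    have "norm (complex_of_real (z \<bullet> v / N k)) = \<bar>z \<bullet> v\<bar> / N k"
      using N[of k] by (simp add: norm_divide)
    also have "\<dots> \<le> norm z * norm v / N k"
      using N[of k] by (intro divide_right_mono Cauchy_Schwarz_ineq2) auto
    also have "\<dots> \<le> norm v * (1 + norm z / N k)"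
      by (simp add: algebra_simps)
    finally show ?thesis by simp
  qed
  then show ?case
    using norm_ge_zero[of v] by blast
next
  case (add p q)
  then obtain C d C' d' where *: "C \<ge> 0" "\<And>k z. norm (p k z) \<le> C * (1 + norm z / N k) ^ d"
    "C' \<ge> 0" "\<And>k z. norm (q k z) \<le> C' * (1 + norm z / N k) ^ d'" by metis
  have "norm (p k z + q k z) \<le> (C + C') * (1 + norm z / N k) ^ max d d'" for k z
  proof -
    have "1 \<le> 1 + norm z / N k" using N[of k] by simp
    then have "C * (1 + norm z / N k) ^ d \<le> C * (1 + norm z / N k) ^ max d d'"
      "C' * (1 + norm z / N k) ^ d' \<le> C' * (1 + norm z / N k) ^ max d d'"
      using * by (auto intro!: mult_left_mono power_increasing)
    then show ?thesis
      using *(2)[of k z] *(4)[of k z] norm_triangle_ineq[of "p k z" "q k z"]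
      unfolding distrib_right by linarith
  qed
  with * show ?case by (meson add_nonneg_nonneg)
next
  case (mult p q)
  then obtain C d C' d' where *: "C \<ge> 0" "\<And>k z. norm (p k z) \<le> C * (1 + norm z / N k) ^ d"
    "C' \<ge> 0" "\<And>k z. norm (q k z) \<le> C' * (1 + norm z / N k) ^ d'" by metis
  have "norm (p k z * q k z) \<le> (C * C') * (1 + norm z / N k) ^ (d + d')" for k z
  proof -
    have "norm (p k z) * norm (q k z) \<le> (C * (1 + norm z / N k) ^ d) * (C' * (1 + norm z / N k) ^ d')"
      using * N[of k] by (intro mult_mono) auto
    then show ?thesis by (simp add: norm_mult power_add mult_ac)
  qed
  with * show ?case by (meson mult_nonneg_nonneg)
qed

lemma poly_family_continuous: "poly_family N p \<Longrightarrow> continuous_on UNIV (p k)"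
  by (induction rule: poly_family.induct) (auto intro!: continuous_intros simp: divide_inverse)

lemma poly_family_deriv:
  assumes N: "\<And>k. 1 / N k \<le> B" "\<And>k. N k > 0" and "poly_family N p"
  shows "\<exists>p'. poly_family N p' \<and> (\<forall>k z. ((\<lambda>t. p k (z + t *\<^sub>R b)) has_vector_derivative p' k z) (at 0))"
  using \<open>poly_family N p\<close>
proof induction
  case (const c C)
  have "poly_family N (\<lambda>k z. 0)"
    by (rule poly_family.const[of _ 0]) simp
  then show ?case by (intro exI[of _ "\<lambda>k z. 0"]) simp
next
  case (coord v)
  have "norm (complex_of_real (b \<bullet> v / N k)) \<le> \<bar>b \<bullet> v\<bar> * B" for k
    using mult_left_mono[OF N(1)[of k], of "\<bar>b \<bullet> v\<bar>"] N(2)[of k] by (simp add: norm_divide)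
  then have "poly_family N (\<lambda>k z. complex_of_real (b \<bullet> v / N k))"
    by (rule poly_family.const)
  moreover have "((\<lambda>t. complex_of_real ((z + t *\<^sub>R b) \<bullet> v / N k)) has_vector_derivative complex_of_real (b \<bullet> v / N k)) (at 0)" for k z
    using N(2)[of k]
    by (intro has_vector_derivative_of_real) (auto simp: inner_add_left intro!: derivative_eq_intros)
  ultimately show ?case by blast
next
  case (add p q)
  then obtain p' q' where "poly_family N p'" "poly_family N q'" and
    *: "\<And>k z. ((\<lambda>t. p k (z + t *\<^sub>R b)) has_vector_derivative p' k z) (at 0)"
      "\<And>k z. ((\<lambda>t. q k (z + t *\<^sub>R b)) has_vector_derivative q' k z) (at 0)"
    by blast
  then show ?case
    by (intro exI[of _ "\<lambda>k z. p' k z + q' k z"]) (auto intro: poly_family.add has_vector_derivative_add)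
next
  case (mult p q)
  then obtain p' q' where p'q': "poly_family N p'" "poly_family N q'" and
    *: "\<And>k z. ((\<lambda>t. p k (z + t *\<^sub>R b)) has_vector_derivative p' k z) (at 0)"
      "\<And>k z. ((\<lambda>t. q k (z + t *\<^sub>R b)) has_vector_derivative q' k z) (at 0)"
    by blast
  have "((\<lambda>t. p k (z + t *\<^sub>R b) * q k (z + t *\<^sub>R b)) has_vector_derivative (p k z * q' k z + p' k z * q k z)) (at 0)" for k z
    using has_vector_derivative_mult[OF *(1)[of k z] *(2)[of k z]] by simp
  with p'q' mult show ?case
    by (intro exI[of _ "\<lambda>k z. p k z * q' k z + p' k z * q k z"]) (auto intro: poly_family.intros)
qed

lemma power_le_fact_exp:
  fixes x :: real
  assumes "x \<ge> 0"
  shows "x ^ d \<le> fact d * exp x"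
proof -
  have "x ^ d /\<^sub>R fact d \<le> (\<Sum>n. x ^ n /\<^sub>R fact n)"
    using assms sum_le_suminf[of "\<lambda>n. x ^ n /\<^sub>R fact n" "{d}"] summable_exp_generic[of x] by auto
  then show ?thesis
    by (simp add: exp_def field_simps)
qed

lemma power_gauss_bound:
  fixes r :: real
  assumes "r \<ge> 0"
  shows "(1 + r) ^ d * exp (- pi * r\<^sup>2) \<le> fact d * exp 2"
proof -
  have "(1 + r) ^ d * exp (- pi * r\<^sup>2) \<le> (fact d * exp (1 + r)) * exp (- pi * r\<^sup>2)"
    using assms by (intro mult_right_mono power_le_fact_exp) auto
  also have "\<dots> = fact d * exp ((1 + r) - pi * r\<^sup>2)"
    by (simp add: exp_diff exp_minus divide_inverse)
  also have "\<dots> \<le> fact d * exp 2"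
  proof -
    have "0 \<le> (r - 1)\<^sup>2" by simp
    then have "2 * r \<le> 1 + r\<^sup>2" by (simp add: power2_diff)
    moreover have "1 * r\<^sup>2 \<le> pi * r\<^sup>2"
      using pi_ge_two by (intro mult_right_mono) auto
    ultimately have "(1 + r) - pi * r\<^sup>2 \<le> 2"
      using assms by linarith
    then show ?thesis by simp
  qed
  finally show ?thesis .
qed

text \<open>The logarithmic derivatives of \<open>E k\<close> form a \<open>poly_family\<close>,
  which makes the products of such polynomials with \<open>E\<close> closed under differentiation.
  Both the chirp multipliers and a single Gaussian fit this description.\<close>

definition gauss_factor :: "(nat \<Rightarrow> real) \<Rightarrow> (nat \<Rightarrow> 'a::euclidean_space \<Rightarrow> complex) \<Rightarrow> bool" where
  "gauss_factor N E \<longleftrightarrow> (\<forall>k. continuous_on UNIV (E k)) \<and>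
     (\<forall>k z. norm (E k z) \<le> exp (- pi * (norm z / N k)\<^sup>2)) \<and>
     (\<forall>b\<in>Basis. \<exists>L. poly_family N L \<and> (\<forall>k z. ((\<lambda>t. E k (z + t *\<^sub>R b)) has_vector_derivative L k z * E k z) (at 0)))"

lemma poly_family_gauss_bound:
  assumes N: "\<And>k. N k > 0" and p: "poly_family N p" and E: "gauss_factor N E"
  shows "\<exists>C\<ge>0. \<forall>k z. (1 + norm z / N k) ^ j * norm (p k z * E k z) \<le> C"
proof -
  obtain C d where C: "C \<ge> 0" "\<And>k z. norm (p k z) \<le> C * (1 + norm z / N k) ^ d"
    using poly_family_bound[OF N p] by blast
  have "(1 + norm z / N k) ^ j * norm (p k z * E k z) \<le> C * (fact (j + d) * exp 2)" for k z
  proof -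
    let ?r = "norm z / N k"
    have r: "?r \<ge> 0" using N[of k] by simp
    have "norm (p k z * E k z) \<le> (C * (1 + ?r) ^ d) * exp (- pi * ?r\<^sup>2)"
      using C E r unfolding norm_mult gauss_factor_def by (intro mult_mono) auto
    then have "(1 + ?r) ^ j * norm (p k z * E k z) \<le> (1 + ?r) ^ j * ((C * (1 + ?r) ^ d) * exp (- pi * ?r\<^sup>2))"
      using r by (intro mult_left_mono) auto
    also have "\<dots> = C * ((1 + ?r) ^ (j + d) * exp (- pi * ?r\<^sup>2))"
      by (simp add: power_add mult_ac)
    also have "\<dots> \<le> C * (fact (j + d) * exp 2)"
      using C r by (intro mult_left_mono power_gauss_bound) auto
    finally show ?thesis .
  qed
  moreover have "0 \<le> C * (fact (j + d) * exp 2)"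
    using C by simp
  ultimately show ?thesis by blast
qed

text \<open>The Weierstrass test gives uniform convergence of the differentiated series on the whole
  line; the conclusion is stated at 0 because that is where \<open>partial_deriv\<close> takes its
  derivative.\<close>

lemma has_vector_derivative_series_at_0:
  fixes \<phi> :: "nat \<Rightarrow> real \<Rightarrow> complex"
  assumes d: "\<And>k t. (\<phi> k has_vector_derivative \<phi>' k t) (at t)"
    and le: "\<And>k t. norm (\<phi>' k t) \<le> M k" and M: "summable M" and s: "summable (\<lambda>k. \<phi> k 0)"
  shows "((\<lambda>t. \<Sum>k. \<phi> k t) has_vector_derivative (\<Sum>k. \<phi>' k 0)) (at 0)"
proof -
  have u: "uniform_limit UNIV (\<lambda>n t. \<Sum>k<n. \<phi>' k t) (\<lambda>t. \<Sum>k. \<phi>' k t) sequentially"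
    by (rule Weierstrass_m_test[OF _ M]) (use le in auto)
  have "\<exists>g. \<forall>t\<in>UNIV. (\<lambda>n. \<phi> n t) sums (g t) \<and> (g has_derivative (\<lambda>h. h *\<^sub>R (\<Sum>k. \<phi>' k t))) (at t within UNIV)"
  proof (rule has_derivative_series)
    show "(\<phi> n has_derivative (\<lambda>h. h *\<^sub>R \<phi>' n t)) (at t within UNIV)" for n t
      using d[of n t] by (simp add: has_vector_derivative_def)
    show "(\<lambda>n. \<phi> n 0) sums (\<Sum>k. \<phi> k 0)"
      using s by (rule summable_sums)
    show "\<forall>\<^sub>F n in sequentially. \<forall>t\<in>UNIV. \<forall>h. norm ((\<Sum>i<n. h *\<^sub>R \<phi>' i t) - h *\<^sub>R (\<Sum>k. \<phi>' k t)) \<le> e * norm h" if "e > 0" for e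
      using uniform_limitD[OF u that]
    proof eventually_elim
      case (elim n)
      show ?case
      proof (intro ballI allI)
        fix t h
        have "norm ((\<Sum>i<n. h *\<^sub>R \<phi>' i t) - h *\<^sub>R (\<Sum>k. \<phi>' k t)) = \<bar>h\<bar> * norm ((\<Sum>i<n. \<phi>' i t) - (\<Sum>k. \<phi>' k t))"
          by (simp add: scaleR_sum_right[symmetric] scaleR_diff_right[symmetric] del: scaleR_diff_right)
        also have "\<dots> \<le> \<bar>h\<bar> * e"
          using elim by (intro mult_left_mono) (auto simp: dist_norm less_imp_le)
        finally show "norm ((\<Sum>i<n. h *\<^sub>R \<phi>' i t) - h *\<^sub>R (\<Sum>k. \<phi>' k t)) \<le> e * norm h"
          by (simp add: mult.commute)
      qed
    qed
  qed auto
  then obtain g where g: "\<And>t. (\<lambda>n. \<phi> n t) sums (g t)" "(g has_derivative (\<lambda>h. h *\<^sub>R (\<Sum>k. \<phi>' k 0))) (at 0)"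
    by auto
  then have "g = (\<lambda>t. \<Sum>k. \<phi> k t)"
    by (auto simp: sums_iff)
  with g show ?thesis by (simp add: has_vector_derivative_def)
qed

text \<open>The weights and Gaussian factors are fixed and only the polynomials vary, so this set is
  mapped into itself by termwise differentiation.\<close>

definition gauss_series :: "(nat \<Rightarrow> real) \<Rightarrow> (nat \<Rightarrow> real) \<Rightarrow> (nat \<Rightarrow> 'a::euclidean_space \<Rightarrow> complex) \<Rightarrow> ('a \<Rightarrow> complex) set" where
  "gauss_series \<delta> N E = {(\<lambda>z. \<Sum>k. of_real (\<delta> k) * (p k z * E k z)) | p. poly_family N p}"

context
  fixes \<delta> N :: "nat \<Rightarrow> real" and E :: "nat \<Rightarrow> 'a::euclidean_space \<Rightarrow> complex" and B :: real
  assumes \<delta>: "\<And>k. \<delta> k \<ge> 0" "summable \<delta>" and N: "\<And>k. 1 / N k \<le> B" "\<And>k. N k > 0" and E: "gauss_factor N E"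
begin

lemma gauss_series_term_le:
  assumes "poly_family N p"
  shows "\<exists>C\<ge>0. \<forall>k z. norm (of_real (\<delta> k) * (p k z * E k z)) \<le> \<delta> k * C"
proof -
  obtain C where "C \<ge> 0" "\<And>k z. norm (p k z * E k z) \<le> C"
    using poly_family_gauss_bound[OF N(2) assms E, of 0] by auto
  then show ?thesis
    using \<delta>(1) by (intro exI[of _ C]) (auto simp: norm_mult[of "of_real _"] intro!: mult_left_mono)
qed

lemma gauss_series_deriv:
  assumes "g \<in> gauss_series \<delta> N E" "b \<in> Basis"
  shows "\<exists>g'\<in>gauss_series \<delta> N E. \<forall>x. ((\<lambda>t. g (x + t *\<^sub>R b)) has_vector_derivative g' x) (at 0)"
proof -
  obtain p where p: "poly_family N p" and g: "g = (\<lambda>z. \<Sum>k. of_real (\<delta> k) * (p k z * E k z))"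
    using assms by (auto simp: gauss_series_def)
  obtain p' where p': "poly_family N p'" "\<And>k z. ((\<lambda>t. p k (z + t *\<^sub>R b)) has_vector_derivative p' k z) (at 0)"
    using poly_family_deriv[OF N p] by blast
  obtain L where L: "poly_family N L" "\<And>k z. ((\<lambda>t. E k (z + t *\<^sub>R b)) has_vector_derivative L k z * E k z) (at 0)"
    using E assms(2) unfolding gauss_factor_def by blast
  define r where "r k z = p k z * L k z + p' k z" for k z
  have r: "poly_family N r"
    unfolding r_def by (intro poly_family.intros p p' L)
  obtain C where C: "C \<ge> 0" "\<And>k z. norm (of_real (\<delta> k) * (p k z * E k z)) \<le> \<delta> k * C"
    using gauss_series_term_le[OF p] by blast
  obtain C' where C': "C' \<ge> 0" "\<And>k z. norm (of_real (\<delta> k) * (r k z * E k z)) \<le> \<delta> k * C'"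
    using gauss_series_term_le[OF r] by blast
  have d: "((\<lambda>t. of_real (\<delta> k) * (p k (x + t *\<^sub>R b) * E k (x + t *\<^sub>R b))) has_vector_derivative
      of_real (\<delta> k) * (r k (x + s *\<^sub>R b) * E k (x + s *\<^sub>R b))) (at s)" for k x s
  proof -
    define y where "y = x + s *\<^sub>R b"
    have "((\<lambda>t. p k (y + t *\<^sub>R b) * E k (y + t *\<^sub>R b)) has_vector_derivative
        (p k y * (L k y * E k y) + p' k y * E k y)) (at 0)"
      using has_vector_derivative_mult[OF p'(2)[of k y] L(2)[of k y]] by simp
    then have "((\<lambda>t. of_real (\<delta> k) * (p k (y + t *\<^sub>R b) * E k (y + t *\<^sub>R b))) has_vector_derivative
        of_real (\<delta> k) * (r k y * E k y)) (at 0)"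
      by (auto simp: r_def algebra_simps dest: has_vector_derivative_mult_right[where a="of_real (\<delta> k)"])
    then have "((\<lambda>t. of_real (\<delta> k) * (p k (y + t *\<^sub>R b) * E k (y + t *\<^sub>R b))) \<circ> (\<lambda>t. t - s) has_vector_derivative
        1 *\<^sub>R (of_real (\<delta> k) * (r k y * E k y))) (at s)"
      by (intro vector_diff_chain_at) (auto intro!: derivative_eq_intros)
    then show ?thesis
      by (simp add: o_def y_def algebra_simps)
  qed
  have "((\<lambda>t. g (x + t *\<^sub>R b)) has_vector_derivative (\<Sum>k. of_real (\<delta> k) * (r k x * E k x))) (at 0)" for x
  proof -
    have "((\<lambda>t. \<Sum>k. of_real (\<delta> k) * (p k (x + t *\<^sub>R b) * E k (x + t *\<^sub>R b))) has_vector_derivative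
        (\<Sum>k. of_real (\<delta> k) * (r k (x + 0 *\<^sub>R b) * E k (x + 0 *\<^sub>R b)))) (at 0)"
    proof (rule has_vector_derivative_series_at_0[OF d])
      show "summable (\<lambda>k. \<delta> k * C')"
        by (rule summable_mult2[OF \<delta>(2)])
      show "summable (\<lambda>k. of_real (\<delta> k) * (p k (x + 0 *\<^sub>R b) * E k (x + 0 *\<^sub>R b)))"
        by (rule summable_comparison_test'[OF summable_mult2[OF \<delta>(2), of C], of 0]) (rule C(2))
    qed (rule C'(2))
    then show ?thesis
      by (simp add: g)
  qed
  then show ?thesis
    using r by (intro bexI[of _ "\<lambda>z. \<Sum>k. of_real (\<delta> k) * (r k z * E k z)"]) (auto simp: gauss_series_def)
qed

lemma gauss_series_continuous_bounded:
  assumes "g \<in> gauss_series \<delta> N E"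
  shows "continuous_on UNIV g" "\<exists>C\<ge>0. \<forall>x. norm (g x) \<le> C"
proof -
  obtain p where p: "poly_family N p" and g: "g = (\<lambda>z. \<Sum>k. of_real (\<delta> k) * (p k z * E k z))"
    using assms by (auto simp: gauss_series_def)
  obtain C where C: "C \<ge> 0" "\<And>k z. norm (of_real (\<delta> k) * (p k z * E k z)) \<le> \<delta> k * C"
    using gauss_series_term_le[OF p] by blast
  have M: "summable (\<lambda>k. \<delta> k * C)"
    by (rule summable_mult2[OF \<delta>(2)])
  have u: "uniform_limit UNIV (\<lambda>n z. \<Sum>k<n. of_real (\<delta> k) * (p k z * E k z)) g sequentially"
    unfolding g by (rule Weierstrass_m_test[OF _ M]) (use C in auto)
  have c: "continuous_on UNIV (\<lambda>z. \<Sum>k<n. of_real (\<delta> k) * (p k z * E k z))" for n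
    using E poly_family_continuous[OF p] unfolding gauss_factor_def by (intro continuous_intros) auto
  show "continuous_on UNIV g"
    using uniform_limit_theorem[OF always_eventually[OF allI[OF c]] u] by simp
  have "norm (g x) \<le> (\<Sum>k. \<delta> k * C)" for x
    unfolding g by (rule norm_suminf_le[OF C(2) M])
  moreover have "0 \<le> (\<Sum>k. \<delta> k * C)"
    using C \<delta> by (intro suminf_nonneg M) auto
  ultimately show "\<exists>C\<ge>0. \<forall>x. norm (g x) \<le> C" by blast
qed

lemma Linf_class_gauss_series:
  assumes "g \<in> gauss_series \<delta> N E"
  shows "Linf_class g"
  unfolding Linf_class_def
proof (intro allI impI)
  fix \<alpha> :: "'a list" assume "multi_index \<alpha>"
  from iter_partial_closed[OF gauss_series_deriv assms this]
  have *: "has_iter_partial \<alpha> g" "iter_partial \<alpha> g \<in> gauss_series \<delta> N E" by auto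
  obtain C where C: "C \<ge> 0" "\<And>x. norm (iter_partial \<alpha> g x) \<le> C"
    using gauss_series_continuous_bounded(2)[OF *(2)] by blast
  have [measurable]: "iter_partial \<alpha> g \<in> borel_measurable borel"
    by (intro borel_measurable_continuous_onI gauss_series_continuous_bounded *)
  have "Linf_norm (iter_partial \<alpha> g) \<le> ennreal C"
    unfolding Linf_norm_def by (intro esssup_I) (use C in \<open>auto intro!: ennreal_leI\<close>)
  with * show "has_iter_partial \<alpha> g \<and> Linf_norm (iter_partial \<alpha> g) < \<infinity>"
    by (auto intro: order_le_less_trans)
qed

end

section \<open>Chirp multipliers and Gaussians as Gaussian factors\<close>

lemma has_vector_derivative_exp_cis:
  assumes A: "(A has_real_derivative A') (at t)" and B: "(B has_real_derivative B') (at t)"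
  shows "((\<lambda>t. complex_of_real (exp (A t)) * cis (B t)) has_vector_derivative
    (of_real A' + \<i> * of_real B') * (complex_of_real (exp (A t)) * cis (B t))) (at t)"
proof -
  have "((\<lambda>t. complex_of_real (A t) + \<i> * complex_of_real (B t)) has_vector_derivative (of_real A' + \<i> * of_real B')) (at t)"
    using has_vector_derivative_of_real[OF A] has_vector_derivative_of_real[OF B]
    by (intro has_vector_derivative_add has_vector_derivative_mult_right)
  from field_vector_diff_chain_at[OF this DERIV_exp]
  show ?thesis
    by (simp add: o_def exp_add cis_conv_exp exp_of_real)
qed

lemma has_real_derivative_norm_sq_line:
  "((\<lambda>t. (norm (x + t *\<^sub>R b))\<^sup>2) has_real_derivative 2 * (x \<bullet> b)) (at (0::real))" for x b :: "'a::euclidean_space"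
proof -
  have "(norm (x + t *\<^sub>R b))\<^sup>2 = (norm x)\<^sup>2 + 2 * t * (x \<bullet> b) + t\<^sup>2 * (norm b)\<^sup>2" for t
    unfolding power2_norm_eq_inner
    by (simp add: inner_add_left inner_add_right inner_commute power2_eq_square algebra_simps)
  then show ?thesis
    by (auto intro!: derivative_eq_intros)
qed

lemma gauss_factor_chirp_mult:
  fixes N :: "nat \<Rightarrow> real"
  assumes N: "\<And>k. 1 \<le> N k"
  shows "gauss_factor N (\<lambda>k. chirp_mult (N k) :: 'a::euclidean_space \<times> 'a \<Rightarrow> complex)"
  unfolding gauss_factor_def
proof (intro conjI allI ballI)
  show "continuous_on UNIV (chirp_mult (N k) :: 'a \<times> 'a \<Rightarrow> complex)" for k
    unfolding chirp_mult_def[abs_def] divide_inverse by (intro continuous_intros)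
  show "norm (chirp_mult (N k) z) \<le> exp (- pi * (norm z / N k)\<^sup>2)" for k and z :: "'a \<times> 'a"
    by (simp add: norm_chirp_mult power_divide)
  fix b :: "'a \<times> 'a" assume "b \<in> Basis"
  \<comment> \<open>Chosen so that \<open>z \<bullet> v\<close> is the inner product of
    \<open>fst z + snd z\<close> with \<open>fst b + snd b\<close>, which is half the derivative of
    the squared norm in the phase. In \<open>L\<close>, one of the two factors
    \<open>1 / N k\<close> of the amplitude term is put into the coefficient, which stays bounded
    because \<open>N k\<close> is at least 1.\<close>
  define v where "v = (fst b + snd b, fst b + snd b)"
  define L where "L k z = complex_of_real (- 2 * pi / N k) * complex_of_real (z \<bullet> b / N k) +
     (\<i> * of_real (2 * pi)) * complex_of_real (z \<bullet> v / N k)" for k :: nat and z :: "'a \<times> 'a"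
  have "norm (complex_of_real (- 2 * pi / N k)) \<le> 2 * pi" for k
    using N[of k] by (simp add: norm_divide field_simps)
  then have "poly_family N L"
    unfolding L_def by (intro poly_family.intros) (auto simp: norm_mult)
  moreover have "((\<lambda>t. chirp_mult (N k) (z + t *\<^sub>R b)) has_vector_derivative L k z * chirp_mult (N k) z) (at 0)" for k and z :: "'a \<times> 'a"
  proof -
    have 1: "((\<lambda>t. - pi * (norm (z + t *\<^sub>R b))\<^sup>2 / (N k)\<^sup>2) has_real_derivative - pi * (2 * (z \<bullet> b)) / (N k)\<^sup>2) (at 0)"
      by (intro DERIV_cdivide DERIV_cmult has_real_derivative_norm_sq_line)
    have "((\<lambda>t. pi * (norm ((fst z + snd z) + t *\<^sub>R (fst b + snd b)))\<^sup>2 / N k) has_real_derivative pi * (2 * ((fst z + snd z) \<bullet> (fst b + snd b))) / N k) (at 0)"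
      by (intro DERIV_cdivide DERIV_cmult has_real_derivative_norm_sq_line)
    then have 2: "((\<lambda>t. pi * (norm (fst (z + t *\<^sub>R b) + snd (z + t *\<^sub>R b)))\<^sup>2 / N k) has_real_derivative pi * (2 * (z \<bullet> v)) / N k) (at 0)"
      by (cases z) (simp add: v_def scaleR_add_right add_ac inner_add_left)
    have "of_real (- pi * (2 * (z \<bullet> b)) / (N k)\<^sup>2) + \<i> * of_real (pi * (2 * (z \<bullet> v)) / N k) = L k z"
      by (simp add: L_def power2_eq_square mult_ac)
    with has_vector_derivative_exp_cis[OF 1 2] show ?thesis
      by (simp add: chirp_mult_def)
  qed
  ultimately show "\<exists>L. poly_family N L \<and> (\<forall>k z. ((\<lambda>t. chirp_mult (N k) (z + t *\<^sub>R b)) has_vector_derivative L k z * chirp_mult (N k) z) (at 0))"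
    by blast
qed

lemma gauss_factor_gauss:
  assumes N: "M > 0"
  shows "gauss_factor (\<lambda>_. M) (\<lambda>_. gauss M :: 'a::euclidean_space \<Rightarrow> complex)"
  unfolding gauss_factor_def
proof (intro conjI allI ballI)
  show "continuous_on UNIV (gauss M :: 'a \<Rightarrow> complex)"
    unfolding gauss_def[abs_def] divide_inverse by (intro continuous_intros)
  show "norm (gauss M z) \<le> exp (- pi * (norm z / M)\<^sup>2)" for z :: 'a
    by (simp add: gauss_def power_divide)
  fix b :: 'a assume "b \<in> Basis"
  define L where "L k z = complex_of_real (- 2 * pi / M) * complex_of_real (z \<bullet> b / M)" for k :: nat and z :: 'a
  have "poly_family (\<lambda>_. M) L"
    unfolding L_def by (intro poly_family.intros) auto
  moreover have "((\<lambda>t. gauss M (z + t *\<^sub>R b)) has_vector_derivative L k z * gauss M z) (at 0)" for k z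
  proof -
    have 1: "((\<lambda>t. - pi * (norm (z + t *\<^sub>R b))\<^sup>2 / M\<^sup>2) has_real_derivative - pi * (2 * (z \<bullet> b)) / M\<^sup>2) (at 0)"
      by (intro DERIV_cdivide DERIV_cmult has_real_derivative_norm_sq_line)
    have eq: "of_real (- pi * (2 * (z \<bullet> b)) / M\<^sup>2) + \<i> * of_real 0 = L k z"
      by (simp add: L_def power2_eq_square mult_ac)
    show ?thesis
      using has_vector_derivative_exp_cis[OF 1 DERIV_const[of 0]] unfolding eq by (simp add: gauss_def)
  qed
  ultimately show "\<exists>L. poly_family (\<lambda>_. M) L \<and> (\<forall>k z. ((\<lambda>t. gauss M (z + t *\<^sub>R b)) has_vector_derivative L k z * gauss M z) (at 0))"
    by blast
qed

lemma schwartz_gauss: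
  assumes M: "M > 0"
  shows "schwartz (gauss M :: 'a::euclidean_space \<Rightarrow> complex)"
proof -
  \<comment> \<open>A single Gaussian is a series with one nonzero term.\<close>
  define \<delta> where "\<delta> k = (if k = 0 then 1 else 0 :: real)" for k :: nat
  have single: "(\<Sum>k. of_real (\<delta> k) * h k) = h 0" for h :: "nat \<Rightarrow> complex"
    using sums_unique[OF sums_single[of 0 h]] unfolding \<delta>_def
    by (simp add: if_distrib if_distribR cong: if_cong)
  have "\<delta> sums 1"
    using sums_single[of 0 "\<lambda>_. 1 :: real"] by (simp add: \<delta>_def[abs_def])
  then have \<delta>: "\<And>k. \<delta> k \<ge> 0" "summable \<delta>"
    by (auto simp: \<delta>_def sums_iff)
  let ?N = "\<lambda>_::nat. M" and ?E = "\<lambda>_::nat. gauss M :: 'a \<Rightarrow> complex"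
  have N: "\<And>k. 1 / ?N k \<le> 1 / M" "\<And>k. ?N k > 0" using M by auto
  note E = gauss_factor_gauss[OF M, where 'a='a]
  have "poly_family ?N (\<lambda>_ _. 1 :: complex)"
    by (rule poly_family.const[of _ 1]) simp
  then have f: "gauss M \<in> gauss_series \<delta> ?N ?E"
    unfolding gauss_series_def single by (auto intro!: exI[of _ "\<lambda>_ _. 1"])
  have it: "has_iter_partial \<alpha> (gauss M :: 'a \<Rightarrow> complex)" "iter_partial \<alpha> (gauss M) \<in> gauss_series \<delta> ?N ?E"
    if "multi_index \<alpha>" for \<alpha>
    using iter_partial_closed[OF gauss_series_deriv[OF \<delta> N E] f that] by auto
  have "C_class j (gauss M :: 'a \<Rightarrow> complex)" for j
    unfolding C_class_def using it gauss_series_continuous_bounded(1)[OF \<delta> N E] by auto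
  moreover have "bounded (range (\<lambda>x. norm x ^ j *\<^sub>R iter_partial \<alpha> (gauss M :: 'a \<Rightarrow> complex) x))" if \<alpha>: "multi_index \<alpha>" for \<alpha> j
  proof -
    obtain p where p: "poly_family ?N p" "iter_partial \<alpha> (gauss M :: 'a \<Rightarrow> complex) = (\<lambda>z. p 0 z * gauss M z)"
      using it(2)[OF \<alpha>] unfolding gauss_series_def single by auto
    obtain C where C: "C \<ge> 0" "\<And>z. (1 + norm z / M) ^ j * norm (p 0 z * gauss M z) \<le> C"
      using poly_family_gauss_bound[OF N(2) p(1) E, of j] by blast
    have "norm (norm x ^ j *\<^sub>R iter_partial \<alpha> (gauss M) x) \<le> M ^ j * C" for x
    proof -
      have "norm x \<le> M * (1 + norm x / M)"
        using M by (simp add: field_simps)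
      then have "norm x ^ j * norm (p 0 x * gauss M x) \<le> (M * (1 + norm x / M)) ^ j * norm (p 0 x * gauss M x)"
        by (intro mult_right_mono power_mono) auto
      also have "\<dots> = M ^ j * ((1 + norm x / M) ^ j * norm (p 0 x * gauss M x))"
        by (simp only: power_mult_distrib mult.assoc)
      also have "\<dots> \<le> M ^ j * C"
        using M by (intro mult_left_mono C) auto
      finally show ?thesis
        by (simp add: p(2))
    qed
    then show ?thesis
      by (auto simp: bounded_iff)
  qed
  ultimately show ?thesis
    by (simp add: schwartz_def)
qed

section \<open>Failure at the endpoint\<close>

text \<open>The base of the power in \<open>L1_bil_gauss_chirp_mult\<close>: a Gaussian of scale
  \<open>N\<close> and a chirp of scale \<open>K\<close> produce an output with L^1 norm
  \<open>chirp_ratio N K powr (n / 2)\<close>.\<close>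

definition chirp_ratio :: "real \<Rightarrow> real \<Rightarrow> real" where
  "chirp_ratio N K = sqrt ((1 / N\<^sup>2 + 1 / K\<^sup>2)\<^sup>2 / 4 + 1 / K\<^sup>2) / (1 / N\<^sup>2 + 1 / K\<^sup>2)\<^sup>2"

text \<open>With \<open>c = 1 / a\<close>, which is at most \<open>N^2\<close> and at most
  \<open>K^2\<close>, the ratio is bounded by \<open>c / 2 + c^2 / K\<close>. The second term
  reaches the order of \<open>N ^ 3\<close> when \<open>K\<close> is close to \<open>N\<close>. If
  \<open>K\<close> is at least \<open>N^2\<close> the denominator reduces it to \<open>N^2\<close>;
  if \<open>K^2\<close> is at most \<open>N\<close> then \<open>c\<close> itself is at most
  \<open>N\<close>.\<close>

lemma chirp_ratio_le:
  assumes N: "N \<ge> 1" and K: "K \<ge> 1" and sep: "K \<ge> N\<^sup>2 \<or> K\<^sup>2 \<le> N"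
  shows "chirp_ratio N K \<le> 2 * N\<^sup>2"
proof -
  define a where "a = 1 / N\<^sup>2 + 1 / K\<^sup>2"
  have a: "a > 0" using N K by (simp add: a_def add_pos_pos)
  define c where "c = 1 / a"
  have c: "c > 0" using a by (simp add: c_def)
  have "1 / N\<^sup>2 \<le> a" "1 / K\<^sup>2 \<le> a"
    using N K by (auto simp: a_def)
  then have cN: "c \<le> N\<^sup>2" and cK: "c \<le> K\<^sup>2"
    using a N K by (auto simp: c_def field_simps)
  have "sqrt (a\<^sup>2 / 4 + 1 / K\<^sup>2) \<le> a / 2 + 1 / K"
    using a K by (intro real_le_lsqrt) (auto simp: power2_sum power_divide)
  then have "chirp_ratio N K \<le> (a / 2 + 1 / K) / a\<^sup>2"
    unfolding chirp_ratio_def a_def[symmetric] by (intro divide_right_mono) auto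
  also have "\<dots> = c / 2 + c\<^sup>2 / K"
    using a by (simp add: c_def field_simps power2_eq_square)
  also have "c / 2 \<le> N\<^sup>2 / 2"
    using cN by simp
  also have "c\<^sup>2 / K \<le> N\<^sup>2"
  proof (cases "K \<ge> N\<^sup>2")
    case True
    have "c\<^sup>2 \<le> (N\<^sup>2)\<^sup>2"
      using c cN by (intro power_mono) auto
    also have "\<dots> = N\<^sup>2 * N\<^sup>2" by (rule power2_eq_square)
    also have "\<dots> \<le> N\<^sup>2 * K"
      using True by (intro mult_left_mono) auto
    finally show ?thesis
      using K by (simp add: pos_divide_le_eq)
  next
    case False
    with sep have "c \<le> N" using cK by auto
    then have "c\<^sup>2 \<le> N\<^sup>2"
      using c by (intro power_mono) auto
    also have "\<dots> \<le> N\<^sup>2 * K"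
      using K N by (simp add: mult_le_cancel_left1)
    finally show ?thesis
      using K by (simp add: pos_divide_le_eq)
  qed
  finally show ?thesis
    by (smt (verit) field_sum_of_halves zero_le_power2)
qed

text \<open>Keeping only the term \<open>1 / N^2\<close> under the root already gives the cube, one
  power of \<open>N\<close> more than for separated scales. This power is the source of the
  unboundedness.\<close>

lemma chirp_ratio_diag_ge:
  assumes N: "N \<ge> 1"
  shows "N ^ 3 / 4 \<le> chirp_ratio N N"
proof -
  have "1 / N = sqrt (1 / N\<^sup>2)"
    using N by (simp add: real_sqrt_divide)
  also have "\<dots> \<le> sqrt ((1 / N\<^sup>2 + 1 / N\<^sup>2)\<^sup>2 / 4 + 1 / N\<^sup>2)"
    by simp
  finally have "(1 / N) / (1 / N\<^sup>2 + 1 / N\<^sup>2)\<^sup>2 \<le> chirp_ratio N N"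
    unfolding chirp_ratio_def by (intro divide_right_mono) auto
  moreover have "(1 / N) / (1 / N\<^sup>2 + 1 / N\<^sup>2)\<^sup>2 = N ^ 3 / 4"
    using N by (simp add: field_simps power2_eq_square power3_eq_cube)
  ultimately show ?thesis by simp
qed

section \<open>Normalisation of the test functions and superposition of multipliers\<close>

lemma fourier_gauss:
  fixes \<xi> :: "'a::euclidean_space"
  assumes N: "N > 0"
  shows "fourier (gauss (1 / N)) \<xi> = of_real (N powr (- real DIM('a))) * gauss N \<xi>"
proof -
  have "fourier (gauss (1 / N)) \<xi> = (LINT x|lborel. complex_of_real (exp (- pi * N\<^sup>2 * (norm x)\<^sup>2)) * cis (2 * pi * (x \<bullet> (- \<xi>))))"
    unfolding fourier_cis gauss_def using N
    by (intro Bochner_Integration.integral_cong) (auto simp: power_one_over inner_commute mult_ac)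
  also have "\<dots> = complex_of_real (exp (- pi * (norm \<xi>)\<^sup>2 / N\<^sup>2) * (N\<^sup>2) powr (- real DIM('a) / 2))"
    using integral_gaussian_cis[of "N\<^sup>2" "- \<xi>"] N by simp
  also have "(N\<^sup>2) powr (- real DIM('a) / 2) = N powr (- real DIM('a))"
    using N by (simp add: powr_powr flip: powr_numeral)
  finally show ?thesis
    unfolding gauss_def[of N \<xi>] by (simp only: of_real_mult mult.commute)
qed

lemma Lp_norm_gauss:
  assumes N: "N > 0"
  shows "(Lp_norm 2 (gauss (1 / N) :: 'a::euclidean_space \<Rightarrow> complex))\<^sup>2 = (2 * N\<^sup>2) powr (- real DIM('a) / 2)"
proof -
  have "(LINT x|lborel. norm (gauss (1 / N) (x::'a)) powr 2) = (LINT x|lborel. exp (- pi * (2 * N\<^sup>2) * (norm (x::'a))\<^sup>2))"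
    using N by (intro Bochner_Integration.integral_cong)
      (auto simp: gauss_def power_one_over exp_double[symmetric])
  also have "\<dots> = (2 * N\<^sup>2) powr (- real DIM('a) / 2)"
    by (rule integral_gaussian) (use N in simp)
  finally show ?thesis
    by (simp add: Lp_norm_def powr_half_sqrt)
qed

lemma bil_scale:
  "bil (\<lambda>x. of_real a * F x) (\<lambda>x. of_real b * G x) m x = of_real (a * b) * bil F G m x"
proof -
  have "bil (\<lambda>x. of_real a * F x) (\<lambda>x. of_real b * G x) m x =
    (LINT p|lborel. of_real (a * b) * (m p * (F (fst p) * G (snd p) * cis (2 * pi * (x \<bullet> (fst p + snd p))))))"
    unfolding bil_def by (simp add: mult_ac)
  then show ?thesis
    unfolding integral_mult_right_zero bil_def .
qed

lemma bil_sums: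
  fixes F G :: "'a::euclidean_space \<Rightarrow> complex"
  assumes F: "integrable lborel F" and G: "integrable lborel G"
    and m: "\<And>k. m k \<in> borel_measurable borel" "\<And>k p. norm (m k p) \<le> 1"
    and \<delta>: "\<And>k. \<delta> k \<ge> 0" "summable \<delta>"
  shows "(\<lambda>k. of_real (\<delta> k) * bil F G (m k) x) sums bil F G (\<lambda>p. \<Sum>k. of_real (\<delta> k) * m k p) x"
proof -
  define h where "h p = F (fst p) * G (snd p) * cis (2 * pi * (x \<bullet> (fst p + snd p)))" for p :: "'a \<times> 'a"
  have mh: "integrable lborel (\<lambda>p. m k p * h p)" for k
    unfolding h_def by (rule integrable_bil[OF F G m])
  have h: "integrable lborel (\<lambda>p. norm (h p))"
    using integrable_bil[OF F G, of "\<lambda>_. 1" 1 x] by (simp add: h_def)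
  have le: "norm (of_real (\<delta> k) * (m k p * h p)) \<le> \<delta> k * norm (h p)" for k p
    using m(2)[of k p] \<delta>(1)[of k] by (auto simp: norm_mult intro!: mult_left_mono mult_left_le_one_le)
  have "(\<lambda>k. LINT p|lborel. of_real (\<delta> k) * (m k p * h p)) sums (LINT p|lborel. (\<Sum>k. of_real (\<delta> k) * (m k p * h p)))"
  proof (rule sums_integral)
    show "integrable lborel (\<lambda>p. of_real (\<delta> k) * (m k p * h p))" for k
      using mh by simp
    show "AE p in lborel. summable (\<lambda>k. norm (of_real (\<delta> k) * (m k p * h p)))"
      using le by (intro always_eventually allI summable_comparison_test'[OF summable_mult2[OF \<delta>(2)]]) auto
    show "summable (\<lambda>k. LINT p|lborel. norm (of_real (\<delta> k) * (m k p * h p)))"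
    proof (rule summable_comparison_test'[OF summable_mult2[OF \<delta>(2), of "LINT p|lborel. norm (h p)"]])
      fix k
      have "(LINT p|lborel. norm (of_real (\<delta> k) * (m k p * h p))) \<le> (LINT p|lborel. \<delta> k * norm (h p))"
        using mh h le by (intro integral_mono) auto
      then show "norm (LINT p|lborel. norm (of_real (\<delta> k) * (m k p * h p))) \<le> \<delta> k * (LINT p|lborel. norm (h p))"
        by simp
    qed
  qed
  moreover have "(\<Sum>k. of_real (\<delta> k) * (m k p * h p)) = (\<Sum>k. of_real (\<delta> k) * m k p) * h p" for p
  proof -
    have "summable (\<lambda>k. of_real (\<delta> k) * m k p)"
      using m(2)[of _ p] \<delta>(1) by (intro summable_comparison_test'[OF \<delta>(2)]) (auto simp: norm_mult intro!: mult_right_le_one_le)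
    from suminf_mult2[OF this, of "h p"] show ?thesis
      by (simp add: mult.assoc)
  qed
  ultimately show ?thesis
    by (simp add: bil_def h_def)
qed

lemma summable_double_exp:
  assumes c: "(c::real) > 0"
  shows "summable (\<lambda>k::nat. 2 powr (a * real k - c * 2 ^ k))"
proof (rule summable_comparison_test_ev)
  show "summable (\<lambda>k. (1 / 2 :: real) ^ k)"
    by (rule summable_geometric) simp
  have "(\<lambda>k. of_nat k / 2 ^ k) \<longlonglongrightarrow> (0::real)"
    by (rule lim_n_over_pown) simp
  moreover have "0 < c / (\<bar>a\<bar> + 1)" using c by simp
  ultimately have "\<forall>\<^sub>F k in sequentially. real k / 2 ^ k < c / (\<bar>a\<bar> + 1)"
    by (rule order_tendstoD)
  then show "\<forall>\<^sub>F k in sequentially. norm (2 powr (a * real k - c * 2 ^ k)) \<le> (1 / 2) ^ k"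
  proof eventually_elim
    case (elim k)
    then have "(\<bar>a\<bar> + 1) * real k < c * 2 ^ k"
      by (simp add: field_simps)
    moreover have "a * real k \<le> \<bar>a\<bar> * real k"
      by (intro mult_right_mono) auto
    ultimately have "a * real k - c * 2 ^ k \<le> - real k"
      by (simp add: algebra_simps)
    then have "2 powr (a * real k - c * 2 ^ k) \<le> 2 powr (- real k)"
      by (intro powr_mono) auto
    also have "\<dots> = (1 / 2) ^ k"
      by (simp add: powr_minus powr_realpow power_one_over inverse_eq_divide)
    finally show ?case by simp
  qed
qed

text \<open>The weights \<open>2 ^ k\<close> replace Minkowski's inequality: if no
  \<open>2 ^ k * u k\<close> exceeds \<open>s powr (1 / q)\<close>, the series is dominated by a
  geometric one. In the application \<open>s\<close> is the sum of all the powers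
  \<open>(2 ^ k * u k) powr q\<close>, which can be integrated term by term, and the extra factor
  \<open>2 ^ k\<close> is lost against doubly exponential decay.\<close>

lemma norm_suminf_powr_le:
  fixes u :: "nat \<Rightarrow> real" and s q :: real
  assumes u: "\<And>k. u k \<ge> 0" "summable u" and s: "\<And>k. (2 ^ k * u k) powr q \<le> s" and q: "q > 0"
  shows "(\<Sum>k. u k) powr q \<le> 2 powr q * s"
proof -
  have "s \<ge> 0" using s[of 0] by (rule order_trans[rotated]) simp
  have "u k \<le> s powr (1 / q) * (1 / 2) ^ k" for k
  proof -
    have "2 ^ k * u k = ((2 ^ k * u k) powr q) powr (1 / q)"
      using u q by (simp add: powr_powr)
    also have "\<dots> \<le> s powr (1 / q)"
      using s q by (intro powr_mono2) auto
    finally show ?thesis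
      by (simp add: power_one_over field_simps)
  qed
  then have "(\<Sum>k. u k) \<le> (\<Sum>k. s powr (1 / q) * (1 / 2) ^ k)"
    by (intro suminf_le u summable_mult summable_geometric) auto
  also have "\<dots> = 2 * s powr (1 / q)"
    by (subst suminf_mult) (auto simp: suminf_geometric summable_geometric)
  finally have "(\<Sum>k. u k) powr q \<le> (2 * s powr (1 / q)) powr q"
    using q u by (intro powr_mono2 suminf_nonneg) auto
  also have "\<dots> = 2 powr q * s"
    using q \<open>s \<ge> 0\<close> by (simp add: powr_mult powr_powr)
  finally show ?thesis .
qed

theorem ex_unbounded_multiplier:
  "\<exists>m :: 'a::euclidean_space \<times> 'a \<Rightarrow> complex. (\<forall>q>4. in_Lp q m) \<and> Linf_class m \<and> mult_norm m = \<infinity>"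
proof -
  define n where "n = real DIM('a)"
  have n: "n > 0" using DIM_positive[where 'a='a] by (simp add: n_def)
  \<comment> \<open>Each \<open>N k\<close> is the square of its predecessor, so any two distinct
    scales satisfy the separation condition of \<open>chirp_ratio_le\<close>, and every negative
    power of \<open>N k\<close> beats all geometric factors.\<close>
  define N where "N k = (2::real) powr (2 ^ k)" for k :: nat
  have N1: "1 \<le> N k" and N0: "N k > 0" for k by (auto simp: N_def intro: ge_one_powr_ge_zero)
  have Npowr: "N k powr t = 2 powr (2 ^ k * t)" for k t
    by (simp add: N_def powr_powr)
  \<comment> \<open>The power of \<open>N k\<close> balances the growth of the operator norm of a
    single chirp; the factor \<open>2 ^ k\<close> then makes the contributions unbounded without
    spoiling summability.\<close>
  define \<delta> where "\<delta> k = 2 ^ k * N k powr (- n / 2)" for k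
  have \<delta>_eq: "\<delta> k = 2 powr (1 * real k - n / 2 * 2 ^ k)" for k
    by (simp add: \<delta>_def Npowr powr_diff powr_minus_divide powr_realpow mult.commute)
  have \<delta>0: "\<delta> k > 0" for k by (simp add: \<delta>_eq)
  have "summable (\<lambda>k. \<delta> k)"
    unfolding \<delta>_eq by (rule summable_double_exp) (use n in simp)
  then have \<delta>: "\<And>k. \<delta> k \<ge> 0" "summable \<delta>"
    using \<delta>0 by (auto intro: less_imp_le)
  define m :: "'a \<times> 'a \<Rightarrow> complex" where "m z = (\<Sum>k. of_real (\<delta> k) * chirp_mult (N k) z)" for z
  let ?E = "\<lambda>k. chirp_mult (N k) :: 'a \<times> 'a \<Rightarrow> complex"
  have N': "1 / N k \<le> 1" for k using N1[of k] by simp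
  note E = gauss_factor_chirp_mult[of N, OF N1, where 'a='a]
  have "poly_family N (\<lambda>_ _. 1 :: complex)"
    by (rule poly_family.const[of _ 1]) simp
  then have mS: "m \<in> gauss_series \<delta> N ?E"
    unfolding gauss_series_def m_def by (auto intro!: exI[of _ "\<lambda>_ _. 1"])
  have Lc: "Linf_class m"
    by (rule Linf_class_gauss_series[OF \<delta> N' N0 E mS])
  have mm [measurable]: "m \<in> borel_measurable borel"
    by (intro borel_measurable_continuous_onI gauss_series_continuous_bounded(1)[OF \<delta> N' N0 E mS])
  obtain Bm where Bm: "norm (m z) \<le> Bm" for z
    using gauss_series_continuous_bounded(2)[OF \<delta> N' N0 E mS] by blast

  have Lq: "in_Lp q m" if q: "q > 4" for q
    unfolding in_Lp_def
  proof (intro conjI)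
    show "integrable lborel (\<lambda>z. norm (m z) powr q)"
    proof (rule integrableI_nonneg)
      define u where "u k z = \<delta> k * exp (- pi * (norm z)\<^sup>2 / (N k)\<^sup>2)" for k and z :: "'a \<times> 'a"
      have [measurable]: "u k \<in> borel_measurable borel" for k
        unfolding u_def by measurable
      have u0: "u k z \<ge> 0" for k z using \<delta> by (simp add: u_def)
      have us: "summable (\<lambda>k. u k z)" for z
        using \<delta>(1) by (intro summable_comparison_test'[OF \<delta>(2)]) (auto simp: u_def abs_mult intro!: mult_right_le_one_le)
      have m_u: "norm (m z) \<le> (\<Sum>k. u k z)" for z
        unfolding m_def by (rule norm_suminf_le[OF _ us]) (use \<delta>(1) in \<open>simp add: u_def norm_mult norm_chirp_mult\<close>)
      define S where "S z = (\<Sum>k. ennreal ((2 ^ k * u k z) powr q))" for z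
      have "ennreal (norm (m z) powr q) \<le> ennreal (2 powr q) * S z" for z
      proof (cases "S z")
        case top
        then show ?thesis by (simp add: ennreal_mult_top)
      next
        case (real s)
        have "(2 ^ k * u k z) powr q \<le> s" for k
        proof -
          have "(\<Sum>i\<in>{k}. ennreal ((2 ^ i * u i z) powr q)) \<le> S z"
            unfolding S_def by (rule sum_le_suminf) (auto intro: summableI)
          then have "ennreal ((2 ^ k * u k z) powr q) \<le> ennreal s"
            by (simp only: real sum.insert sum.empty finite.emptyI empty_iff not_False_eq_True add_0_right)
          then show ?thesis
            using \<open>0 \<le> s\<close> by (simp only: ennreal_le_iff)
        qed
        then have "(\<Sum>k. u k z) powr q \<le> 2 powr q * s"
          using q by (intro norm_suminf_powr_le u0 us) auto
        moreover have "norm (m z) powr q \<le> (\<Sum>k. u k z) powr q"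
          using m_u q by (intro powr_mono2) auto
        ultimately show ?thesis
          using real by (auto simp: ennreal_mult'[symmetric] intro!: ennreal_leI)
      qed
      then have "(\<integral>\<^sup>+z. ennreal (norm (m z) powr q) \<partial>lborel) \<le> (\<integral>\<^sup>+z. ennreal (2 powr q) * S z \<partial>lborel)"
        by (rule nn_integral_mono)
      also have "\<dots> = ennreal (2 powr q) * (\<integral>\<^sup>+z. S z \<partial>lborel)"
        unfolding S_def by (rule nn_integral_cmult) measurable
      also have "(\<integral>\<^sup>+z. S z \<partial>lborel) = (\<Sum>k. \<integral>\<^sup>+z. ennreal ((2 ^ k * u k z) powr q) \<partial>lborel)"
        unfolding S_def by (rule nn_integral_suminf) measurable
      \<comment> \<open>The integral of the Gaussian over dimension \<open>2 * n\<close> contributes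
        \<open>N k powr (2 * n)\<close> and the weight \<open>N k powr (- n * q / 2)\<close>. The
        total exponent \<open>- n * (q - 4) / 2\<close> is negative exactly for
        \<open>q > 4\<close>.\<close>
      also have "\<dots> = (\<Sum>k. ennreal (q powr (- n) * 2 powr ((2 * q) * real k - (n * (q - 4) / 2) * 2 ^ k)))"
      proof (rule suminf_cong)
        fix k
        have "(\<integral>\<^sup>+z. ennreal ((2 ^ k * u k z) powr q) \<partial>lborel) =
          (\<integral>\<^sup>+z. ennreal ((2 ^ k * \<delta> k) powr q) * ennreal (exp (- pi * (q / (N k)\<^sup>2) * (norm (z :: 'a \<times> 'a))\<^sup>2)) \<partial>lborel)"
        proof (rule nn_integral_cong)
          fix z :: "'a \<times> 'a"
          have "exp (- pi * (norm z)\<^sup>2 / (N k)\<^sup>2) powr q = exp (- pi * (q / (N k)\<^sup>2) * (norm z)\<^sup>2)"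
            by (simp add: exp_powr_real mult_ac)
          then have "(2 ^ k * u k z) powr q = (2 ^ k * \<delta> k) powr q * exp (- pi * (q / (N k)\<^sup>2) * (norm z)\<^sup>2)"
            unfolding u_def mult.assoc[symmetric] using \<delta> by (subst powr_mult) auto
          then show "ennreal ((2 ^ k * u k z) powr q) = ennreal ((2 ^ k * \<delta> k) powr q) * ennreal (exp (- pi * (q / (N k)\<^sup>2) * (norm z)\<^sup>2))"
            by (simp add: ennreal_mult)
        qed
        also have "\<dots> = ennreal ((2 ^ k * \<delta> k) powr q) * ennreal ((q / (N k)\<^sup>2) powr (- real DIM('a \<times> 'a) / 2))"
          using q N0[of k] by (subst nn_integral_cmult, measurable, subst nn_integral_gaussian) auto
        also have "\<dots> = ennreal ((2 ^ k * \<delta> k) powr q * (q / (N k)\<^sup>2) powr (- n))"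
          by (simp add: ennreal_mult n_def)
        also have "(q / (N k)\<^sup>2) powr (- n) = q powr (- n) * N k powr (2 * n)"
          using q N0[of k] by (simp add: powr_divide powr_powr powr_minus_divide flip: powr_numeral)
        also have "2 ^ k * \<delta> k = 2 powr (2 * real k - n / 2 * 2 ^ k)"
        proof -
          have "(2::real) ^ k = 2 powr real k" by (simp add: powr_realpow)
          then have "2 ^ k * \<delta> k = 2 powr (real k + (1 * real k - n / 2 * 2 ^ k))"
            by (simp only: \<delta>_eq powr_add)
          then show ?thesis by simp
        qed
        also have "(2 powr (2 * real k - n / 2 * 2 ^ k)) powr q * (q powr (- n) * N k powr (2 * n)) =
           q powr (- n) * (2 powr ((2 * real k - n / 2 * 2 ^ k) * q) * 2 powr (2 ^ k * (2 * n)))"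
          by (simp add: Npowr powr_powr mult_ac)
        also have "2 powr ((2 * real k - n / 2 * 2 ^ k) * q) * 2 powr (2 ^ k * (2 * n)) = 2 powr ((2 * q) * real k - (n * (q - 4) / 2) * 2 ^ k)"
          unfolding powr_add[symmetric] by (simp add: algebra_simps diff_divide_distrib)
        finally show "(\<integral>\<^sup>+z. ennreal ((2 ^ k * u k z) powr q) \<partial>lborel) = ennreal (q powr (- n) * 2 powr ((2 * q) * real k - (n * (q - 4) / 2) * 2 ^ k))" .
      qed
      finally have *: "(\<integral>\<^sup>+z. ennreal (norm (m z) powr q) \<partial>lborel) \<le>
        ennreal (2 powr q) * (\<Sum>k. ennreal (q powr (- n) * 2 powr ((2 * q) * real k - (n * (q - 4) / 2) * 2 ^ k)))" .
      have "(\<Sum>k. ennreal (q powr (- n) * 2 powr ((2 * q) * real k - (n * (q - 4) / 2) * 2 ^ k))) < \<infinity>"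
      proof -
        have "summable (\<lambda>k. q powr (- n) * 2 powr ((2 * q) * real k - (n * (q - 4) / 2) * 2 ^ k))"
          using n q by (intro summable_mult summable_double_exp) auto
        then show ?thesis
          by (subst suminf_ennreal2) auto
      qed
      then have "ennreal (2 powr q) * (\<Sum>k. ennreal (q powr (- n) * 2 powr ((2 * q) * real k - (n * (q - 4) / 2) * 2 ^ k))) < \<infinity>"
        by (simp add: ennreal_mult_less_top)
      with * show "(\<integral>\<^sup>+z. ennreal (norm (m z) powr q) \<partial>lborel) < \<infinity>"
        by (rule order_le_less_trans)
    qed auto
  qed auto

  define b where "b k j = bil (gauss (N k)) (gauss (N k)) (?E j)" for k j
  have mb [measurable]: "b k j \<in> borel_measurable borel" for k j
    unfolding b_def by (intro measurable_bil measurable_chirp_mult measurable_gauss)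
  define S where "S = (\<Sum>j. \<delta> j)"
  have bL1: "(\<integral>\<^sup>+x. ennreal (norm (b k j x)) \<partial>lborel) = ennreal (chirp_ratio (N k) (N j) powr (n / 2))" for k j
    unfolding b_def n_def chirp_ratio_def by (rule L1_bil_gauss_chirp_mult[OF N0 N0])
  have off: "chirp_ratio (N k) (N j) \<le> 2 * (N k)\<^sup>2" if "j \<noteq> k" for k j
  proof (rule chirp_ratio_le[OF N1 N1])
    have sq: "(N i)\<^sup>2 \<le> N l" if "i < l" for i l
    proof -
      have "(N i)\<^sup>2 = 2 powr (2 ^ Suc i)"
        unfolding N_def power2_eq_square powr_add[symmetric] by simp
      also have "\<dots> \<le> N l"
        unfolding N_def using that by (intro powr_mono power_increasing) auto
      finally show ?thesis .
    qed
    show "N j \<ge> (N k)\<^sup>2 \<or> (N j)\<^sup>2 \<le> N k"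
      using sq[of j k] sq[of k j] that by (auto simp: neq_iff)
  qed
  \<comment> \<open>The diagonal term has size \<open>N k powr (- n / 2)\<close> times
    \<open>(N k ^ 3) powr (n / 2)\<close>, that is \<open>N k powr n\<close>, with the factor
    \<open>2 ^ k\<close> left over.\<close>
  have ge: "ennreal (2 ^ k * (4 powr (- n / 2) * N k powr n)) \<le> (\<integral>\<^sup>+x. ennreal (norm (of_real (\<delta> k) * b k k x)) \<partial>lborel)" for k
  proof -
    have "4 powr (- n / 2) * N k powr n = N k powr (- n / 2) * ((N k) ^ 3 / 4) powr (n / 2)"
    proof -
      have "N k powr (- n / 2) * ((N k) ^ 3 / 4) powr (n / 2) = N k powr (- n / 2) * (N k powr (3 * n / 2) / 4 powr (n / 2))"
        using N0[of k] by (simp add: powr_divide powr_powr flip: powr_numeral)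
      also have "\<dots> = (N k powr (- n / 2) * N k powr (3 * n / 2)) * 4 powr (- n / 2)"
        by (simp add: powr_minus_divide)
      also have "N k powr (- n / 2) * N k powr (3 * n / 2) = N k powr n"
        by (simp add: powr_add[symmetric])
      finally show ?thesis by simp
    qed
    also have "\<dots> \<le> N k powr (- n / 2) * chirp_ratio (N k) (N k) powr (n / 2)"
      using chirp_ratio_diag_ge[OF N1[of k]] N0[of k] n by (intro mult_left_mono powr_mono2) auto
    finally have "2 ^ k * (4 powr (- n / 2) * N k powr n) \<le> \<delta> k * chirp_ratio (N k) (N k) powr (n / 2)"
      unfolding \<delta>_def by (simp add: mult.assoc)
    then have "ennreal (2 ^ k * (4 powr (- n / 2) * N k powr n)) \<le> ennreal (\<delta> k) * (\<integral>\<^sup>+x. ennreal (norm (b k k x)) \<partial>lborel)"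
      unfolding bL1 using \<delta> by (simp add: ennreal_mult[symmetric] ennreal_leI)
    also have "\<dots> = (\<integral>\<^sup>+x. ennreal (norm (of_real (\<delta> k) * b k k x)) \<partial>lborel)"
      using \<delta> by (subst nn_integral_cmult[symmetric]) (auto simp: norm_mult ennreal_mult)
    finally show ?thesis .
  qed
  \<comment> \<open>Isolates the \<open>k\<close>-th term of the series. Every other term is bounded
    by its weight times \<open>(2 * (N k)^2) powr (n / 2)\<close>, which carries the same power
    \<open>N k powr n\<close> as the diagonal term but not the factor \<open>2 ^ k\<close>.\<close>
  have le: "(\<integral>\<^sup>+x. ennreal (norm (of_real (\<delta> k) * b k k x)) \<partial>lborel) \<le>
     (\<integral>\<^sup>+x. ennreal (norm (bil (gauss (N k)) (gauss (N k)) m x)) \<partial>lborel) + ennreal (S * (2 powr (n / 2) * N k powr n))" for k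
  proof -
    define t where "t j x = (if j = k then 0 else of_real (\<delta> j) * b k j x)" for j x
    have [measurable]: "t j \<in> borel_measurable borel" for j
      unfolding t_def by measurable
    have "ennreal (norm (of_real (\<delta> k) * b k k x)) \<le> ennreal (norm (bil (gauss (N k)) (gauss (N k)) m x)) + (\<Sum>j. ennreal (norm (t j x)))" for x
    proof (cases "(\<Sum>j. ennreal (norm (t j x))) = \<infinity>")
      case False
      then have sm: "summable (\<lambda>j. norm (t j x))"
        by (intro summable_suminf_not_top) auto
      have "(\<lambda>j. of_real (\<delta> j) * b k j x) sums bil (gauss (N k)) (gauss (N k)) m x"
        unfolding b_def m_def
        by (rule bil_sums[OF integrable_gauss[OF N0] integrable_gauss[OF N0] measurable_chirp_mult norm_chirp_mult_le_1 \<delta>])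
      moreover have "(\<lambda>j. if j = k then of_real (\<delta> k) * b k k x else 0) sums (of_real (\<delta> k) * b k k x)"
        by (rule sums_single)
      ultimately have "(\<lambda>j. of_real (\<delta> j) * b k j x - (if j = k then of_real (\<delta> k) * b k k x else 0)) sums
         (bil (gauss (N k)) (gauss (N k)) m x - of_real (\<delta> k) * b k k x)"
        by (rule sums_diff)
      moreover have "(\<lambda>j. of_real (\<delta> j) * b k j x - (if j = k then of_real (\<delta> k) * b k k x else 0)) = (\<lambda>j. t j x)"
        by (auto simp: t_def)
      ultimately have "(\<Sum>j. t j x) = bil (gauss (N k)) (gauss (N k)) m x - of_real (\<delta> k) * b k k x"
        by (simp add: sums_iff)
      then have "norm (of_real (\<delta> k) * b k k x) \<le> norm (bil (gauss (N k)) (gauss (N k)) m x) + norm (\<Sum>j. t j x)"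
        by (metis diff_add_cancel norm_minus_commute norm_triangle_sub add.commute)
      also have "norm (\<Sum>j. t j x) \<le> (\<Sum>j. norm (t j x))"
        by (rule summable_norm[OF sm])
      finally have "ennreal (norm (of_real (\<delta> k) * b k k x)) \<le> ennreal (norm (bil (gauss (N k)) (gauss (N k)) m x) + (\<Sum>j. norm (t j x)))"
        by (simp add: ennreal_leI del: ennreal_plus)
      also have "\<dots> = ennreal (norm (bil (gauss (N k)) (gauss (N k)) m x)) + (\<Sum>j. ennreal (norm (t j x)))"
        using sm by (subst ennreal_plus) (auto simp: suminf_nonneg suminf_ennreal2)
      finally show ?thesis .
    qed simp
    then have "(\<integral>\<^sup>+x. ennreal (norm (of_real (\<delta> k) * b k k x)) \<partial>lborel) \<le>
       (\<integral>\<^sup>+x. ennreal (norm (bil (gauss (N k)) (gauss (N k)) m x)) + (\<Sum>j. ennreal (norm (t j x))) \<partial>lborel)"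
      by (rule nn_integral_mono)
    also have "\<dots> = (\<integral>\<^sup>+x. ennreal (norm (bil (gauss (N k)) (gauss (N k)) m x)) \<partial>lborel) + (\<integral>\<^sup>+x. (\<Sum>j. ennreal (norm (t j x))) \<partial>lborel)"
      using measurable_bil[OF measurable_gauss measurable_gauss mm] by (intro nn_integral_add) auto
    also have "(\<integral>\<^sup>+x. (\<Sum>j. ennreal (norm (t j x))) \<partial>lborel) = (\<Sum>j. \<integral>\<^sup>+x. ennreal (norm (t j x)) \<partial>lborel)"
      by (rule nn_integral_suminf) measurable
    also have "\<dots> \<le> (\<Sum>j. ennreal (\<delta> j * (2 powr (n / 2) * N k powr n)))"
    proof (intro suminf_le)
      fix j
      show "(\<integral>\<^sup>+x. ennreal (norm (t j x)) \<partial>lborel) \<le> ennreal (\<delta> j * (2 powr (n / 2) * N k powr n))"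
      proof (cases "j = k")
        case False
        have "(2 * (N k)\<^sup>2) powr (n / 2) = 2 powr (n / 2) * N k powr n"
          using N0[of k] by (simp add: powr_mult powr_powr flip: powr_numeral)
        moreover have "chirp_ratio (N k) (N j) powr (n / 2) \<le> (2 * (N k)\<^sup>2) powr (n / 2)"
          using off[OF False] n by (intro powr_mono2) (auto simp: chirp_ratio_def)
        ultimately have "\<delta> j * chirp_ratio (N k) (N j) powr (n / 2) \<le> \<delta> j * (2 powr (n / 2) * N k powr n)"
          using \<delta> by (intro mult_left_mono) auto
        moreover have "(\<integral>\<^sup>+x. ennreal (norm (t j x)) \<partial>lborel) = ennreal (\<delta> j) * (\<integral>\<^sup>+x. ennreal (norm (b k j x)) \<partial>lborel)"
          using \<delta> False by (subst nn_integral_cmult[symmetric]) (auto simp: t_def norm_mult ennreal_mult)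
        ultimately show ?thesis
          unfolding bL1 using \<delta> by (simp add: ennreal_mult[symmetric] ennreal_leI)
      qed (simp add: t_def)
    qed auto
    also have "\<dots> = ennreal (S * (2 powr (n / 2) * N k powr n))"
      using \<delta> unfolding S_def by (intro suminf_ennreal_eq sums_mult2 summable_sums) auto
    finally show ?thesis
      by (simp add: add_left_mono)
  qed

  have "mult_norm m = \<infinity>"
    unfolding mult_norm_def
  proof (rule Inf_eqI)
    fix A :: ennreal
    assume "A \<in> {A. \<forall>f g. schwartz f \<and> schwartz g \<longrightarrow>
      L1_norm (bilinear_mult m f g) \<le> A * ennreal (Lp_norm 2 f) * ennreal (Lp_norm 2 g)}"
    then have A: "L1_norm (bilinear_mult m f g) \<le> A * ennreal (Lp_norm 2 f) * ennreal (Lp_norm 2 g)"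
      if "schwartz f" "schwartz g" for f g using that by auto
    show "\<infinity> \<le> A"
    proof (cases A)
      case (real r)
      have "2 ^ k * 4 powr (- n / 2) \<le> r * 2 powr (- n / 2) + S * 2 powr (n / 2)" for k
      proof -
        define f where "f = (gauss (1 / N k) :: 'a \<Rightarrow> complex)"
        \<comment> \<open>\<open>c\<close> is the amplitude of the Fourier transform of
          \<open>f\<close> and, up to \<open>2 powr (- n / 2)\<close>, also the squared L^2 norm of
          \<open>f\<close>. As \<open>N k powr n = 1 / c\<close>, every term of the final inequality
          carries one factor \<open>c\<close>, and cancelling it leaves a bound for
          \<open>2 ^ k\<close> that does not depend on \<open>k\<close>.\<close>
        define c where "c = N k powr (- n)"
        have c: "c > 0" using N0[of k] by (simp add: c_def)
        have f: "schwartz f"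
          unfolding f_def using N0[of k] by (intro schwartz_gauss) simp
        have Ff: "fourier f = (\<lambda>\<xi>. of_real c * gauss (N k) \<xi>)"
          unfolding f_def c_def n_def by (rule ext, rule fourier_gauss[OF N0])
        let ?I = "\<integral>\<^sup>+x. ennreal (norm (bil (gauss (N k)) (gauss (N k)) m x)) \<partial>lborel"
        have "L1_norm (bilinear_mult m f f) = (\<integral>\<^sup>+x. ennreal (c * c) * ennreal (norm (bil (gauss (N k)) (gauss (N k)) m x)) \<partial>lborel)"
          unfolding L1_norm_def bilinear_mult_eq_bil[OF f f mm Bm] Ff bil_scale
          using c by (intro nn_integral_cong) (simp add: norm_mult ennreal_mult[symmetric] abs_mult)
        also have "\<dots> = ennreal (c * c) * ?I"
          using measurable_bil[OF measurable_gauss measurable_gauss mm] by (intro nn_integral_cmult) auto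
        finally have "ennreal (c * c) * ?I \<le> A * ennreal (Lp_norm 2 f) * ennreal (Lp_norm 2 f)"
          using A[OF f f] by simp
        also have "\<dots> = A * ennreal ((Lp_norm 2 f)\<^sup>2)"
          by (simp add: mult.assoc power2_eq_square ennreal_mult Lp_norm_def)
        also have "(Lp_norm 2 f)\<^sup>2 = (2 * (N k)\<^sup>2) powr (- n / 2)"
          unfolding f_def n_def by (rule Lp_norm_gauss[OF N0])
        also have "\<dots> = 2 powr (- n / 2) * c"
          using N0[of k] by (simp add: c_def powr_mult powr_powr flip: powr_numeral)
        also have "A * ennreal (2 powr (- n / 2) * c) = ennreal (r * 2 powr (- n / 2) * c)"
          using real c by (simp add: ennreal_mult'[symmetric] mult.assoc)
        finally have 1: "ennreal (c * c) * ?I \<le> ennreal (r * 2 powr (- n / 2) * c)" .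
        have Nc: "N k powr n = 1 / c"
          by (simp add: c_def powr_minus inverse_eq_divide)
        have S0: "S \<ge> 0" using \<delta> by (simp add: S_def suminf_nonneg)
        have "ennreal (c * c) * ennreal (2 ^ k * (4 powr (- n / 2) * N k powr n)) \<le>
            ennreal (c * c) * (?I + ennreal (S * (2 powr (n / 2) * N k powr n)))"
          using order_trans[OF ge le, of k] by (rule mult_left_mono) simp
        also have "\<dots> \<le> ennreal (r * 2 powr (- n / 2) * c) + ennreal (c * c) * ennreal (S * (2 powr (n / 2) * N k powr n))"
          unfolding distrib_left by (intro add_right_mono 1)
        finally have "ennreal (2 ^ k * 4 powr (- n / 2) * c) \<le> ennreal (r * 2 powr (- n / 2) * c + S * 2 powr (n / 2) * c)"
          using c S0 real unfolding Nc by (simp add: ennreal_mult[symmetric] field_simps)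
        then have "2 ^ k * 4 powr (- n / 2) * c \<le> r * 2 powr (- n / 2) * c + S * 2 powr (n / 2) * c"
          using c S0 real by (subst (asm) ennreal_le_iff) auto
        then have "(2 ^ k * 4 powr (- n / 2)) * c \<le> (r * 2 powr (- n / 2) + S * 2 powr (n / 2)) * c"
          by (simp add: algebra_simps)
        then show ?thesis
          using c by (rule mult_right_le_imp_le)
      qed
      then have bnd: "2 ^ k \<le> (r * 2 powr (- n / 2) + S * 2 powr (n / 2)) / 4 powr (- n / 2)" for k
        by (simp add: pos_le_divide_eq)
      obtain k where "(r * 2 powr (- n / 2) + S * 2 powr (n / 2)) / 4 powr (- n / 2) < 2 ^ k"
        using real_arch_pow[of 2] by auto
      with bnd[of k] show ?thesis by simp
    qed simp
  qed auto
  with Lq Lc show ?thesis by blast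
qed

theorem theorem1p3:
  shows "(\<forall>q::real. 1 \<le> q \<and> q < 4 \<longrightarrow>
            (let M = nat \<lfloor>2 * real CARD('n::finite) / (4 - q)\<rfloor> + 1 in
             \<exists>C>0. \<forall>(m :: (real^'n) \<times> (real^'n) \<Rightarrow> complex) (C0::real).
               in_Lp q m \<and> C_class M m \<and> 0 \<le> C0 \<and>
               (\<forall>\<alpha>. multi_index \<alpha> \<and> length \<alpha> \<le> M \<longrightarrow>
                  Linf_norm (iter_partial \<alpha> m) \<le> ennreal C0) \<longrightarrow>
               mult_norm m \<le> ennreal (C * C0 powr (1 - q / 4) * Lp_norm q m powr (q / 4))))
       \<and> (\<exists>m :: (real^'n) \<times> (real^'n) \<Rightarrow> complex.
            (\<forall>q>4. in_Lp q m) \<and> Linf_class m \<and> mult_norm m = \<infinity>)"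
proof (intro conjI allI impI)
  fix q :: real assume "1 \<le> q \<and> q < 4"
  then have q: "1 \<le> q" "q < 4" by auto
  define M where "M = nat \<lfloor>2 * real CARD('n) / (4 - q)\<rfloor> + 1"
  \<comment> \<open>The \<open>+ 1\<close> makes the inequality strict even when the quotient is an
    integer; strictness is what gives convergence of the sum over the scales.\<close>
  have "2 * real CARD('n) / (4 - q) < real M"
    unfolding M_def using q by linarith
  then have "2 * real DIM(real^'n) < real M * (4 - q)"
    using q by (simp add: pos_divide_less_eq)
  from mult_norm_le[OF q this] obtain D where D: "D > 0"
    "\<And>(m :: (real^'n) \<times> (real^'n) \<Rightarrow> complex) C. in_Lp q m \<Longrightarrow> C_class M m \<Longrightarrow> C \<ge> 0 \<Longrightarrow>
      (\<And>\<alpha>. multi_index \<alpha> \<Longrightarrow> length \<alpha> \<le> M \<Longrightarrow> Linf_norm (iter_partial \<alpha> m) \<le> ennreal C) \<Longrightarrow>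
      mult_norm m \<le> ennreal (D * C powr (1 - q / 4) * Lp_norm q m powr (q / 4))"
    by blast
  then show "let M = nat \<lfloor>2 * real CARD('n) / (4 - q)\<rfloor> + 1 in
     \<exists>C>0. \<forall>(m :: (real^'n) \<times> (real^'n) \<Rightarrow> complex) (C0::real).
       in_Lp q m \<and> C_class M m \<and> 0 \<le> C0 \<and>
       (\<forall>\<alpha>. multi_index \<alpha> \<and> length \<alpha> \<le> M \<longrightarrow> Linf_norm (iter_partial \<alpha> m) \<le> ennreal C0) \<longrightarrow>
       mult_norm m \<le> ennreal (C * C0 powr (1 - q / 4) * Lp_norm q m powr (q / 4))"
    unfolding M_def[symmetric] Let_def by (intro exI[of _ D]) auto
qed (rule ex_unbounded_multiplier)

end
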